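(* Let $1\le p\le\infty$ and let $A,B,C\in\mathcal{QT}_p$, with $$A=T(a)+E_a,\qquad B=T(b)+E_b,\qquad C=T(c)+E_c,$$ where $a,b,c\in\mathcal W$ and $E_a,E_b,E_c$ are compact operators on $\ell^p$. Assume that $\sigma(A)\cap\sigma(-B)=\emptyset$, and let $X$ be the solution (a bounded operator on $\ell^p$) of $AX+XB+C=0$. Then $X$ can be decomposed as $X=T(x)+E_x$, where $x\in\mathcal W$ is given by $x(z)=-c(z)\,(a(z)+b(z))^{-1}$, and $E_x$ is a compact operator on $\ell^p$ that solves the correction equation $$AE_x+E_xB+\hat C=0,\qquad \hat C:=C+A\,T(x)+T(x)\,B.$$
   Context: $\mathcal W$ (the Wiener algebra) is the set of Laurent series $a(z)=\sum_{j\in\mathbb Z}a_jz^j$ with complex coefficients such that $\sum_{j\in\mathbb Z}|a_j|<\infty$, regarded as functions on the unit circle. For $a\in\mathcal W$, $T(a)=[a_{j-i}]_{i,j\ge1}$ is the semi-infinite Toeplitz matrix with symbol $a$ (row index $i$, column index $j$), acting as a bounded operator on $\ell^p$, the space of complex $p$-summable (bounded if $p=\infty$) sequences indexed by the positive integers. $\mathcal{QT}_p$ is the set of bounded operators on $\ell^p$ of the form $T(a)+E$ with $a\in\mathcal W$ and $E$ a compact operator on $\ell^p$. $\sigma(\cdot)$ is the spectrum of an operator on $\ell^p$. *)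

theory Defs
  imports "HOL-Analysis.Analysis" "HOL-Library.Function_Algebras"
begin

text \<open>
  The exponent \<open>p\<close> is a value, so \<open>\<ell>\<^sup>p\<close> is a carrier set inside \<open>nat \<Rightarrow> complex\<close>. Entry \<open>i\<close> of a
  sequence is the entry with index \<open>i + 1\<close> in the usual numbering by positive integers; Toeplitz
  matrices are insensitive to this shift.
\<close>

definition lp :: "ennreal \<Rightarrow> (nat \<Rightarrow> complex) set" where
  "lp p = (if p = \<infinity> then {v. bounded (range v)}
           else {v. summable (\<lambda>i. norm (v i) powr enn2real p)})"

definition lp_norm :: "ennreal \<Rightarrow> (nat \<Rightarrow> complex) \<Rightarrow> real" where
  "lp_norm p v = (if p = \<infinity> then (SUP i. norm (v i))
                  else (\<Sum>i. norm (v i) powr enn2real p) powr (1 / enn2real p))"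

text \<open>The value \<open>0\<close> off the carrier is there because \<open>Metric_space\<close> wants \<open>0 \<le> d x y\<close> unconditionally.\<close>

definition lp_dist :: "ennreal \<Rightarrow> (nat \<Rightarrow> complex) \<Rightarrow> (nat \<Rightarrow> complex) \<Rightarrow> real" where
  "lp_dist p v w = (if v \<in> lp p \<and> w \<in> lp p then lp_norm p (v - w) else 0)"

abbreviation lp_topology :: "ennreal \<Rightarrow> (nat \<Rightarrow> complex) topology" where
  "lp_topology p \<equiv> Metric_space.mtopology (lp p) (lp_dist p)"

abbreviation lp_bounded :: "ennreal \<Rightarrow> (nat \<Rightarrow> complex) set \<Rightarrow> bool" where
  "lp_bounded p \<equiv> Metric_space.mbounded (lp p) (lp_dist p)"

text \<open>
  Operators on \<open>\<ell>\<^sup>p\<close> are total functions on sequences of which only the values on \<open>lp p\<close> matter;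
  accordingly, \<open>op_eq p\<close> is equality of operators on \<open>\<ell>\<^sup>p\<close>. Sums, negation and \<open>0\<close> are pointwise.
\<close>

type_synonym seq_op = "(nat \<Rightarrow> complex) \<Rightarrow> (nat \<Rightarrow> complex)"

definition op_eq :: "ennreal \<Rightarrow> seq_op \<Rightarrow> seq_op \<Rightarrow> bool" where
  "op_eq p A B \<longleftrightarrow> (\<forall>v\<in>lp p. A v = B v)"

definition bounded_op :: "ennreal \<Rightarrow> seq_op \<Rightarrow> bool" where
  "bounded_op p A \<longleftrightarrow>
     (\<forall>v\<in>lp p. A v \<in> lp p) \<and>
     (\<forall>v\<in>lp p. \<forall>w\<in>lp p. A (v + w) = A v + A w) \<and>
     (\<forall>k. \<forall>v\<in>lp p. A (\<lambda>i. k * v i) = (\<lambda>i. k * A v i)) \<and>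
     (\<exists>K. \<forall>v\<in>lp p. lp_norm p (A v) \<le> K * lp_norm p v)"

definition compact_op :: "ennreal \<Rightarrow> seq_op \<Rightarrow> bool" where
  "compact_op p E \<longleftrightarrow> bounded_op p E \<and>
     (\<forall>S \<subseteq> lp p. lp_bounded p S \<longrightarrow> compactin (lp_topology p) (lp_topology p closure_of (E ` S)))"

definition scalar_op :: "complex \<Rightarrow> seq_op" where
  "scalar_op k v = (\<lambda>i. k * v i)"

definition invertible_op :: "ennreal \<Rightarrow> seq_op \<Rightarrow> bool" where
  "invertible_op p A \<longleftrightarrow> (\<exists>R. bounded_op p R \<and> op_eq p (R \<circ> A) id \<and> op_eq p (A \<circ> R) id)"

definition op_spectrum :: "ennreal \<Rightarrow> seq_op \<Rightarrow> complex set" where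
  "op_spectrum p A = {k. \<not> invertible_op p (A - scalar_op k)}"

text \<open>
  A Laurent series is given by its coefficient family; \<open>laurent_eval a\<close> is the function it defines
  on the unit circle.
\<close>

definition wiener :: "(int \<Rightarrow> complex) set" where
  "wiener = {a. (\<lambda>j. norm (a j)) summable_on UNIV}"

definition laurent_eval :: "(int \<Rightarrow> complex) \<Rightarrow> complex \<Rightarrow> complex" where
  "laurent_eval a z = (\<Sum>\<^sub>\<infinity>j. a j * z powi j)"

definition toeplitz :: "(int \<Rightarrow> complex) \<Rightarrow> seq_op" where
  "toeplitz a v = (\<lambda>i. \<Sum>\<^sub>\<infinity>j. a (int j - int i) * v j)"

definition quasi_toeplitz :: "ennreal \<Rightarrow> seq_op set" where
  "quasi_toeplitz p = {A. bounded_op p A \<and>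
     (\<exists>a\<in>wiener. \<exists>E. compact_op p E \<and> op_eq p A (toeplitz a + E))}"

text \<open>\<open>lp_topology\<close> and \<open>lp_bounded\<close> are meaningful only because \<open>lp_dist p\<close> is a metric:\<close>

lemma minkowski_aux:
  fixes f g :: "nat \<Rightarrow> real" and r :: real
  assumes r: "1 \<le> r" and f: "\<And>i. 0 \<le> f i" and g: "\<And>i. 0 \<le> g i"
    and F: "summable (\<lambda>i. f i powr r)" and G: "summable (\<lambda>i. g i powr r)"
  shows "summable (\<lambda>i. (f i + g i) powr r)"
    and "(\<Sum>i. (f i + g i) powr r) powr (1/r)
          \<le> (\<Sum>i. f i powr r) powr (1/r) + (\<Sum>i. g i powr r) powr (1/r)"
proof -
  have shrink: "(u * y) powr r \<le> u * y powr r" if "0 \<le> u" "u \<le> 1" "0 \<le> y" for u y :: real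
    using that r powr_mono'[of 1 r u] by (simp add: powr_mult mult_right_mono)
  have cvx: "(u * x + (1 - u) * y) powr r \<le> u * x powr r + (1 - u) * y powr r"
    if u: "0 \<le> u" "u \<le> 1" and x: "0 \<le> x" and y: "0 \<le> y" for u x y :: real
  proof (cases "x = 0 \<or> y = 0")
    case True
    then show ?thesis using shrink[of "1 - u" y] shrink[of u x] u x y r by auto
  next
    case False
    then show ?thesis
      using convex_onD[OF powr_convex[OF r], of u y x] u x y by (simp add: algebra_simps)
  qed
  have bound: "(f i + g i) powr r
      \<le> (s + t) powr r * ((s/(s+t)) * (f i powr r / s powr r) + (t/(s+t)) * (g i powr r / t powr r))"
    if s: "0 < s" and t: "0 < t" for s t :: real and i
  proof -
    have t1: "t/(s+t) = 1 - s/(s+t)" using s t by (simp add: field_simps)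
    have e: "f i + g i = (s + t) * ((s/(s+t)) * (f i/s) + (t/(s+t)) * (g i/t))"
    proof -
      have "(s/(s+t)) * (f i/s) = f i / (s+t)" "(t/(s+t)) * (g i/t) = g i / (s+t)"
        using s t by simp_all
      then show ?thesis using s t by (simp flip: add_divide_distrib)
    qed
    have "(f i + g i) powr r
        = (s + t) powr r * ((s/(s+t)) * (f i/s) + (t/(s+t)) * (g i/t)) powr r"
      by (subst e, subst powr_mult) (use s t f g in auto)
    also have "\<dots> \<le> (s + t) powr r * ((s/(s+t)) * (f i/s) powr r + (t/(s+t)) * (g i/t) powr r)"
      unfolding t1 by (intro mult_left_mono cvx) (use s t f g in auto)
    finally show ?thesis using s t f g by (simp add: powr_divide)
  qed
  have sm: "summable (\<lambda>i. (s + t) powr r *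
      ((s/(s+t)) * (f i powr r / s powr r) + (t/(s+t)) * (g i powr r / t powr r)))" for s t
    by (intro summable_mult summable_add summable_divide F G)
  show S: "summable (\<lambda>i. (f i + g i) powr r)"
    by (rule summable_comparison_test'[OF sm[of 1 1], where N=0]) (use bound[of 1 1] in simp)
  let ?F = "\<Sum>i. f i powr r" and ?G = "\<Sum>i. g i powr r"
  have F0: "0 \<le> ?F" and G0: "0 \<le> ?G" by (simp_all add: suminf_nonneg F G)
  show "(\<Sum>i. (f i + g i) powr r) powr (1/r) \<le> ?F powr (1/r) + ?G powr (1/r)"
  proof (cases "?F = 0 \<or> ?G = 0")
    case True
    then show ?thesis
    proof
      assume "?F = 0"
      then have "\<And>i. f i powr r = 0" using suminf_eq_zero_iff[OF F] by auto
      then show ?thesis by simp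
    next
      assume "?G = 0"
      then have "\<And>i. g i powr r = 0" using suminf_eq_zero_iff[OF G] by auto
      then show ?thesis by simp
    qed
  next
    case False
    define s t where "s = ?F powr (1/r)" and "t = ?G powr (1/r)"
    have s: "0 < s" and t: "0 < t" using False F0 G0 by (auto simp: s_def t_def)
    have sr: "s powr r = ?F" and tr: "t powr r = ?G"
      using r F0 G0 by (auto simp: s_def t_def powr_powr)
    have "(\<Sum>i. (f i + g i) powr r) \<le> (\<Sum>i. (s + t) powr r *
      ((s/(s+t)) * (f i powr r / s powr r) + (t/(s+t)) * (g i powr r / t powr r)))"
      by (rule suminf_le[OF bound[OF s t] S sm])
    also have "\<dots> = (s + t) powr r * ((s/(s+t)) * (?F / s powr r) + (t/(s+t)) * (?G / t powr r))"
      by (subst suminf_mult suminf_add[symmetric] suminf_divide | intro summable_mult summable_add summable_divide F G)+ simp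
    also have "\<dots> = (s + t) powr r"
      using False s t unfolding sr tr by (simp flip: add_divide_distrib)
    finally have "(\<Sum>i. (f i + g i) powr r) powr (1/r) \<le> ((s + t) powr r) powr (1/r)"
      by (intro powr_mono2) (use r S in \<open>auto intro: suminf_nonneg\<close>)
    also have "\<dots> = s + t" using r s t by (simp add: powr_powr)
    finally show ?thesis by (simp add: s_def t_def)
  qed
qed

lemma lp_norm_triangle:
  assumes p: "1 \<le> p" and v: "v \<in> lp p" and w: "w \<in> lp p"
  shows "v + w \<in> lp p" and "lp_norm p (v + w) \<le> lp_norm p v + lp_norm p w"
proof -
  have "v + w \<in> lp p \<and> lp_norm p (v + w) \<le> lp_norm p v + lp_norm p w"
  proof (cases "p = \<infinity>")
    case True
    then have bv: "bdd_above (range (\<lambda>i. norm (v i)))" and bw: "bdd_above (range (\<lambda>i. norm (w i)))"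
      using v w by (auto simp: lp_def bounded_iff bdd_above_def)
    have le: "norm ((v + w) i) \<le> (SUP i. norm (v i)) + (SUP i. norm (w i))" for i
      using norm_triangle_ineq[of "v i" "w i"] cSUP_upper[OF UNIV_I bv, of i]
        cSUP_upper[OF UNIV_I bw, of i] by simp
    then have "bounded (range (v + w))" unfolding bounded_iff by blast
    moreover have "(SUP i. norm ((v + w) i)) \<le> (SUP i. norm (v i)) + (SUP i. norm (w i))"
      by (rule cSUP_least) (use le in auto)
    ultimately show ?thesis using True by (simp add: lp_def lp_norm_def)
  next
    case False
    define r where "r = enn2real p"
    have r: "1 \<le> r"
      using p False enn2real_mono[of 1 p] by (simp add: r_def top.not_eq_extremum)
    have vs: "summable (\<lambda>i. norm (v i) powr r)" and ws: "summable (\<lambda>i. norm (w i) powr r)"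
      using v w False by (simp_all add: lp_def r_def)
    note M = minkowski_aux[OF r norm_ge_zero norm_ge_zero vs ws]
    have le: "norm ((v + w) i) powr r \<le> (norm (v i) + norm (w i)) powr r" for i
      using r by (intro powr_mono2) (auto intro: norm_triangle_ineq)
    have S: "summable (\<lambda>i. norm ((v + w) i) powr r)"
      by (rule summable_comparison_test'[OF M(1), where N=0]) (use le in simp)
    have "(\<Sum>i. norm ((v + w) i) powr r) powr (1/r)
        \<le> (\<Sum>i. (norm (v i) + norm (w i)) powr r) powr (1/r)"
      by (intro powr_mono2 suminf_le[OF le S M(1)]) (use r S in \<open>auto intro: suminf_nonneg\<close>)
    with M(2) S False show ?thesis by (simp add: lp_def lp_norm_def r_def)
  qed
  then show "v + w \<in> lp p" and "lp_norm p (v + w) \<le> lp_norm p v + lp_norm p w" by auto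
qed

lemma lp_norm_minus:
  "- v \<in> lp p \<longleftrightarrow> v \<in> lp p" "lp_norm p (- v) = lp_norm p v"
  by (auto simp: lp_def lp_norm_def bounded_iff)

lemma lp_norm_eq_0:
  assumes p: "1 \<le> p" and v: "v \<in> lp p"
  shows "0 \<le> lp_norm p v" and "lp_norm p v = 0 \<longleftrightarrow> v = 0"
proof -
  have "0 \<le> lp_norm p v \<and> (lp_norm p v = 0 \<longleftrightarrow> v = 0)"
  proof (cases "p = \<infinity>")
    case True
    then have bv: "bdd_above (range (\<lambda>i. norm (v i)))"
      using v by (auto simp: lp_def bounded_iff bdd_above_def)
    have u: "norm (v i) \<le> lp_norm p v" for i
      using cSUP_upper[OF UNIV_I bv, of i] True by (simp add: lp_norm_def)
    have "0 \<le> lp_norm p v" using u[of 0] norm_ge_zero order_trans by blast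
    moreover have "v = 0" if "lp_norm p v = 0" using u that by (auto simp: fun_eq_iff)
    moreover have "lp_norm p 0 = 0" using True by (simp add: lp_norm_def)
    ultimately show ?thesis by auto
  next
    case False
    then have "summable (\<lambda>i. norm (v i) powr enn2real p)" using v by (simp add: lp_def)
    from suminf_eq_zero_iff[OF this] False show ?thesis
      by (auto simp: lp_norm_def fun_eq_iff)
  qed
  then show "0 \<le> lp_norm p v" and "lp_norm p v = 0 \<longleftrightarrow> v = 0" by auto
qed

lemma Metric_space_lp:
  assumes p: "1 \<le> p"
  shows "Metric_space (lp p) (lp_dist p)"
proof
  have d: "v - w \<in> lp p" if "v \<in> lp p" "w \<in> lp p" for v w
    using lp_norm_triangle(1)[OF p that(1), of "- w"] that by (simp add: lp_norm_minus)
  show "0 \<le> lp_dist p v w" for v w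
    using lp_norm_eq_0(1)[OF p d[of v w]] by (simp add: lp_dist_def)
  show "lp_dist p v w = lp_dist p w v" for v w
    using lp_norm_minus(2)[of p "v - w"] by (simp add: lp_dist_def)
  show "lp_dist p v w = 0 \<longleftrightarrow> v = w" if "v \<in> lp p" "w \<in> lp p" for v w
    using lp_norm_eq_0(2)[OF p d[OF that]] that by (simp add: lp_dist_def)
  show "lp_dist p u w \<le> lp_dist p u v + lp_dist p v w"
    if "u \<in> lp p" "v \<in> lp p" "w \<in> lp p" for u v w
    using lp_norm_triangle(2)[OF p d[OF that(1,2)] d[OF that(2,3)]] that by (simp add: lp_dist_def)
qed

end

theory Submission
  imports Defs
begin

text \<open>
  The image of the unit circle under \<open>a\<close> lies in \<open>\<sigma>(A)\<close>, because a compact perturbation cannot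
  destroy a sequence of approximate eigenvectors with disjoint supports; likewise for \<open>- b\<close> and
  \<open>\<sigma>(- B)\<close>. Hence \<open>a(z) + b(w) \<noteq> 0\<close> for all \<open>z\<close>, \<open>w\<close> on the circle, not only for \<open>z = w\<close>, and by
  Wiener's lemma on the torus \<open>1 / (a(z) + b(w)) = \<Sum> g\<^sub>k\<^sub>l z\<^sup>k w\<^sup>l\<close> with \<open>g\<close> absolutely summable.
  Modulo compact operators \<open>T(a) X + X T(b) = - T(c)\<close>. Let \<open>S\<^sub>k = T(z\<^sup>k)\<close>. Since \<open>S\<^sub>k S\<^sub>l - S\<^sub>k\<^sub>+\<^sub>l\<close> is
  compact, applying \<open>Z \<mapsto> \<Sum> g\<^sub>k\<^sub>l S\<^sub>k Z S\<^sub>l\<close> to both sides turns the left side into \<open>X\<close> and the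
  right side into \<open>T(x)\<close>, again modulo compact operators.
\<close>

section \<open>Absolutely summable families\<close>

no_notation Infinite_Set_Sum.abs_summable_on (infix "abs'_summable'_on" 50)

text \<open>The formula for \<open>x\<close> involves only a(z) + b(z), but nothing is known
  beforehand about how \<open>X\<close> interacts with shifts. Multiplying \<open>X\<close> by
  shifts from the left and from the right therefore gives two independent variables, and the
  function to be inverted is a(z) + b(w) on the whole torus. The variables merge only on T(c), where
  shifts on both sides combine with the symbol up to compact operators; this is the origin of the
  diagonal z = w in the formula for \<open>x\<close>. Only functions are inverted, never operators
  modulo compact ones, so no quotient algebra occurs. Compactness is handled as total boundedness of
  the image of the unit ball: it survives sums, composition with bounded operators and absolutely
  convergent series, the latter because finite sums approximate uniformly on the unit ball, for
  every exponent. The difficulty in producing \<open>g\<close> is that a sup norm does not control a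
  sum of moduli of coefficients. For powers of a trigonometric polynomial the loss is only a
  polynomial factor, which a geometric series absorbs.\<close>

definition l1_norm :: "('i \<Rightarrow> complex) \<Rightarrow> real" where
  "l1_norm c = (\<Sum>\<^sub>\<infinity>k. norm (c k))"

lemma l1_norm_nonneg: "0 \<le> l1_norm c"
  unfolding l1_norm_def by (rule infsum_nonneg) simp

lemma wiener_iff: "a \<in> wiener \<longleftrightarrow> a abs_summable_on UNIV"
  by (simp add: wiener_def)

lemma abs_summable_mult_bounded:
  fixes c u :: "'i \<Rightarrow> complex"
  assumes "c abs_summable_on A" and "\<And>k. norm (u k) \<le> B"
  shows "(\<lambda>k. c k * u k) abs_summable_on A"
proof (rule Infinite_Sum.abs_summable_on_comparison_test')
  show "(\<lambda>k. norm (c k) * B) summable_on A"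
    by (intro summable_on_cmult_left assms(1))
  show "norm (c k * u k) \<le> norm (c k) * B" if "k \<in> A" for k
    using assms(2)[of k] by (simp add: norm_mult mult_left_mono)
qed

lemma l1_norm_mult_bounded_le:
  fixes c u :: "'i \<Rightarrow> complex"
  assumes c: "c abs_summable_on UNIV" and u: "\<And>k. norm (u k) \<le> B"
  shows "norm (\<Sum>\<^sub>\<infinity>k. c k * u k) \<le> l1_norm c * B"
proof -
  have "norm (\<Sum>\<^sub>\<infinity>k. c k * u k) \<le> (\<Sum>\<^sub>\<infinity>k. norm (c k * u k))"
    by (rule norm_infsum_bound) (rule abs_summable_mult_bounded[OF assms])
  also have "\<dots> \<le> (\<Sum>\<^sub>\<infinity>k. norm (c k) * B)"
    by (intro infsum_mono abs_summable_mult_bounded[OF assms] summable_on_cmult_left c)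
      (use u in \<open>simp add: norm_mult mult_left_mono\<close>)
  also have "\<dots> = l1_norm c * B"
    unfolding l1_norm_def by (rule infsum_cmult_left) (use c in simp)
  finally show ?thesis .
qed

lemma sum_norm_le_l1_norm:
  assumes "c abs_summable_on UNIV" and "finite F"
  shows "(\<Sum>k\<in>F. norm (c k)) \<le> l1_norm c"
  unfolding l1_norm_def by (rule finite_sum_le_infsum) (use assms in auto)

lemma l1_norm_mono:
  assumes "d abs_summable_on UNIV" and "\<And>k. norm (c k) \<le> norm (d k)"
  shows "c abs_summable_on UNIV" and "l1_norm c \<le> l1_norm d"
proof -
  show c: "c abs_summable_on UNIV"
    by (rule Infinite_Sum.abs_summable_on_comparison_test[OF assms(1)]) (use assms(2) in simp)
  show "l1_norm c \<le> l1_norm d"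
    unfolding l1_norm_def by (rule infsum_mono[OF c assms(1)]) (use assms(2) in simp)
qed

lemma abs_summable_add:
  fixes c d :: "'i \<Rightarrow> complex"
  assumes c: "c abs_summable_on UNIV" and d: "d abs_summable_on UNIV"
  shows "(\<lambda>k. c k + d k) abs_summable_on UNIV"
    and "l1_norm (\<lambda>k. c k + d k) \<le> l1_norm c + l1_norm d"
proof -
  have s: "(\<lambda>k. norm (c k) + norm (d k)) summable_on UNIV"
    by (rule summable_on_add[OF c d])
  show a: "(\<lambda>k. c k + d k) abs_summable_on UNIV"
    by (rule Infinite_Sum.abs_summable_on_comparison_test'[OF s]) (rule norm_triangle_ineq)
  show "l1_norm (\<lambda>k. c k + d k) \<le> l1_norm c + l1_norm d"
    unfolding l1_norm_def infsum_add[OF c d, symmetric]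
    by (rule infsum_mono[OF a s]) (rule norm_triangle_ineq)
qed

lemma abs_summable_scale:
  fixes c :: "'i \<Rightarrow> complex"
  assumes c: "c abs_summable_on UNIV"
  shows "(\<lambda>k. r * c k) abs_summable_on UNIV"
    and "l1_norm (\<lambda>k. r * c k) = norm r * l1_norm c"
  by (auto simp: l1_norm_def norm_mult infsum_cmult_right' intro: summable_on_cmult_right c)

lemma abs_summable_uminus:
  fixes c :: "'i \<Rightarrow> complex"
  shows "(\<lambda>k. - c k) abs_summable_on UNIV \<longleftrightarrow> c abs_summable_on UNIV"
  by simp

lemma abs_summable_finite_support:
  fixes c :: "'i \<Rightarrow> complex"
  assumes "finite F" and "\<And>k. k \<notin> F \<Longrightarrow> c k = 0"
  shows "c abs_summable_on UNIV" and "l1_norm c = (\<Sum>k\<in>F. norm (c k))"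
proof -
  have "(\<lambda>k. norm (c k)) summable_on F" using assms(1) by simp
  then show "c abs_summable_on UNIV"
    by (rule summable_on_cong_neutral[THEN iffD1, rotated 3]) (use assms in auto)
  show "l1_norm c = (\<Sum>k\<in>F. norm (c k))"
    unfolding l1_norm_def infsum_finite[OF assms(1), symmetric]
    by (rule infsum_cong_neutral) (use assms in auto)
qed

text \<open>The bound covers all larger index sets, so that a caller may enlarge \<open>F\<close> to
  a set of convenient shape such as a lattice box.\<close>

lemma l1_norm_tail:
  fixes c :: "'i \<Rightarrow> complex"
  assumes c: "c abs_summable_on UNIV" and e: "0 < e"
  obtains F where "finite F" and "\<And>G. F \<subseteq> G \<Longrightarrow> l1_norm (\<lambda>k. if k \<in> G then 0 else c k) \<le> e"
proof -
  obtain F where F: "finite F" "dist (\<Sum>k\<in>F. norm (c k)) (\<Sum>\<^sub>\<infinity>k. norm (c k)) \<le> e"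
    using infsum_finite_approximation[OF c e] by auto
  have "l1_norm (\<lambda>k. if k \<in> G then 0 else c k) \<le> e" if G: "F \<subseteq> G" for G
  proof -
    have "l1_norm (\<lambda>k. if k \<in> G then 0 else c k) \<le> l1_norm (\<lambda>k. if k \<in> F then 0 else c k)"
      by (intro l1_norm_mono(2) l1_norm_mono(1)[OF c]) (use G in auto)
    also have "\<dots> = (\<Sum>\<^sub>\<infinity>k\<in>-F. norm (c k))"
      unfolding l1_norm_def by (rule infsum_cong_neutral) auto
    also have "\<dots> = (\<Sum>\<^sub>\<infinity>k. norm (c k)) - (\<Sum>k\<in>F. norm (c k))"
      using infsum_Un_disjoint[of "\<lambda>k. norm (c k)" F "- F"] F(1)
        summable_on_subset_banach[OF c, of "- F"] by (simp add: Un_commute)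
    also have "\<dots> \<le> e" using F(2) by (simp add: dist_real_def)
    finally show ?thesis .
  qed
  with F(1) that show thesis by blast
qed

lemma abs_summable_tensor:
  fixes c :: "'i \<Rightarrow> complex" and d :: "'j \<Rightarrow> complex"
  assumes c: "c abs_summable_on UNIV" and d: "d abs_summable_on UNIV"
  shows "(\<lambda>(k, m). c k * d m) abs_summable_on UNIV"
    and "l1_norm (\<lambda>(k, m). c k * d m) = l1_norm c * l1_norm d"
proof -
  have "(\<lambda>(k, m). c k * d m) abs_summable_on Sigma UNIV (\<lambda>_. UNIV)"
    unfolding Infinite_Sum.abs_summable_on_Sigma_iff
    using abs_summable_scale(1)[OF d]
    by (auto simp: norm_mult infsum_cmult_right' abs_mult infsum_nonneg
        intro!: summable_on_cmult_left c summable_on_cmult_right d)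
  then show s: "(\<lambda>(k, m). c k * d m) abs_summable_on UNIV" by simp
  have "l1_norm (\<lambda>(k, m). c k * d m) = (\<Sum>\<^sub>\<infinity>k. \<Sum>\<^sub>\<infinity>m. norm (c k) * norm (d m))"
    unfolding l1_norm_def
    using infsum_Sigma_banach[of "\<lambda>x. norm (case x of (k, m) \<Rightarrow> c k * d m)" UNIV "\<lambda>_. UNIV"] s
    by (simp add: norm_mult)
  also have "\<dots> = l1_norm c * l1_norm d"
    by (simp add: infsum_cmult_right' infsum_cmult_left' l1_norm_def)
  finally show "l1_norm (\<lambda>(k, m). c k * d m) = l1_norm c * l1_norm d" .
qed

lemma infsum_tensor:
  fixes c :: "'i \<Rightarrow> complex" and d :: "'j \<Rightarrow> complex" and u :: "'i \<Rightarrow> 'j \<Rightarrow> complex"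
  assumes c: "c abs_summable_on UNIV" and d: "d abs_summable_on UNIV"
    and u: "\<And>k m. norm (u k m) \<le> B"
  shows "(\<Sum>\<^sub>\<infinity>(k, m). c k * d m * u k m) = (\<Sum>\<^sub>\<infinity>k. c k * (\<Sum>\<^sub>\<infinity>m. d m * u k m))"
proof -
  have "(\<lambda>x. (case x of (k, m) \<Rightarrow> c k * d m) * (case x of (k, m) \<Rightarrow> u k m)) abs_summable_on UNIV"
    by (rule abs_summable_mult_bounded[OF abs_summable_tensor(1)[OF c d]]) (use u in auto)
  then have s: "(\<lambda>(k, m). c k * d m * u k m) summable_on Sigma UNIV (\<lambda>_. UNIV)"
    using abs_summable_summable by (auto simp: case_prod_unfold)
  from infsum_Sigma_banach[OF s] show ?thesis
    by (simp add: mult.assoc infsum_cmult_right')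
qed

text \<open>The image under \<open>\<phi>\<close> of the complex measure with masses
  \<open>f\<close>. Convolution is the push of a tensor family along addition, a one-variable series
  enters the torus by a push along \<open>\<lambda>k. (k, 0)\<close>, and setting w = z is a push
  along the total degree.\<close>

definition push :: "('i \<Rightarrow> 'j) \<Rightarrow> ('i \<Rightarrow> complex) \<Rightarrow> 'j \<Rightarrow> complex" where
  "push \<phi> f n = (\<Sum>\<^sub>\<infinity>i\<in>\<phi> -` {n}. f i)"

lemma abs_summable_fibres:
  fixes f :: "'i \<Rightarrow> complex"
  assumes "f abs_summable_on UNIV"
  shows "(\<lambda>(n, i). f i) abs_summable_on Sigma UNIV (\<lambda>n. \<phi> -` {n})"
proof -
  have b: "bij_betw (\<lambda>i. (\<phi> i, i)) UNIV (Sigma UNIV (\<lambda>n. \<phi> -` {n}))"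
    by (rule bij_betwI[where g=snd]) auto
  show ?thesis
    using summable_on_reindex_bij_betw[OF b, of "\<lambda>(n, i). norm (f i)"] assms
    by (simp add: case_prod_unfold)
qed

lemma infsum_fibres:
  fixes f :: "'i \<Rightarrow> 'a :: banach"
  shows "(\<Sum>\<^sub>\<infinity>x\<in>Sigma UNIV (\<lambda>n. \<phi> -` {n}). f (snd x)) = (\<Sum>\<^sub>\<infinity>i. f i)"
proof -
  have b: "bij_betw (\<lambda>i. (\<phi> i, i)) UNIV (Sigma UNIV (\<lambda>n. \<phi> -` {n}))"
    by (rule bij_betwI[where g=snd]) auto
  show ?thesis
    using infsum_reindex_bij_betw[OF b, of "\<lambda>x. f (snd x)"] by simp
qed

lemma abs_summable_push:
  assumes f: "f abs_summable_on UNIV"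
  shows "push \<phi> f abs_summable_on UNIV" and "l1_norm (push \<phi> f) \<le> l1_norm f"
proof -
  note S = abs_summable_fibres[OF f, of \<phi>]
  have f': "f abs_summable_on A" for A using summable_on_subset_banach[OF f] by simp
  have n: "norm (push \<phi> f n) \<le> (\<Sum>\<^sub>\<infinity>i\<in>\<phi> -` {n}. norm (f i))" for n
    unfolding push_def by (rule norm_infsum_bound[OF f'])
  have s: "(\<lambda>n. \<Sum>\<^sub>\<infinity>i\<in>\<phi> -` {n}. norm (f i)) summable_on UNIV"
    using summable_on_Sigma_banach[of "\<lambda>n i. norm (f i)" UNIV] S by (simp add: case_prod_unfold)
  show p: "push \<phi> f abs_summable_on UNIV"
    by (rule Infinite_Sum.abs_summable_on_comparison_test'[OF s n])
  have "l1_norm (push \<phi> f) \<le> (\<Sum>\<^sub>\<infinity>n. \<Sum>\<^sub>\<infinity>i\<in>\<phi> -` {n}. norm (f i))"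
    unfolding l1_norm_def by (rule infsum_mono[OF p s n])
  also have "\<dots> = l1_norm f"
    using infsum_Sigma_banach[of "\<lambda>x. norm (f (snd x))" UNIV "\<lambda>n. \<phi> -` {n}"] S
      infsum_fibres[of "\<lambda>i. norm (f i)" \<phi>]
    by (simp add: case_prod_unfold l1_norm_def)
  finally show "l1_norm (push \<phi> f) \<le> l1_norm f" .
qed

text \<open>Change of variables for the image measure; boundedness of \<open>u\<close> keeps the
  regrouping by fibres absolutely convergent.\<close>

lemma infsum_push:
  fixes u :: "'j \<Rightarrow> complex"
  assumes f: "f abs_summable_on UNIV" and u: "\<And>n. norm (u n) \<le> B"
  shows "(\<Sum>\<^sub>\<infinity>n. push \<phi> f n * u n) = (\<Sum>\<^sub>\<infinity>i. f i * u (\<phi> i))"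
proof -
  have "(\<lambda>i. f i * u (\<phi> i)) abs_summable_on UNIV"
    by (rule abs_summable_mult_bounded[OF f u])
  then have s: "(\<lambda>x. f (snd x) * u (\<phi> (snd x))) summable_on Sigma UNIV (\<lambda>n. \<phi> -` {n})"
    using abs_summable_summable[OF abs_summable_fibres] by (fastforce simp: case_prod_unfold)
  have "push \<phi> f n * u n = (\<Sum>\<^sub>\<infinity>i\<in>\<phi> -` {n}. f i * u (\<phi> i))" for n
    unfolding push_def infsum_cmult_left'[symmetric] by (rule infsum_cong) auto
  then show ?thesis
    using infsum_Sigma_banach[OF s] infsum_fibres[of "\<lambda>i. f i * u (\<phi> i)" \<phi>] by simp
qed

section \<open>Wiener's lemma on the torus\<close>

definition torus :: "(complex \<times> complex) set" where
  "torus = {t. norm (fst t) = 1 \<and> norm (snd t) = 1}"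

definition character :: "int \<times> int \<Rightarrow> complex \<times> complex \<Rightarrow> complex" where
  "character k t = fst t powi fst k * snd t powi snd k"

lemma compact_torus: "compact torus"
proof -
  have "torus = sphere 0 1 \<times> sphere 0 1" by (auto simp: torus_def)
  then show ?thesis by (metis compact_Times compact_sphere)
qed

lemma norm_character: "t \<in> torus \<Longrightarrow> norm (character k t) = 1"
  by (simp add: torus_def character_def norm_mult norm_power_int)

lemma character_add: "t \<in> torus \<Longrightarrow> character (k + m) t = character k t * character m t"
  by (subgoal_tac "fst t \<noteq> 0 \<and> snd t \<noteq> 0")
    (auto simp: torus_def character_def power_int_add)

lemma cnj_character: "t \<in> torus \<Longrightarrow> cnj (character k t) = character (- k) t"
proof -
  assume t: "t \<in> torus"
  have "character k t * character (- k) t = 1"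
    using character_add[OF t, of k "- k"] by (simp add: character_def)
  moreover have "character k t * cnj (character k t) = 1"
    using norm_character[OF t, of k] complex_norm_square[of "character k t"] by simp
  ultimately show ?thesis by (metis mult_cancel_left zero_neq_one mult_zero_left)
qed

lemma continuous_on_character: "continuous_on torus (character k)"
  unfolding character_def by (intro continuous_intros) (auto simp: torus_def)

text \<open>A relation between coefficients and functions: algebra is done pointwise on the function
  side, and the families are carried along.\<close>

definition wiener_rep :: "(int \<times> int \<Rightarrow> complex) \<Rightarrow> (complex \<times> complex \<Rightarrow> complex) \<Rightarrow> bool" where
  "wiener_rep c F \<longleftrightarrow> c abs_summable_on UNIV \<and> (\<forall>t\<in>torus. (\<Sum>\<^sub>\<infinity>k. c k * character k t) = F t)"

lemma wiener_repD:
  assumes "wiener_rep c F"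
  shows "c abs_summable_on UNIV" and "t \<in> torus \<Longrightarrow> (\<Sum>\<^sub>\<infinity>k. c k * character k t) = F t"
  using assms by (auto simp: wiener_rep_def)

lemma character_summable:
  assumes "c abs_summable_on UNIV" and "t \<in> torus"
  shows "(\<lambda>k. c k * character k t) summable_on UNIV"
  using abs_summable_summable[OF abs_summable_mult_bounded[OF assms(1), of "\<lambda>k. character k t" 1]]
    norm_character[OF assms(2)] by simp

lemma wiener_rep_norm_le:
  assumes "wiener_rep c F" and t: "t \<in> torus"
  shows "norm (F t) \<le> l1_norm c"
  using l1_norm_mult_bounded_le[of c "\<lambda>k. character k t" 1] norm_character[OF t]
    wiener_repD[OF assms(1)] t by simp

lemma wiener_rep_add:
  assumes "wiener_rep c F" and "wiener_rep d G"
  shows "wiener_rep (\<lambda>k. c k + d k) (\<lambda>t. F t + G t)"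
  using assms unfolding wiener_rep_def
  by (auto simp: abs_summable_add distrib_right infsum_add character_summable)

lemma wiener_rep_scale:
  assumes "wiener_rep c F"
  shows "wiener_rep (\<lambda>k. r * c k) (\<lambda>t. r * F t)"
  using assms unfolding wiener_rep_def
  by (auto simp: abs_summable_scale mult.assoc infsum_cmult_right')

lemma wiener_rep_cong:
  assumes "wiener_rep c F" and "\<And>t. t \<in> torus \<Longrightarrow> F t = G t"
  shows "wiener_rep c G"
  using assms by (auto simp: wiener_rep_def)

lemma wiener_rep_diff:
  assumes "wiener_rep c F" and "wiener_rep d G"
  shows "wiener_rep (\<lambda>k. c k - d k) (\<lambda>t. F t - G t)"
  using wiener_rep_add[OF assms(1) wiener_rep_scale[OF assms(2), of "-1"]] by simp

lemma wiener_rep_const: "wiener_rep (\<lambda>k. if k = 0 then r else 0) (\<lambda>t. r)"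
proof -
  have "(\<Sum>\<^sub>\<infinity>k. (if k = 0 then r else 0) * character k t) = (\<Sum>\<^sub>\<infinity>k\<in>{0}. r * character k t)" for t
    by (rule infsum_cong_neutral) auto
  then show ?thesis
    using abs_summable_finite_support(1)[of "{0 :: int \<times> int}" "\<lambda>k. if k = 0 then r else 0"]
    by (auto simp: wiener_rep_def character_def)
qed

text \<open>Fubini for the tensor family together with multiplicativity of characters; the norm
  bound feeds the estimates for powers.\<close>

lemma wiener_rep_mult:
  assumes c: "wiener_rep c F" and d: "wiener_rep d G"
  shows "wiener_rep (push (\<lambda>(k, m). k + m) (\<lambda>(k, m). c k * d m)) (\<lambda>t. F t * G t)"
    and "l1_norm (push (\<lambda>(k, m). k + m) (\<lambda>(k, m). c k * d m)) \<le> l1_norm c * l1_norm d"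
proof -
  note C = wiener_repD[OF c] and D = wiener_repD[OF d]
  note T = abs_summable_tensor[OF C(1) D(1)]
  let ?p = "push (\<lambda>(k, m). k + m) (\<lambda>(k, m). c k * d m)"
  show "l1_norm ?p \<le> l1_norm c * l1_norm d"
    using abs_summable_push(2)[OF T(1)] T(2) by simp
  have "(\<Sum>\<^sub>\<infinity>k. ?p k * character k t) = F t * G t" if t: "t \<in> torus" for t
  proof -
    have b: "norm (character k t) \<le> 1" for k using norm_character[OF t] by simp
    have "(\<Sum>\<^sub>\<infinity>k. ?p k * character k t) =
        (\<Sum>\<^sub>\<infinity>(k, m). c k * d m * (character k t * character m t))"
      using infsum_push[OF T(1) b, of "\<lambda>(k, m). k + m" "\<lambda>k. k"] by (simp add: case_prod_unfold character_add[OF t])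
    also have "\<dots> = (\<Sum>\<^sub>\<infinity>k. c k * (\<Sum>\<^sub>\<infinity>m. d m * (character k t * character m t)))"
      by (rule infsum_tensor[OF C(1) D(1), where B=1]) (simp add: norm_mult norm_character[OF t])
    also have "\<dots> = (\<Sum>\<^sub>\<infinity>k. c k * character k t) * (\<Sum>\<^sub>\<infinity>m. d m * character m t)"
      unfolding infsum_cmult_left'[symmetric]
      by (simp add: infsum_cmult_right'[symmetric] mult.left_commute mult.assoc)
    finally show ?thesis using C(2)[OF t] D(2)[OF t] by simp
  qed
  then show "wiener_rep ?p (\<lambda>t. F t * G t)"
    using abs_summable_push(1)[OF T(1)] by (simp add: wiener_rep_def)
qed

lemma wiener_rep_cnj:
  assumes c: "wiener_rep c F"
  shows "wiener_rep (\<lambda>k. cnj (c (- k))) (\<lambda>t. cnj (F t))"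
proof -
  have bij: "bij_betw uminus (UNIV :: (int \<times> int) set) UNIV"
    by (rule bij_betwI[where g=uminus]) auto
  have "(\<Sum>\<^sub>\<infinity>k. cnj (c (- k)) * character k t) = cnj (F t)" if t: "t \<in> torus" for t
  proof -
    have "(\<Sum>\<^sub>\<infinity>k. cnj (c (- k)) * character k t) = (\<Sum>\<^sub>\<infinity>k. cnj (c k * character k t))"
      using infsum_reindex_bij_betw[OF bij, of "\<lambda>k. cnj (c k * character k t)"]
      by (simp add: cnj_character[OF t])
    then show ?thesis using wiener_repD(2)[OF c t] unfolding infsum_cnj by simp
  qed
  moreover have "(\<lambda>k. cnj (c (- k))) abs_summable_on UNIV"
    using summable_on_reindex_bij_betw[OF bij, of "\<lambda>k. norm (c k)"] wiener_repD(1)[OF c] by simp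
  ultimately show ?thesis by (simp add: wiener_rep_def)
qed

lemma wiener_rep_continuous:
  assumes c: "wiener_rep c F"
  shows "continuous_on torus F"
proof -
  have "uniform_limit torus (\<lambda>X t. \<Sum>k\<in>X. c k * character k t)
      (\<lambda>t. \<Sum>\<^sub>\<infinity>k. c k * character k t) (finite_subsets_at_top UNIV)"
    by (rule Weierstrass_m_test_general[OF _ wiener_repD(1)[OF c]])
      (simp add: norm_mult norm_character)
  then have "continuous_on torus (\<lambda>t. \<Sum>\<^sub>\<infinity>k. c k * character k t)"
    by (rule uniform_limit_theorem[rotated])
      (auto intro!: always_eventually continuous_intros continuous_on_character)
  then show ?thesis
    using wiener_repD(2)[OF c] by (metis (no_types, lifting) continuous_on_cong)
qed

section \<open>Coefficients estimated by values on the torus\<close>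

definition lattice_box :: "nat \<Rightarrow> (int \<times> int) set" where
  "lattice_box n = {- int n..int n} \<times> {- int n..int n}"

lemma finite_lattice_box: "finite (lattice_box n)"
  by (simp add: lattice_box_def)

lemma card_lattice_box: "card (lattice_box n) = (2 * n + 1)\<^sup>2"
  by (simp add: lattice_box_def card_cartesian_product power2_eq_square nat_add_distrib nat_mult_distrib)

lemma finite_subset_lattice_box:
  assumes "finite F"
  obtains n where "F \<subseteq> lattice_box n"
proof -
  let ?f = "\<lambda>k. nat \<bar>fst k\<bar> + nat \<bar>snd k\<bar>"
  have "F \<subseteq> lattice_box (\<Sum>k\<in>F. ?f k)"
  proof
    fix k assume "k \<in> F"
    then have "?f k \<le> (\<Sum>k\<in>F. ?f k)" using assms by (intro member_le_sum) auto
    then show "k \<in> lattice_box (\<Sum>k\<in>F. ?f k)" unfolding lattice_box_def mem_Times_iff atLeastAtMost_iff by linarith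
  qed
  then show thesis by (rule that)
qed

lemma sum_powers_root_of_unity:
  fixes j :: int and Q :: nat
  assumes "\<bar>j\<bar> < int Q"
  shows "(\<Sum>m<Q. cis (2 * pi * of_int j / of_nat Q) ^ m) = (if j = 0 then of_nat Q else 0)"
proof (cases "j = 0")
  case False
  have Q: "Q > 0" using assms by linarith
  let ?u = "cis (2 * pi * of_int j / of_nat Q)"
  have "?u \<noteq> 1"
  proof
    assume "?u = 1"
    then have "cos (2 * pi * of_int j / of_nat Q) = 1" by (metis cis.simps(1) one_complex.simps(1))
    then obtain n :: int where "2 * pi * of_int j / of_nat Q = of_int n * 2 * pi"
      unfolding cos_one_2pi_int by blast
    then have "real_of_int j = of_int (n * int Q)" using Q by (simp add: field_simps)
    then have "j = n * int Q" by (simp only: of_int_eq_iff)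
    then show False using assms False dvd_imp_le_int[of j "int Q"] by auto
  qed
  moreover have "?u ^ Q = 1"
    using Q cis_multiple_2pi[of "of_int j"] by (simp add: Complex.DeMoivre)
  ultimately show ?thesis using False by (simp add: geometric_sum)
qed simp

text \<open>
  On the points \<open>(\<omega>\<^sup>m, \<omega>\<^bsup>Nm\<^esup>)\<close> with \<open>\<omega>\<close> a primitive root of unity of order \<open>N\<^sup>2\<close>, the characters
  of small index are pairwise orthogonal, because \<open>k + N l\<close> determines \<open>(k, l)\<close>.
\<close>

lemma character_coefficient_le:
  assumes F: "\<And>t. t \<in> torus \<Longrightarrow> norm (\<Sum>k\<in>lattice_box n. c k * character k t) \<le> M"
    and k0: "k0 \<in> lattice_box n"
  shows "norm (c k0) \<le> M"
proof -
  \<comment> \<open>Differences of two box indices have entries of modulus at most 2n. Since N > 2n,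
    \<open>h\<close> vanishes on such a difference only at 0, and 2n + 2nN < \<open>Q\<close> keeps
    the values of \<open>h\<close> below the order of the root of unity.\<close>
  define N Q where "N = 2 * n + 2" and "Q = N\<^sup>2"
  define h where "h = (\<lambda>k :: int \<times> int. fst k + int N * snd k)"
  define t where "t = (\<lambda>m::nat. (cis (2 * pi * m / Q), cis (2 * pi * N * m / Q)))"
  have Q: "Q > 0" by (simp add: Q_def N_def)
  have t: "t m \<in> torus" for m by (simp add: t_def torus_def)
  have ch: "character k (t m) = cis (2 * pi * of_int (h k) / Q) ^ m" for k m
    unfolding character_def t_def h_def fst_conv snd_conv cis_power_int cis_mult Complex.DeMoivre
    by (rule arg_cong[where f=cis]) (simp add: add_divide_distrib algebra_simps)
  have orth: "(\<Sum>m<Q. character k (t m)) = (if k = 0 then of_nat Q else 0)"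
    if "\<bar>fst k\<bar> \<le> 2 * int n" "\<bar>snd k\<bar> \<le> 2 * int n" for k
  proof -
    have "\<bar>h k\<bar> \<le> \<bar>fst k\<bar> + int N * \<bar>snd k\<bar>"
      unfolding h_def by (metis abs_mult abs_of_nat abs_triangle_ineq)
    also have "\<dots> \<le> 2 * int n + int N * (2 * int n)"
      using that by (intro add_mono mult_left_mono) auto
    also have "\<dots> < int Q" by (simp add: Q_def N_def power2_eq_square algebra_simps)
    finally have "\<bar>h k\<bar> < int Q" .
    moreover have "h k = 0 \<longleftrightarrow> k = 0"
    proof
      assume h: "h k = 0"
      then have "fst k = int N * (- snd k)" by (simp add: h_def)
      moreover from this have "fst k = 0"
        using that(1) dvd_imp_le_int[of "fst k" "int N"] by (fastforce simp: N_def)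
      ultimately show "k = 0" by (auto simp: N_def prod_eq_iff)
    qed (simp add: h_def)
    ultimately show ?thesis unfolding ch by (simp add: sum_powers_root_of_unity)
  qed
  \<comment> \<open>Averaging against \<open>character (- k0)\<close> over the sample points plays
    the part of an integral over the torus and isolates the coefficient at
    \<open>k0\<close>.\<close>
  have "(\<Sum>m<Q. (\<Sum>k\<in>lattice_box n. c k * character k (t m)) * character (- k0) (t m))
      = (\<Sum>m<Q. \<Sum>k\<in>lattice_box n. c k * character (k - k0) (t m))"
    using character_add[OF t, of _ "- k0"] by (simp add: sum_distrib_right mult.assoc)
  also have "\<dots> = (\<Sum>k\<in>lattice_box n. c k * (\<Sum>m<Q. character (k - k0) (t m)))"
    by (subst sum.swap) (simp add: sum_distrib_left)
  also have "\<dots> = (\<Sum>k\<in>lattice_box n. if k = k0 then of_nat Q * c k0 else 0)"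
  proof (rule sum.cong[OF refl])
    fix k assume "k \<in> lattice_box n"
    then show "c k * (\<Sum>m<Q. character (k - k0) (t m)) = (if k = k0 then of_nat Q * c k0 else 0)"
      using k0 by (subst orth) (auto simp: lattice_box_def)
  qed
  also have "\<dots> = of_nat Q * c k0" using k0 finite_lattice_box[of n] by simp
  finally have "real Q * norm (c k0) =
      norm (\<Sum>m<Q. (\<Sum>k\<in>lattice_box n. c k * character k (t m)) * character (- k0) (t m))"
    by (simp add: norm_mult)
  also have "\<dots> \<le> (\<Sum>m<Q. M)"
    by (rule sum_norm_le) (use F[OF t] norm_character[OF t] in \<open>simp add: norm_mult\<close>)
  finally show ?thesis using Q by simp
qed

lemma infsum_finite_support:
  fixes c u :: "'i \<Rightarrow> complex"
  assumes "finite A" and "\<And>k. k \<notin> A \<Longrightarrow> c k = 0"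
  shows "(\<Sum>\<^sub>\<infinity>k. c k * u k) = (\<Sum>k\<in>A. c k * u k)"
  unfolding infsum_finite[OF assms(1), symmetric]
  by (rule infsum_cong_neutral) (use assms in auto)

text \<open>Cuts off a tail of small norm. The index \<open>k\<close> is put into the box on
  request, because the coefficient estimate concerns one given index.\<close>

lemma wiener_rep_truncate:
  assumes c: "wiener_rep c F" and e: "0 < e"
  obtains n P where "wiener_rep (\<lambda>k. if k \<in> lattice_box n then c k else 0) P" and "k \<in> lattice_box n"
    and "wiener_rep (\<lambda>k. if k \<in> lattice_box n then 0 else c k) (\<lambda>t. F t - P t)"
    and "l1_norm (\<lambda>k. if k \<in> lattice_box n then 0 else c k) \<le> e"
proof -
  obtain A where A: "finite A" "\<And>G. A \<subseteq> G \<Longrightarrow> l1_norm (\<lambda>k. if k \<in> G then 0 else c k) \<le> e"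
    using l1_norm_tail[OF wiener_repD(1)[OF c] e] by blast
  obtain n where n: "insert k A \<subseteq> lattice_box n" using finite_subset_lattice_box A(1) by (metis finite_insert)
  define P where "P = (\<lambda>t. \<Sum>\<^sub>\<infinity>k. (if k \<in> lattice_box n then c k else 0) * character k t)"
  have P: "wiener_rep (\<lambda>k. if k \<in> lattice_box n then c k else 0) P"
    unfolding wiener_rep_def P_def
    by (intro conjI l1_norm_mono(1)[OF wiener_repD(1)[OF c]]) auto
  have "(\<lambda>k. c k - (if k \<in> lattice_box n then c k else 0)) = (\<lambda>k. if k \<in> lattice_box n then 0 else c k)"
    by auto
  with wiener_rep_diff[OF c P] A(2)[of "lattice_box n"] P n that show thesis by auto
qed

text \<open>Discrete orthogonality covers trigonometric polynomials; truncation raises the sup norm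
  by at most \<open>e\<close>, which is arbitrary.\<close>

lemma wiener_rep_coefficient_le:
  assumes c: "wiener_rep c F" and F: "\<And>t. t \<in> torus \<Longrightarrow> norm (F t) \<le> M"
  shows "norm (c k) \<le> M"
proof (rule field_le_epsilon)
  fix e :: real assume "0 < e"
  from wiener_rep_truncate[OF c this, of k] obtain n P
    where P: "wiener_rep (\<lambda>k. if k \<in> lattice_box n then c k else 0) P" and k: "k \<in> lattice_box n"
      and R: "wiener_rep (\<lambda>k. if k \<in> lattice_box n then 0 else c k) (\<lambda>t. F t - P t)"
      and e: "l1_norm (\<lambda>k. if k \<in> lattice_box n then 0 else c k) \<le> e" by blast
  have "norm (\<Sum>k\<in>lattice_box n. c k * character k t) \<le> M + e" if t: "t \<in> torus" for t
  proof -
    have "(\<Sum>k\<in>lattice_box n. c k * character k t) = P t"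
      using wiener_repD(2)[OF P t]
        infsum_finite_support[OF finite_lattice_box, of n "\<lambda>k. if k \<in> lattice_box n then c k else 0"] by simp
    moreover have "norm (F t - P t) \<le> e" using wiener_rep_norm_le[OF R t] e by simp
    ultimately show ?thesis
      using F[OF t] norm_triangle_ineq4[of "F t" "F t - P t"] by simp
  qed
  from character_coefficient_le[OF this k] show "norm (c k) \<le> M + e" .
qed

text \<open>Carries identities between functions back to coefficients, where operators can use
  them.\<close>

lemma wiener_rep_unique:
  assumes "wiener_rep c F" and "wiener_rep d F"
  shows "c = d"
proof
  fix k
  show "c k = d k"
    using wiener_rep_coefficient_le[OF wiener_rep_diff[OF assms], of 0 k] by simp
qed

text \<open>Hides the representing family, so that norm estimates for powers and binomial sums can
  be composed on the function side.\<close>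

definition wiener_bd :: "(complex \<times> complex \<Rightarrow> complex) \<Rightarrow> real \<Rightarrow> bool" where
  "wiener_bd F K \<longleftrightarrow> (\<exists>c. wiener_rep c F \<and> l1_norm c \<le> K)"

lemma wiener_bd_mono: "wiener_bd F K \<Longrightarrow> K \<le> L \<Longrightarrow> wiener_bd F L"
  unfolding wiener_bd_def using order_trans by blast

lemma wiener_bd_nonneg: "wiener_bd F K \<Longrightarrow> 0 \<le> K"
  unfolding wiener_bd_def using l1_norm_nonneg order_trans by blast

lemma wiener_bd_const: "wiener_bd (\<lambda>t. r) (norm r)"
  unfolding wiener_bd_def
  using abs_summable_finite_support(2)[of "{0 :: int \<times> int}" "\<lambda>k. if k = 0 then r else 0"]
  by (intro exI[of _ "\<lambda>k. if k = 0 then r else 0"]) (auto simp: wiener_rep_const)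

lemma wiener_bd_add:
  assumes "wiener_bd F K" and "wiener_bd G L"
  shows "wiener_bd (\<lambda>t. F t + G t) (K + L)"
proof -
  obtain c d where c: "wiener_rep c F" "l1_norm c \<le> K" and d: "wiener_rep d G" "l1_norm d \<le> L"
    using assms by (auto simp: wiener_bd_def)
  have "l1_norm (\<lambda>k. c k + d k) \<le> K + L"
    using abs_summable_add(2)[OF wiener_repD(1)[OF c(1)] wiener_repD(1)[OF d(1)]] c(2) d(2) by simp
  with wiener_rep_add[OF c(1) d(1)] show ?thesis by (auto simp: wiener_bd_def)
qed

lemma wiener_bd_mult:
  assumes "wiener_bd F K" and "wiener_bd G L"
  shows "wiener_bd (\<lambda>t. F t * G t) (K * L)"
proof -
  obtain c d where c: "wiener_rep c F" "l1_norm c \<le> K" and d: "wiener_rep d G" "l1_norm d \<le> L"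
    using assms by (auto simp: wiener_bd_def)
  have "l1_norm c * l1_norm d \<le> K * L"
    using c(2) d(2) l1_norm_nonneg wiener_bd_nonneg[OF assms(1)] by (intro mult_mono) auto
  with wiener_rep_mult[OF c(1) d(1)] show ?thesis unfolding wiener_bd_def using order_trans by blast
qed

lemma wiener_bd_sum:
  assumes "finite A" and "\<And>i. i \<in> A \<Longrightarrow> wiener_bd (F i) (K i)"
  shows "wiener_bd (\<lambda>t. \<Sum>i\<in>A. F i t) (\<Sum>i\<in>A. K i)"
  using assms
proof (induction A rule: finite_induct)
  case empty
  then show ?case using wiener_bd_const[of 0] by simp
next
  case (insert x A)
  then show ?case using wiener_bd_add[of "F x" "K x"] by simp
qed

lemma wiener_bd_power:
  assumes "wiener_bd F K"
  shows "wiener_bd (\<lambda>t. F t ^ n) (K ^ n)"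
proof (induction n)
  case 0
  then show ?case using wiener_bd_const[of 1] by simp
next
  case (Suc n)
  then show ?case using wiener_bd_mult[OF assms] by simp
qed

text \<open>The degree of \<open>P ^ n\<close> is linear in \<open>n\<close>, so its norm is at most the sup norm up to a polynomial factor.\<close>

lemma wiener_bd_trig_poly_power:
  assumes P: "wiener_rep c P" and c: "\<And>k. k \<notin> lattice_box d \<Longrightarrow> c k = 0"
    and M: "\<And>t. t \<in> torus \<Longrightarrow> norm (P t) \<le> M"
  shows "wiener_bd (\<lambda>t. P t ^ n) (real ((2 * (n * d) + 1)\<^sup>2) * M ^ n)"
proof -
  have "\<exists>e. wiener_rep e (\<lambda>t. P t ^ n) \<and> (\<forall>k. k \<notin> lattice_box (n * d) \<longrightarrow> e k = 0)"
  proof (induction n)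
    case 0
    show ?case
      using wiener_rep_const[of 1] by (intro exI[of _ "\<lambda>k. if k = 0 then 1 else 0"]) (auto simp: lattice_box_def zero_prod_def)
  next
    case (Suc n)
    then obtain e where e: "wiener_rep e (\<lambda>t. P t ^ n)" "\<And>k. k \<notin> lattice_box (n * d) \<Longrightarrow> e k = 0" by blast
    have "push (\<lambda>(k, m). k + m) (\<lambda>(k, m). c k * e m) j = 0" if j: "j \<notin> lattice_box (Suc n * d)" for j
      unfolding push_def
    proof (rule infsum_0)
      fix x assume "x \<in> (\<lambda>(k, m). k + m) -` {j}"
      then have "j = fst x + snd x" by (auto simp: case_prod_unfold)
      with j have "fst x \<notin> lattice_box d \<or> snd x \<notin> lattice_box (n * d)" by (auto simp: lattice_box_def)
      then have "c (fst x) = 0 \<or> e (snd x) = 0" using c e(2) by blast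
      then show "(case x of (k, m) \<Rightarrow> c k * e m) = 0" by (auto simp: case_prod_unfold)
    qed
    with wiener_rep_mult(1)[OF P e(1)] show ?case by auto
  qed
  then obtain e where e: "wiener_rep e (\<lambda>t. P t ^ n)" "\<And>k. k \<notin> lattice_box (n * d) \<Longrightarrow> e k = 0" by blast
  have "l1_norm e = (\<Sum>k\<in>lattice_box (n * d). norm (e k))"
    by (rule abs_summable_finite_support(2)[OF finite_lattice_box e(2)])
  also have "\<dots> \<le> (\<Sum>k\<in>lattice_box (n * d). M ^ n)"
    by (intro sum_mono wiener_rep_coefficient_le[OF e(1)])
      (use M in \<open>simp add: norm_power power_mono\<close>)
  also have "\<dots> = real ((2 * (n * d) + 1)\<^sup>2) * M ^ n" by (simp add: card_lattice_box)
  finally show ?thesis using e(1) by (auto simp: wiener_bd_def)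
qed

text \<open>Completeness of the Wiener algebra: the double family is absolutely summable in both
  indices together, and pushing along \<open>snd\<close> sums out the first.\<close>

lemma wiener_rep_infsum:
  fixes F :: "nat \<Rightarrow> complex \<times> complex \<Rightarrow> complex"
  assumes F: "\<And>n. wiener_bd (F n) (K n)" and K: "summable K"
  shows "\<exists>c. wiener_rep c (\<lambda>t. \<Sum>\<^sub>\<infinity>n. F n t)"
proof -
  obtain c where c: "\<And>n. wiener_rep (c n) (F n)" "\<And>n. l1_norm (c n) \<le> K n"
    using F unfolding wiener_bd_def by metis
  have "K summable_on UNIV"
    by (rule summable_nonneg_imp_summable_on[OF K wiener_bd_nonneg[OF F]])
  then have "(\<lambda>n. norm (l1_norm (c n))) summable_on UNIV"
    by (rule Infinite_Sum.abs_summable_on_comparison_test') (use c(2) in \<open>simp add: abs_of_nonneg[OF l1_norm_nonneg]\<close>)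
  then have "(\<lambda>(n, k). c n k) abs_summable_on Sigma UNIV (\<lambda>_. UNIV)"
    unfolding Infinite_Sum.abs_summable_on_Sigma_iff
    using wiener_repD(1)[OF c(1)] by (simp add: l1_norm_def)
  then have s: "(\<lambda>(n, k). c n k) abs_summable_on UNIV" by simp
  let ?p = "push snd (\<lambda>(n, k). c n k)"
  have "(\<Sum>\<^sub>\<infinity>k. ?p k * character k t) = (\<Sum>\<^sub>\<infinity>n. F n t)" if t: "t \<in> torus" for t
  proof -
    have b: "norm (character k t) \<le> 1" for k using norm_character[OF t] by simp
    have "(\<lambda>x. (case x of (n, k) \<Rightarrow> c n k) * character (snd x) t) abs_summable_on UNIV"
      by (rule abs_summable_mult_bounded[OF s b])
    then have s': "(\<lambda>x. (case x of (n, k) \<Rightarrow> c n k) * character (snd x) t)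
        summable_on Sigma UNIV (\<lambda>_. UNIV)"
      using abs_summable_summable by simp
    show ?thesis
      using infsum_push[OF s b, of snd "\<lambda>k. k"] infsum_Sigma_banach[OF s'] wiener_repD(2)[OF c(1) t]
      by simp
  qed
  with abs_summable_push(1)[OF s, of snd] show ?thesis
    unfolding wiener_rep_def by (intro exI[of _ ?p]) simp
qed

text \<open>Differentiating the geometric series twice gives the coefficients (n + 1)(n + 2), which
  dominate the quadratic factor up to the constant (2d + 1)^2.\<close>

lemma summable_quadratic_geometric:
  fixes s :: real
  assumes "0 \<le> s" and "s < 1"
  shows "summable (\<lambda>n. real ((2 * (n * d) + 1)\<^sup>2) * s ^ n)"
proof -
  have g: "summable (\<lambda>n. (1::real) * x ^ n)" if "norm x < 1" for x
    using that by (simp add: summable_geometric)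
  have g1: "summable (\<lambda>n. diffs (\<lambda>_. 1) n * x ^ n)" if "norm x < 1" for x :: real
    by (rule termdiff_converges[OF that g])
  have "summable (\<lambda>n. diffs (diffs (\<lambda>_. 1)) n * s ^ n)"
    by (rule termdiff_converges[OF _ g1]) (use assms in auto)
  then have s: "summable (\<lambda>n. (2 * real d + 1)\<^sup>2 * (real ((n + 1) * (n + 2)) * s ^ n))"
    by (intro summable_mult) (simp add: diffs_def algebra_simps)
  have "(2 * real (n * d) + 1)\<^sup>2 \<le> (2 * real d + 1)\<^sup>2 * real ((n + 1) * (n + 2))" for n
  proof -
    have "(2 * real (n * d) + 1)\<^sup>2 \<le> ((2 * real d + 1) * real (n + 1))\<^sup>2"
      by (intro power_mono) (auto simp: algebra_simps)
    also have "\<dots> \<le> (2 * real d + 1)\<^sup>2 * real ((n + 1) * (n + 2))"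
      unfolding power_mult_distrib by (intro mult_left_mono) (auto simp: power2_eq_square algebra_simps)
    finally show ?thesis .
  qed
  then have "norm (real ((2 * (n * d) + 1)\<^sup>2) * s ^ n)
      \<le> (2 * real d + 1)\<^sup>2 * (real ((n + 1) * (n + 2)) * s ^ n)" for n
    using mult_right_mono[of "(2 * real (n * d) + 1)\<^sup>2"
        "(2 * real d + 1)\<^sup>2 * real ((n + 1) * (n + 2))" "s ^ n"] assms(1)
    by (simp add: mult.assoc add.commute)
  then show ?thesis by (intro summable_comparison_test'[OF s, where N=0]) blast
qed

text \<open>The Wiener norm of \<open>H\<close> may exceed 1, so the geometric series cannot be
  bounded term by term by powers of that norm. Instead \<open>H\<close> is split into a
  trigonometric polynomial \<open>P\<close> and a remainder of Wiener norm at most \<open>e\<close>.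
  In the binomial expansion the powers of \<open>P\<close> cost (q + e)^k up to a quadratic factor,
  and the norm of H^n is at most that factor times (q + 2e)^n.\<close>

lemma wiener_rep_geometric:
  assumes H: "wiener_rep c H" and q: "q < 1" and Hq: "\<And>t. t \<in> torus \<Longrightarrow> norm (H t) \<le> q"
  shows "\<exists>g. wiener_rep g (\<lambda>t. 1 / (1 - H t))"
proof -
  have "(1, 1) \<in> torus" by (simp add: torus_def)
  then have q0: "0 \<le> q" using Hq norm_ge_zero order_trans by blast
  \<comment> \<open>One \<open>e\<close> is lost in the sup norm of \<open>P\<close> and one in the
    norm of the remainder; this choice leaves q + 2e = (1 + q) / 2 < 1.\<close>
  define e where "e = (1 - q) / 4"
  have e: "0 < e" "q + 2 * e < 1" using q by (auto simp: e_def field_simps)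
  from wiener_rep_truncate[OF H e(1), of 0] obtain d P
    where P: "wiener_rep (\<lambda>k. if k \<in> lattice_box d then c k else 0) P"
      and R: "wiener_rep (\<lambda>k. if k \<in> lattice_box d then 0 else c k) (\<lambda>t. H t - P t)"
      and Re: "l1_norm (\<lambda>k. if k \<in> lattice_box d then 0 else c k) \<le> e" by blast
  have Pq: "norm (P t) \<le> q + e" if "t \<in> torus" for t
    using wiener_rep_norm_le[OF R that] Re Hq[OF that] norm_triangle_ineq4[of "H t" "H t - P t"]
    by simp
  have bdP: "wiener_bd (\<lambda>t. P t ^ n) (real ((2 * (n * d) + 1)\<^sup>2) * (q + e) ^ n)" for n
    by (rule wiener_bd_trig_poly_power[OF P _ Pq]) simp_all
  have bdR: "wiener_bd (\<lambda>t. (H t - P t) ^ n) (e ^ n)" for n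
    by (rule wiener_bd_power) (use R Re in \<open>auto simp: wiener_bd_def\<close>)
  have "wiener_bd (\<lambda>t. H t ^ n) (real ((2 * (n * d) + 1)\<^sup>2) * (q + 2 * e) ^ n)" for n
  proof -
    have H: "H t ^ n = (\<Sum>k\<le>n. of_nat (n choose k) * (P t ^ k * (H t - P t) ^ (n - k)))" for t
      using binomial_ring[of "P t" "H t - P t" n] by (simp add: mult.assoc)
    have bd: "wiener_bd (\<lambda>t. H t ^ n) (\<Sum>k\<le>n. norm (of_nat (n choose k) :: complex) *
        ((real ((2 * (k * d) + 1)\<^sup>2) * (q + e) ^ k) * e ^ (n - k)))"
      unfolding H by (intro wiener_bd_sum wiener_bd_mult wiener_bd_const bdP bdR finite_atMost)
    \<comment> \<open>The quadratic factor is raised to its value at \<open>n\<close> and leaves the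
      sum, which the binomial theorem then closes.\<close>
    have "(\<Sum>k\<le>n. norm (of_nat (n choose k) :: complex) *
        ((real ((2 * (k * d) + 1)\<^sup>2) * (q + e) ^ k) * e ^ (n - k)))
      \<le> (\<Sum>k\<le>n. real ((2 * (n * d) + 1)\<^sup>2) * (real (n choose k) * (q + e) ^ k * e ^ (n - k)))"
    proof (rule sum_mono)
      fix k assume "k \<in> {..n}"
      then have "real ((2 * (k * d) + 1)\<^sup>2) \<le> real ((2 * (n * d) + 1)\<^sup>2)"
        by (intro of_nat_mono power_mono) (auto intro: mult_right_mono)
      then have "real ((2 * (k * d) + 1)\<^sup>2) * (real (n choose k) * (q + e) ^ k * e ^ (n - k))
          \<le> real ((2 * (n * d) + 1)\<^sup>2) * (real (n choose k) * (q + e) ^ k * e ^ (n - k))"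
        using e q0 by (intro mult_right_mono) auto
      then show "norm (of_nat (n choose k) :: complex) *
          ((real ((2 * (k * d) + 1)\<^sup>2) * (q + e) ^ k) * e ^ (n - k))
        \<le> real ((2 * (n * d) + 1)\<^sup>2) * (real (n choose k) * (q + e) ^ k * e ^ (n - k))"
        by (simp add: mult_ac)
    qed
    also have "\<dots> = real ((2 * (n * d) + 1)\<^sup>2) * (q + 2 * e) ^ n"
      using binomial_ring[of "q + e" e n] by (simp add: sum_distrib_left add.assoc)
    finally show ?thesis by (rule wiener_bd_mono[OF bd])
  qed
  from wiener_rep_infsum[OF this summable_quadratic_geometric] e q0
  obtain g where g: "wiener_rep g (\<lambda>t. \<Sum>\<^sub>\<infinity>n. H t ^ n)" by auto
  have "(\<Sum>\<^sub>\<infinity>n. H t ^ n) = 1 / (1 - H t)" if t: "t \<in> torus" for t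
  proof -
    have h: "norm (H t) < 1" using Hq[OF t] q by simp
    then have "summable (\<lambda>n. norm (H t ^ n))" by (simp add: norm_power summable_geometric)
    from norm_summable_imp_has_sum[OF this geometric_sums[OF h]] show ?thesis by (rule infsumI)
  qed
  from wiener_rep_cong[OF g this] show ?thesis by blast
qed

text \<open>
  Applying the geometric series to \<open>1 - |F|\<^sup>2 / M\<^sup>2\<close>, whose values lie in an interval \<open>[0, q]\<close> with
  \<open>q < 1\<close>, inverts \<open>|F|\<^sup>2\<close>, and \<open>1 / F = cnj F / |F|\<^sup>2\<close>.
\<close>

theorem wiener_lemma_torus:
  assumes F: "wiener_rep c F" and nz: "\<And>t. t \<in> torus \<Longrightarrow> F t \<noteq> 0"
  shows "\<exists>g. wiener_rep g (\<lambda>t. 1 / F t)"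
proof -
  have ne: "torus \<noteq> {}" by (auto simp: torus_def intro!: exI[of _ 1])
  have cont: "continuous_on torus (\<lambda>t. norm (F t))"
    by (intro continuous_intros wiener_rep_continuous[OF F])
  obtain t0 where t0: "t0 \<in> torus" "\<And>t. t \<in> torus \<Longrightarrow> norm (F t0) \<le> norm (F t)"
    using continuous_attains_inf[OF compact_torus ne cont] by blast
  \<comment> \<open>The Wiener norm serves as the upper bound of |F|, so that |F|^2 / M^2 stays
    between m^2 / M^2 and 1.\<close>
  define m M where "m = norm (F t0)" and "M = l1_norm c"
  have m: "0 < m" using nz[OF t0(1)] by (simp add: m_def)
  have FM: "norm (F t) \<le> M" if "t \<in> torus" for t
    using wiener_rep_norm_le[OF F that] by (simp add: M_def)
  have M: "0 < M" using FM[OF t0(1)] m m_def by linarith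
  define H where "H = (\<lambda>t. 1 - of_real (1 / M\<^sup>2) * (F t * cnj (F t)))"
  obtain h where h: "wiener_rep h H"
    using wiener_rep_diff[OF wiener_rep_const[of 1]
        wiener_rep_scale[OF wiener_rep_mult(1)[OF F wiener_rep_cnj[OF F]]]]
    unfolding H_def by blast
  have H: "H t = of_real (1 - (norm (F t))\<^sup>2 / M\<^sup>2)" for t
    unfolding H_def complex_norm_square[symmetric] by simp
  have "norm (H t) \<le> 1 - m\<^sup>2 / M\<^sup>2" if t: "t \<in> torus" for t
  proof -
    have "(norm (F t))\<^sup>2 / M\<^sup>2 \<le> 1" using FM[OF t] M by (simp add: power_mono)
    moreover have "m\<^sup>2 / M\<^sup>2 \<le> (norm (F t))\<^sup>2 / M\<^sup>2"
      using t0(2)[OF t] m by (intro divide_right_mono power_mono) (auto simp: m_def)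
    ultimately show ?thesis unfolding H norm_of_real by simp
  qed
  moreover have "1 - m\<^sup>2 / M\<^sup>2 < 1" using m M by simp
  ultimately obtain g where "wiener_rep g (\<lambda>t. 1 / (1 - H t))"
    using wiener_rep_geometric[OF h] by blast
  from wiener_rep_mult(1)[OF wiener_rep_scale[OF wiener_rep_cnj[OF F], of "of_real (1 / M\<^sup>2)"] this]
  obtain g where g: "wiener_rep g (\<lambda>t. of_real (1 / M\<^sup>2) * cnj (F t) * (1 / (1 - H t)))" by blast
  have "of_real (1 / M\<^sup>2) * cnj (F t) * (1 / (1 - H t)) = 1 / F t" if "t \<in> torus" for t
    using nz[OF that] M by (simp add: H_def field_simps)
  from wiener_rep_cong[OF g this] show ?thesis by blast
qed

section \<open>Sequence spaces\<close>

context
  fixes p :: ennreal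
  assumes p: "1 \<le> p"
begin

text \<open>Reduces membership with a norm bound to conditions on finitely many entries at a time,
  which survive entrywise limits and injective reindexing.\<close>

lemma lp_ball_iff:
  assumes K: "0 \<le> K"
  shows "v \<in> lp p \<and> lp_norm p v \<le> K \<longleftrightarrow>
    (if p = \<infinity> then \<forall>i. norm (v i) \<le> K
     else \<forall>I. finite I \<longrightarrow> (\<Sum>i\<in>I. norm (v i) powr enn2real p) \<le> K powr enn2real p)"
proof (cases "p = \<infinity>")
  case True
  have "(\<forall>i. norm (v i) \<le> K) \<longleftrightarrow> bounded (range v) \<and> (SUP i. norm (v i)) \<le> K"
  proof (intro iffI conjI allI)
    show "bounded (range v)" if "\<forall>i. norm (v i) \<le> K"
      using that by (auto simp: bounded_iff)
    show "(SUP i. norm (v i)) \<le> K" if "\<forall>i. norm (v i) \<le> K"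
      using that by (intro cSUP_least) auto
    fix i
    assume v: "bounded (range v) \<and> (SUP i. norm (v i)) \<le> K"
    then have "bdd_above (range (\<lambda>i. norm (v i)))" by (auto simp: bounded_iff bdd_above_def)
    from cSUP_upper[OF UNIV_I this, of i] v show "norm (v i) \<le> K" by simp
  qed
  then show ?thesis using True by (simp add: lp_def lp_norm_def)
next
  case False
  define r where "r = enn2real p"
  have r: "1 \<le> r"
    using p False enn2real_mono[of 1 p] by (simp add: r_def top.not_eq_extremum)
  let ?f = "\<lambda>i. norm (v i) powr r"
  have "summable ?f \<and> (\<Sum>i. ?f i) powr (1 / r) \<le> K \<longleftrightarrow> (\<forall>I. finite I \<longrightarrow> sum ?f I \<le> K powr r)"
  proof
    assume s: "summable ?f \<and> (\<Sum>i. ?f i) powr (1 / r) \<le> K"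
    then have "0 \<le> (\<Sum>i. ?f i)" by (simp add: suminf_nonneg)
    then have "(\<Sum>i. ?f i) = ((\<Sum>i. ?f i) powr (1 / r)) powr r" using r by (simp add: powr_powr)
    also have "\<dots> \<le> K powr r" using s r by (intro powr_mono2) auto
    finally have le: "(\<Sum>i. ?f i) \<le> K powr r" .
    have "sum ?f I \<le> K powr r" if "finite I" for I
      using sum_le_suminf[OF conjunct1[OF s] that] le by (auto intro: order_trans)
    then show "\<forall>I. finite I \<longrightarrow> sum ?f I \<le> K powr r" by blast
  next
    assume b: "\<forall>I. finite I \<longrightarrow> sum ?f I \<le> K powr r"
    then have b': "sum ?f {..<n} \<le> K powr r" for n by simp
    have s: "summable ?f" by (rule summableI_nonneg_bounded[OF _ b']) simp
    have "(\<Sum>i. ?f i) powr (1 / r) \<le> (K powr r) powr (1 / r)"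
      by (rule powr_mono2[OF _ suminf_nonneg[OF s] suminf_le_const[OF s b']]) (use r in auto)
    also have "\<dots> = K" using r K by (simp add: powr_powr)
    finally show "summable ?f \<and> (\<Sum>i. ?f i) powr (1 / r) \<le> K" using s by simp
  qed
  then show ?thesis using False by (simp add: lp_def lp_norm_def r_def)
qed

text \<open>One criterion for all exponents: the entrywise premise serves
  \<open>p = \<infinity>\<close>, the comparison of finite sums the finite \<open>p\<close>.\<close>

lemma lp_ball_of_sums:
  assumes "v \<in> lp p" and "\<And>i. norm (w i) \<le> lp_norm p v"
    and "\<And>I. finite I \<Longrightarrow> \<exists>J. finite J \<and>
      (\<Sum>i\<in>I. norm (w i) powr enn2real p) \<le> (\<Sum>i\<in>J. norm (v i) powr enn2real p)"
  shows "w \<in> lp p" and "lp_norm p w \<le> lp_norm p v"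
proof -
  note K = lp_norm_eq_0(1)[OF p assms(1)]
  have "w \<in> lp p \<and> lp_norm p w \<le> lp_norm p v"
  proof (cases "p = \<infinity>")
    case True
    then show ?thesis unfolding lp_ball_iff[OF K] using assms(2) by simp
  next
    case False
    then have "(\<Sum>i\<in>J. norm (v i) powr enn2real p) \<le> lp_norm p v powr enn2real p" if "finite J" for J
      using lp_ball_iff[OF K, of v] assms(1) that by simp
    then have "(\<Sum>i\<in>I. norm (w i) powr enn2real p) \<le> lp_norm p v powr enn2real p" if "finite I" for I
      using assms(3)[OF that] order_trans by blast
    with False show ?thesis unfolding lp_ball_iff[OF K] by simp
  qed
  then show "w \<in> lp p" and "lp_norm p w \<le> lp_norm p v" by auto
qed

lemma norm_le_lp_norm:
  assumes v: "v \<in> lp p"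
  shows "norm (v i) \<le> lp_norm p v"
proof (cases "p = \<infinity>")
  case True
  then show ?thesis using lp_ball_iff[OF lp_norm_eq_0(1)[OF p v], of v] v by simp
next
  case False
  have r: "1 \<le> enn2real p"
    using p False enn2real_mono[of 1 p] by (simp add: top.not_eq_extremum)
  have "(\<Sum>j\<in>{i}. norm (v j) powr enn2real p) \<le> lp_norm p v powr enn2real p"
    using lp_ball_iff[OF lp_norm_eq_0(1)[OF p v], of v] v False by (metis finite.simps order_refl)
  then have "norm (v i) powr enn2real p \<le> lp_norm p v powr enn2real p" by simp
  then show ?thesis
    using r powr_less_mono2[of "enn2real p" "lp_norm p v" "norm (v i)"] lp_norm_eq_0(1)[OF p v]
    by (cases "norm (v i) \<le> lp_norm p v") auto
qed

lemma lp_mono: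
  assumes v: "v \<in> lp p" and w: "\<And>i. norm (w i) \<le> norm (v i)"
  shows "w \<in> lp p" and "lp_norm p w \<le> lp_norm p v"
proof -
  have 1: "norm (w i) \<le> lp_norm p v" for i
    using w[of i] norm_le_lp_norm[OF v, of i] by simp
  have 2: "\<exists>J. finite J \<and> (\<Sum>i\<in>I. norm (w i) powr enn2real p) \<le> (\<Sum>i\<in>J. norm (v i) powr enn2real p)"
    if "finite I" for I
    using that w by (intro exI[of _ I]) (auto intro!: sum_mono powr_mono2)
  show "w \<in> lp p" and "lp_norm p w \<le> lp_norm p v"
    using lp_ball_of_sums[OF v 1 2] by auto
qed

text \<open>An injection uses every entry at most once; the zeros off \<open>D\<close> let this
  cover shifts in both directions.\<close>

lemma lp_partial_reindex:
  assumes v: "v \<in> lp p" and D: "inj_on \<phi> D"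
  shows "(\<lambda>i. if i \<in> D then v (\<phi> i) else 0) \<in> lp p"
    and "lp_norm p (\<lambda>i. if i \<in> D then v (\<phi> i) else 0) \<le> lp_norm p v"
proof -
  let ?w = "\<lambda>i. if i \<in> D then v (\<phi> i) else 0"
  have 1: "norm (?w i) \<le> lp_norm p v" for i
    using norm_le_lp_norm[OF v] lp_norm_eq_0(1)[OF p v] by simp
  have 2: "\<exists>J. finite J \<and> (\<Sum>i\<in>I. norm (?w i) powr enn2real p) \<le> (\<Sum>i\<in>J. norm (v i) powr enn2real p)"
    if "finite I" for I
  proof (intro exI conjI)
    show "finite (\<phi> ` (I \<inter> D))" using that by simp
    have "(\<Sum>i\<in>I. norm (?w i) powr enn2real p) = (\<Sum>i\<in>I \<inter> D. norm (v (\<phi> i)) powr enn2real p)"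
      using that by (subst sum.inter_restrict) (auto intro: sum.cong)
    also have "\<dots> = (\<Sum>i\<in>\<phi> ` (I \<inter> D). norm (v i) powr enn2real p)"
      by (subst sum.reindex) (auto intro: inj_on_subset[OF D])
    finally show "(\<Sum>i\<in>I. norm (?w i) powr enn2real p) \<le> (\<Sum>i\<in>\<phi> ` (I \<inter> D). norm (v i) powr enn2real p)"
      by simp
  qed
  show "?w \<in> lp p" and "lp_norm p ?w \<le> lp_norm p v"
    using lp_ball_of_sums[OF v 1 2] by auto
qed

lemma lp_norm_scale_le:
  assumes v: "v \<in> lp p"
  shows "(\<lambda>i. k * v i) \<in> lp p \<and> lp_norm p (\<lambda>i. k * v i) \<le> norm k * lp_norm p v"
proof -
  have K: "0 \<le> lp_norm p v" by (rule lp_norm_eq_0(1)[OF p v])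
  then have k: "0 \<le> norm k * lp_norm p v" by simp
  show ?thesis
    unfolding lp_ball_iff[OF k]
    using lp_ball_iff[OF K, of v] v K
    by (auto simp: norm_mult powr_mult mult_left_mono sum_distrib_left[symmetric] split: if_splits)
qed

lemma lp_scale:
  assumes v: "v \<in> lp p"
  shows "(\<lambda>i. k * v i) \<in> lp p" and "lp_norm p (\<lambda>i. k * v i) = norm k * lp_norm p v"
proof -
  show s: "(\<lambda>i. k * v i) \<in> lp p" using lp_norm_scale_le[OF v] by blast
  show "lp_norm p (\<lambda>i. k * v i) = norm k * lp_norm p v"
  proof (cases "k = 0")
    case True
    have "lp_norm p (\<lambda>i. k * v i) = 0"
      unfolding lp_norm_eq_0(2)[OF p s] by (simp add: True fun_eq_iff)
    with True show ?thesis by simp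
  next
    case False
    have "lp_norm p v \<le> norm (inverse k) * lp_norm p (\<lambda>i. k * v i)"
      using lp_norm_scale_le[OF s, of "inverse k"] False by (simp add: mult.assoc[symmetric])
    then have "norm k * lp_norm p v \<le> norm k * (norm (inverse k) * lp_norm p (\<lambda>i. k * v i))"
      by (rule mult_left_mono) simp
    also have "\<dots> = lp_norm p (\<lambda>i. k * v i)"
      using False by (simp add: mult.assoc[symmetric] flip: norm_mult)
    finally have "norm k * lp_norm p v \<le> lp_norm p (\<lambda>i. k * v i)" .
    with lp_norm_scale_le[OF v] show ?thesis by (meson antisym)
  qed
qed

lemma lp_zero: "0 \<in> lp p" "lp_norm p 0 = 0"
proof -
  show "0 \<in> lp p" using lp_ball_iff[of 0 0] by (auto split: if_splits)
  then show "lp_norm p 0 = 0" using lp_norm_eq_0(2)[OF p] by simp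
qed

lemma lp_diff:
  assumes "v \<in> lp p" and "w \<in> lp p"
  shows "v - w \<in> lp p" and "lp_norm p (v - w) \<le> lp_norm p v + lp_norm p w"
  using lp_norm_triangle[OF p assms(1), of "- w"] assms(2) by (simp_all add: lp_norm_minus)

lemma lp_sum:
  assumes "finite A" and "\<And>i. i \<in> A \<Longrightarrow> f i \<in> lp p"
  shows "(\<Sum>i\<in>A. f i) \<in> lp p" and "lp_norm p (\<Sum>i\<in>A. f i) \<le> (\<Sum>i\<in>A. lp_norm p (f i))"
proof -
  have "(\<Sum>i\<in>A. f i) \<in> lp p \<and> lp_norm p (\<Sum>i\<in>A. f i) \<le> (\<Sum>i\<in>A. lp_norm p (f i))"
    using assms
  proof (induction A rule: finite_induct)
    case empty
    then show ?case using lp_zero by (simp add: zero_fun_def)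
  next
    case (insert x A)
    then have "f x \<in> lp p" "sum f A \<in> lp p" "lp_norm p (sum f A) \<le> (\<Sum>i\<in>A. lp_norm p (f i))"
      by simp_all
    with lp_norm_triangle[OF p this(1,2)] insert.hyps show ?case by (simp add: plus_fun_def)
  qed
  then show "(\<Sum>i\<in>A. f i) \<in> lp p" and "lp_norm p (\<Sum>i\<in>A. f i) \<le> (\<Sum>i\<in>A. lp_norm p (f i))" by auto
qed

lemma lp_unit:
  "(\<lambda>i. if i = M then 1 else 0) \<in> lp p \<and> lp_norm p (\<lambda>i. if i = M then 1 else 0) \<le> 1"
proof -
  have "(\<Sum>i\<in>I. norm (if i = M then 1 else 0 :: complex) powr enn2real p) \<le> 1" if "finite I" for I
  proof -
    have "(\<Sum>i\<in>I. norm (if i = M then 1 else 0 :: complex) powr enn2real p) = (\<Sum>i\<in>I. if i = M then 1 else 0)"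
      by (intro sum.cong) auto
    also have "\<dots> \<le> 1" using that by simp
    finally show ?thesis .
  qed
  then show ?thesis by (subst lp_ball_iff) auto
qed

text \<open>Fatou's lemma, read off from conditions on finitely many entries. The filter is
  arbitrary because the limits come both from sequences and from the net of finite index
  sets.\<close>

lemma lp_pointwise_limit:
  assumes F: "F \<noteq> bot" and K: "0 \<le> K"
    and ev: "eventually (\<lambda>n. f n \<in> lp p \<and> lp_norm p (f n) \<le> K) F"
    and lim: "\<And>i. ((\<lambda>n. f n i) \<longlongrightarrow> v i) F"
  shows "v \<in> lp p" and "lp_norm p v \<le> K"
proof -
  have "v \<in> lp p \<and> lp_norm p v \<le> K"
  proof (cases "p = \<infinity>")
    case True
    have "norm (v i) \<le> K" for i
      by (rule tendsto_upperbound[OF tendsto_norm[OF lim] _ F])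
        (use ev in eventually_elim, use lp_ball_iff[OF K] True in auto)
    then show ?thesis unfolding lp_ball_iff[OF K] using True by simp
  next
    case False
    have r: "1 \<le> enn2real p"
      using p False enn2real_mono[of 1 p] by (simp add: top.not_eq_extremum)
    have "(\<Sum>i\<in>I. norm (v i) powr enn2real p) \<le> K powr enn2real p" if "finite I" for I
    proof (rule tendsto_upperbound[OF _ _ F])
      show "((\<lambda>n. \<Sum>i\<in>I. norm (f n i) powr enn2real p) \<longlongrightarrow> (\<Sum>i\<in>I. norm (v i) powr enn2real p)) F"
        by (intro tendsto_sum tendsto_powr' tendsto_norm lim tendsto_const) (use r in auto)
      show "eventually (\<lambda>n. (\<Sum>i\<in>I. norm (f n i) powr enn2real p) \<le> K powr enn2real p) F"
        using ev by eventually_elim (use lp_ball_iff[OF K] False that in auto)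
    qed
    then show ?thesis unfolding lp_ball_iff[OF K] using False by simp
  qed
  then show "v \<in> lp p" and "lp_norm p v \<le> K" by auto
qed

text \<open>The entrywise limit is a norm limit by Fatou, applied to \<open>f n - f m\<close> in
  \<open>m\<close>. Completeness later turns total boundedness into compact closure.\<close>

lemma mcomplete_lp: "Metric_space.mcomplete (lp p) (lp_dist p)"
proof -
  interpret Metric_space "lp p" "lp_dist p" by (rule Metric_space_lp[OF p])
  show ?thesis unfolding mcomplete_def
  proof (intro allI impI)
    fix f :: "nat \<Rightarrow> nat \<Rightarrow> complex" assume "MCauchy f"
    then have f: "\<And>n. f n \<in> lp p"
      and C: "\<And>e. 0 < e \<Longrightarrow> \<exists>N. \<forall>n n'. N \<le> n \<longrightarrow> N \<le> n' \<longrightarrow> lp_norm p (f n - f n') < e"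
      by (auto simp: MCauchy_def lp_dist_def image_subset_iff)
    have "Cauchy (\<lambda>n. f n i)" for i
    proof (rule metric_CauchyI)
      fix e :: real assume "0 < e"
      from C[OF this] obtain N where "\<forall>n n'. N \<le> n \<longrightarrow> N \<le> n' \<longrightarrow> lp_norm p (f n - f n') < e" ..
      then show "\<exists>M. \<forall>m\<ge>M. \<forall>n\<ge>M. dist (f m i) (f n i) < e"
        using norm_le_lp_norm[OF lp_diff(1)[OF f f], of _ _ i]
        by (intro exI[of _ N]) (metis dist_norm fun_diff_def le_less_trans)
    qed
    then have "\<exists>l. (\<lambda>n. f n i) \<longlonglongrightarrow> l" for i
      by (simp add: Cauchy_convergent_iff convergent_def)
    then obtain v where v: "\<And>i. (\<lambda>n. f n i) \<longlonglongrightarrow> v i" by metis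
    have near: "\<exists>N. \<forall>n\<ge>N. f n - v \<in> lp p \<and> lp_norm p (f n - v) \<le> e" if e: "0 < e" for e
    proof -
      obtain N where N: "\<forall>n n'. N \<le> n \<longrightarrow> N \<le> n' \<longrightarrow> lp_norm p (f n - f n') < e"
        using C[OF e] ..
      have "f n - v \<in> lp p \<and> lp_norm p (f n - v) \<le> e" if "N \<le> n" for n
      proof -
        have ev: "\<forall>\<^sub>F m in sequentially. f n - f m \<in> lp p \<and> lp_norm p (f n - f m) \<le> e"
          unfolding eventually_sequentially
          using N \<open>N \<le> n\<close> lp_diff(1)[OF f f] less_imp_le by blast
        have lim: "(\<lambda>m. (f n - f m) i) \<longlonglongrightarrow> (f n - v) i" for i
          unfolding fun_diff_def by (intro tendsto_diff tendsto_const v)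
        show ?thesis
          using lp_pointwise_limit[OF sequentially_bot _ ev lim] e by (simp add: fun_diff_def)
      qed
      then show ?thesis by blast
    qed
    obtain N where "f N - v \<in> lp p" using near[of 1] by auto
    from lp_diff(1)[OF f[of N] this] have vlp: "v \<in> lp p" by simp
    have "limitin mtopology f v sequentially"
      unfolding limitin_metric eventually_sequentially
    proof (intro conjI vlp allI impI)
      fix e :: real assume "0 < e"
      with near[of "e / 2"] obtain N where "\<forall>n\<ge>N. lp_norm p (f n - v) \<le> e / 2" by auto
      with \<open>0 < e\<close> show "\<exists>N. \<forall>n\<ge>N. f n \<in> lp p \<and> lp_dist p (f n) v < e"
        using f vlp by (intro exI[of _ N]) (auto simp: lp_dist_def)
    qed
    then show "\<exists>x. limitin mtopology f x sequentially" by blast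
  qed
qed

end

section \<open>Bounded and compact operators\<close>

text \<open>Carries the constant explicitly, since sums over infinite families of operators need one
  bound for all members.\<close>

definition op_bound :: "ennreal \<Rightarrow> real \<Rightarrow> seq_op \<Rightarrow> bool" where
  "op_bound p K A \<longleftrightarrow> bounded_op p A \<and> 0 \<le> K \<and> (\<forall>v\<in>lp p. lp_norm p (A v) \<le> K * lp_norm p v)"

text \<open>Bounds by \<open>d\<close> the noncompactness of \<open>Z\<close>, measured by finite
  nets for the image of the unit ball. With \<open>d\<close> visible, the bounds add under sums and
  are multiplied by the operator bound under composition.\<close>

definition finite_net :: "ennreal \<Rightarrow> real \<Rightarrow> seq_op \<Rightarrow> bool" where
  "finite_net p d Z \<longleftrightarrow> (\<exists>F. finite F \<and> F \<subseteq> lp p \<and>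
     (\<forall>v\<in>lp p. lp_norm p v \<le> 1 \<longrightarrow> (\<exists>w\<in>F. lp_norm p (Z v - w) \<le> d)))"

definition precompact :: "ennreal \<Rightarrow> seq_op \<Rightarrow> bool" where
  "precompact p Z \<longleftrightarrow> (\<forall>d>0. finite_net p d Z)"

text \<open>Summed entrywise, to match the entrywise definition of \<open>toeplitz\<close>;
  approximation in norm is derived in \<open>seqsum_approx\<close>.\<close>

definition seqsum :: "('i \<Rightarrow> complex) \<Rightarrow> ('i \<Rightarrow> nat \<Rightarrow> complex) \<Rightarrow> nat \<Rightarrow> complex" where
  "seqsum c u = (\<lambda>j. \<Sum>\<^sub>\<infinity>k. c k * u k j)"

lemma fun_minus_scale: "v - w = v + (\<lambda>i. (-1) * w i)" for v w :: "nat \<Rightarrow> complex"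
  by (simp add: fun_eq_iff)

lemma bounded_op_lp: "bounded_op p A \<Longrightarrow> v \<in> lp p \<Longrightarrow> A v \<in> lp p"
  by (simp add: bounded_op_def)

lemma bounded_op_add: "bounded_op p A \<Longrightarrow> v \<in> lp p \<Longrightarrow> w \<in> lp p \<Longrightarrow> A (v + w) = A v + A w"
  by (simp add: bounded_op_def)

lemma bounded_op_scale: "bounded_op p A \<Longrightarrow> v \<in> lp p \<Longrightarrow> A (\<lambda>i. k * v i) = (\<lambda>i. k * A v i)"
  by (simp add: bounded_op_def)

lemma op_boundD:
  assumes "op_bound p K A"
  shows "bounded_op p A" and "0 \<le> K" and "v \<in> lp p \<Longrightarrow> A v \<in> lp p"
    and "v \<in> lp p \<Longrightarrow> lp_norm p (A v) \<le> K * lp_norm p v"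
  using assms by (auto simp: op_bound_def bounded_op_lp)

lemma op_boundI:
  assumes "0 \<le> K" and "\<And>v. v \<in> lp p \<Longrightarrow> A v \<in> lp p"
    and "\<And>v w. v \<in> lp p \<Longrightarrow> w \<in> lp p \<Longrightarrow> A (v + w) = A v + A w"
    and "\<And>k v. v \<in> lp p \<Longrightarrow> A (\<lambda>i. k * v i) = (\<lambda>i. k * A v i)"
    and "\<And>v. v \<in> lp p \<Longrightarrow> lp_norm p (A v) \<le> K * lp_norm p v"
  shows "op_bound p K A"
  unfolding op_bound_def bounded_op_def using assms by blast

context
  fixes p :: ennreal
  assumes p: "1 \<le> p"
begin

lemma bounded_op_diff:
  assumes "bounded_op p A" "v \<in> lp p" "w \<in> lp p"
  shows "A (v - w) = A v - A w"
  using bounded_op_add[OF assms(1,2) lp_scale(1)[OF p assms(3), of "-1"]]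
    bounded_op_scale[OF assms(1,3), of "-1"] by (simp add: fun_minus_scale)

lemma bounded_op_zero:
  assumes "bounded_op p A"
  shows "A 0 = 0"
  using bounded_op_diff[OF assms lp_zero(1)[OF p] lp_zero(1)[OF p]] by simp

lemma bounded_op_sum:
  assumes A: "bounded_op p A" and "finite I" and "\<And>i. i \<in> I \<Longrightarrow> f i \<in> lp p"
  shows "A (\<Sum>i\<in>I. f i) = (\<Sum>i\<in>I. A (f i))"
  using assms(2,3)
proof (induction I rule: finite_induct)
  case empty
  show ?case unfolding sum.empty by (rule bounded_op_zero[OF A])
next
  case (insert x I)
  have "A (f x + sum f I) = A (f x) + A (sum f I)"
    using insert.prems by (intro bounded_op_add[OF A] lp_sum(1)[OF p insert.hyps(1)]) auto
  moreover have "A (sum f I) = (\<Sum>i\<in>I. A (f i))" using insert by simp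
  ultimately show ?case unfolding sum.insert[OF insert.hyps] by (simp add: plus_fun_def)
qed

lemma bounded_op_iff: "bounded_op p A \<longleftrightarrow> (\<exists>K. op_bound p K A)"
proof
  assume A: "bounded_op p A"
  then obtain K where K: "\<And>v. v \<in> lp p \<Longrightarrow> lp_norm p (A v) \<le> K * lp_norm p v"
    unfolding bounded_op_def by blast
  have "op_bound p (max K 0) A"
    unfolding op_bound_def
  proof (intro conjI A ballI)
    fix v assume v: "v \<in> lp p"
    have "K * lp_norm p v \<le> max K 0 * lp_norm p v"
      using lp_norm_eq_0(1)[OF p v] by (intro mult_right_mono) auto
    with K[OF v] show "lp_norm p (A v) \<le> max K 0 * lp_norm p v" by simp
  qed simp
  then show "\<exists>K. op_bound p K A" ..
qed (auto simp: op_bound_def)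

lemma op_bound_comp:
  assumes A: "op_bound p K A" and B: "op_bound p L B"
  shows "op_bound p (K * L) (\<lambda>v. A (B v))"
proof (rule op_boundI)
  fix v assume v: "v \<in> lp p"
  have "lp_norm p (A (B v)) \<le> K * lp_norm p (B v)" using op_boundD[OF A] op_boundD[OF B] v by blast
  also have "\<dots> \<le> K * (L * lp_norm p v)"
    using op_boundD[OF A] op_boundD[OF B] v by (intro mult_left_mono) auto
  finally show "lp_norm p (A (B v)) \<le> K * L * lp_norm p v" by simp
qed (use op_boundD[OF A] op_boundD[OF B] in \<open>simp_all add: bounded_op_add[OF op_boundD(1)[OF A]] bounded_op_add[OF op_boundD(1)[OF B]]
      bounded_op_scale[OF op_boundD(1)[OF A]] bounded_op_scale[OF op_boundD(1)[OF B]]\<close>)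

lemma op_bound_add:
  assumes A: "op_bound p K A" and B: "op_bound p L B"
  shows "op_bound p (K + L) (\<lambda>v. A v + B v)"
proof (rule op_boundI)
  fix v assume v: "v \<in> lp p"
  show "lp_norm p (A v + B v) \<le> (K + L) * lp_norm p v"
    using lp_norm_triangle(2)[OF p op_boundD(3)[OF A v] op_boundD(3)[OF B v]]
      op_boundD(4)[OF A v] op_boundD(4)[OF B v] by (simp add: distrib_right)
qed (use op_boundD[OF A] op_boundD[OF B] lp_norm_triangle(1)[OF p] in
    \<open>simp_all add: bounded_op_add[OF op_boundD(1)[OF A]] bounded_op_add[OF op_boundD(1)[OF B]]
      bounded_op_scale[OF op_boundD(1)[OF A]] bounded_op_scale[OF op_boundD(1)[OF B]]
      distrib_left fun_eq_iff\<close>)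

lemma op_bound_scale: "op_bound p (norm k) (\<lambda>v i. k * v i)"
  by (rule op_boundI) (use lp_scale[OF p] in \<open>auto simp: fun_eq_iff algebra_simps\<close>)

lemma bounded_op_comp: "bounded_op p A \<Longrightarrow> bounded_op p B \<Longrightarrow> bounded_op p (\<lambda>v. A (B v))"
  unfolding bounded_op_iff using op_bound_comp by blast

lemma bounded_op_plus: "bounded_op p A \<Longrightarrow> bounded_op p B \<Longrightarrow> bounded_op p (\<lambda>v. A v + B v)"
  unfolding bounded_op_iff using op_bound_add by blast

lemma bounded_op_smult: "bounded_op p A \<Longrightarrow> bounded_op p (\<lambda>v i. k * A v i)"
  unfolding bounded_op_iff using op_bound_comp[OF op_bound_scale] by blast

lemma bounded_op_minus:
  assumes "bounded_op p A" "bounded_op p B"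
  shows "bounded_op p (\<lambda>v. A v - B v)"
  using bounded_op_plus[OF assms(1) bounded_op_smult[OF assms(2), of "-1"]] by (simp add: fun_minus_scale)

lemma bounded_op_cong:
  assumes "bounded_op p A" and "\<And>v. v \<in> lp p \<Longrightarrow> B v = A v"
  shows "bounded_op p B"
  using assms lp_norm_triangle(1)[OF p] lp_scale(1)[OF p] unfolding bounded_op_def by simp

section \<open>Finite nets under sums and compositions\<close>

lemma finite_net_mono: "finite_net p d Z \<Longrightarrow> d \<le> e \<Longrightarrow> finite_net p e Z"
  unfolding finite_net_def by (meson order_trans)

lemma finite_net_add:
  assumes "finite_net p d Y" and "finite_net p e Z"
    and "bounded_op p Y" and "bounded_op p Z"
  shows "finite_net p (d + e) (\<lambda>v. Y v + Z v)"
proof -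
  obtain F G where F: "finite F" "F \<subseteq> lp p"
      "\<And>v. v \<in> lp p \<Longrightarrow> lp_norm p v \<le> 1 \<Longrightarrow> \<exists>w\<in>F. lp_norm p (Y v - w) \<le> d"
    and G: "finite G" "G \<subseteq> lp p"
      "\<And>v. v \<in> lp p \<Longrightarrow> lp_norm p v \<le> 1 \<Longrightarrow> \<exists>w\<in>G. lp_norm p (Z v - w) \<le> e"
    using assms(1,2) by (auto simp: finite_net_def)
  show ?thesis
    unfolding finite_net_def
  proof (intro exI[of _ "(\<lambda>(f, g). f + g) ` (F \<times> G)"] conjI ballI impI)
    show "(\<lambda>(f, g). f + g) ` (F \<times> G) \<subseteq> lp p"
      using F(2) G(2) lp_norm_triangle(1)[OF p] by auto
    fix v assume v: "v \<in> lp p" "lp_norm p v \<le> 1"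
    obtain f g where f: "f \<in> F" "lp_norm p (Y v - f) \<le> d" and g: "g \<in> G" "lp_norm p (Z v - g) \<le> e"
      using F(3)[OF v] G(3)[OF v] by blast
    have "lp_norm p ((Y v - f) + (Z v - g)) \<le> d + e"
      using lp_norm_triangle(2)[OF p lp_diff(1)[OF p bounded_op_lp[OF assms(3) v(1)]]
          lp_diff(1)[OF p bounded_op_lp[OF assms(4) v(1)]], of f g] f g F(2) G(2) by force
    moreover have "(Y v - f) + (Z v - g) = (Y v + Z v) - (f + g)" by (simp add: algebra_simps)
    ultimately show "\<exists>w\<in>(\<lambda>(f, g). f + g) ` (F \<times> G). lp_norm p (Y v + Z v - w) \<le> d + e"
      using f(1) g(1) by force
  qed (use F G in auto)
qed

lemma finite_net_small:
  assumes "\<And>v. v \<in> lp p \<Longrightarrow> lp_norm p v \<le> 1 \<Longrightarrow> lp_norm p (Z v) \<le> d"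
  shows "finite_net p d Z"
  unfolding finite_net_def using assms lp_zero[OF p] by (intro exI[of _ "{0}"]) auto

lemma finite_net_comp_left:
  assumes A: "op_bound p K A" and Z: "bounded_op p Z" "finite_net p d Z"
  shows "finite_net p (K * d) (\<lambda>v. A (Z v))"
proof -
  obtain F where F: "finite F" "F \<subseteq> lp p"
      "\<And>v. v \<in> lp p \<Longrightarrow> lp_norm p v \<le> 1 \<Longrightarrow> \<exists>w\<in>F. lp_norm p (Z v - w) \<le> d"
    using Z(2) by (auto simp: finite_net_def)
  show ?thesis
    unfolding finite_net_def
  proof (intro exI[of _ "A ` F"] conjI ballI impI)
    fix v assume v: "v \<in> lp p" "lp_norm p v \<le> 1"
    obtain w where w: "w \<in> F" "lp_norm p (Z v - w) \<le> d" using F(3)[OF v] by blast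
    have wl: "w \<in> lp p" "Z v \<in> lp p" using w(1) F(2) bounded_op_lp[OF Z(1) v(1)] by auto
    have "lp_norm p (A (Z v - w)) \<le> K * lp_norm p (Z v - w)"
      by (rule op_boundD(4)[OF A lp_diff(1)[OF p wl(2,1)]])
    also have "\<dots> \<le> K * d" using w(2) op_boundD(2)[OF A] by (rule mult_left_mono)
    finally show "\<exists>w\<in>A ` F. lp_norm p (A (Z v) - w) \<le> K * d"
      using w(1) bounded_op_diff[OF op_boundD(1)[OF A] wl(2,1)] by auto
  qed (use F op_boundD(3)[OF A] in auto)
qed

lemma finite_net_comp_right:
  assumes A: "op_bound p K A" and K: "0 < K" and Z: "bounded_op p Z" "finite_net p d Z"
  shows "finite_net p (K * d) (\<lambda>v. Z (A v))"
proof -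
  obtain F where F: "finite F" "F \<subseteq> lp p"
      "\<And>v. v \<in> lp p \<Longrightarrow> lp_norm p v \<le> 1 \<Longrightarrow> \<exists>w\<in>F. lp_norm p (Z v - w) \<le> d"
    using Z(2) by (auto simp: finite_net_def)
  let ?s = "\<lambda>w :: nat \<Rightarrow> complex. \<lambda>i. of_real K * w i"
  show ?thesis
    unfolding finite_net_def
  proof (intro exI[of _ "?s ` F"] conjI ballI impI)
    fix v assume v: "v \<in> lp p" "lp_norm p v \<le> 1"
    note Av = op_boundD(3)[OF A v(1)]
    \<comment> \<open>\<open>A v\<close> has norm at most \<open>K\<close>; dividing by
      \<open>K\<close> brings it into the unit ball, where the net of \<open>Z\<close>
      applies.\<close>
    define u where "u = (\<lambda>i. of_real (1 / K) * A v i)"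
    have u: "u \<in> lp p" unfolding u_def by (rule lp_scale(1)[OF p Av])
    have "lp_norm p (A v) \<le> K"
      using order_trans[OF op_boundD(4)[OF A v(1)] mult_left_mono[OF v(2) less_imp_le[OF K]]] by simp
    then have "lp_norm p u \<le> 1"
      unfolding u_def lp_scale(2)[OF p Av] using K by (simp add: norm_divide)
    then obtain w where w: "w \<in> F" "lp_norm p (Z u - w) \<le> d" using F(3)[OF u] by blast
    have wl: "w \<in> lp p" "Z u \<in> lp p" using w(1) F(2) bounded_op_lp[OF Z(1) u] by auto
    have "A v = ?s u" using K by (simp add: u_def fun_eq_iff)
    then have "Z (A v) = ?s (Z u)" using bounded_op_scale[OF Z(1) u] by simp
    then have "Z (A v) - ?s w = ?s (Z u - w)" by (simp add: fun_eq_iff algebra_simps)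
    then have "lp_norm p (Z (A v) - ?s w) \<le> K * d"
      using lp_scale(2)[OF p lp_diff(1)[OF p wl(2,1)], of "of_real K"] w(2) K
      by (simp add: mult_left_mono)
    with w(1) show "\<exists>w\<in>?s ` F. lp_norm p (Z (A v) - w) \<le> K * d" by blast
  qed (use F lp_scale(1)[OF p] in auto)
qed

lemma precompact_cong:
  assumes "precompact p Y" and "\<And>v. v \<in> lp p \<Longrightarrow> Z v = Y v"
  shows "precompact p Z"
  using assms by (simp add: precompact_def finite_net_def)

lemma precompact_comp_left:
  assumes "bounded_op p A" and "bounded_op p Z" and "precompact p Z"
  shows "precompact p (\<lambda>v. A (Z v))"
proof -
  obtain K where K: "op_bound p K A" using assms(1) by (auto simp: bounded_op_iff)
  show ?thesis unfolding precompact_def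
  proof (intro allI impI)
    fix d :: real assume d: "0 < d"
    have "K * (d / (K + 1)) \<le> d" using op_boundD(2)[OF K] d by (simp add: field_simps)
    moreover have "finite_net p (K * (d / (K + 1))) (\<lambda>v. A (Z v))"
      using assms(3) op_boundD(2)[OF K] d
      by (intro finite_net_comp_left[OF K assms(2)]) (auto simp: precompact_def)
    ultimately show "finite_net p d (\<lambda>v. A (Z v))" using finite_net_mono by blast
  qed
qed

lemma precompact_comp_right:
  assumes "bounded_op p A" and "bounded_op p Z" and "precompact p Z"
  shows "precompact p (\<lambda>v. Z (A v))"
proof -
  obtain K where K: "op_bound p K A" using assms(1) by (auto simp: bounded_op_iff)
  \<comment> \<open>The rescaling divides by the bound, and \<open>K\<close> itself may be
    0.\<close>
  have K1: "op_bound p (K + 1) A"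
    using K op_boundD[OF K] lp_norm_eq_0(1)[OF p]
    by (auto simp: op_bound_def distrib_right intro: add_increasing2)
  show ?thesis unfolding precompact_def
  proof (intro allI impI)
    fix d :: real assume d: "0 < d"
    have "finite_net p ((K + 1) * (d / (K + 1))) (\<lambda>v. Z (A v))"
      using assms(3) op_boundD(2)[OF K] d
      by (intro finite_net_comp_right[OF K1 _ assms(2)]) (auto simp: precompact_def)
    then show "finite_net p d (\<lambda>v. Z (A v))" using op_boundD(2)[OF K] by simp
  qed
qed

lemma precompact_add:
  assumes "bounded_op p Y" "bounded_op p Z" "precompact p Y" "precompact p Z"
  shows "precompact p (\<lambda>v. Y v + Z v)"
  unfolding precompact_def
proof (intro allI impI)
  fix d :: real assume "0 < d"
  then have "finite_net p (d / 2 + d / 2) (\<lambda>v. Y v + Z v)"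
    using assms by (intro finite_net_add) (auto simp: precompact_def)
  then show "finite_net p d (\<lambda>v. Y v + Z v)" by simp
qed

lemma precompact_smult:
  assumes "bounded_op p Z" "precompact p Z"
  shows "precompact p (\<lambda>v i. k * Z v i)"
  using precompact_comp_left[OF op_boundD(1)[OF op_bound_scale] assms] .

lemma precompact_zero: "precompact p (\<lambda>v. 0)"
  unfolding precompact_def using lp_zero[OF p] by (auto intro!: finite_net_small)

lemma bounded_op_null: "bounded_op p (\<lambda>v. 0)"
  unfolding bounded_op_def using lp_zero[OF p] lp_norm_eq_0(1)[OF p]
  by (auto simp: fun_eq_iff intro!: exI[of _ 0])

lemma precompact_sum:
  assumes "finite I" and "\<And>i. i \<in> I \<Longrightarrow> bounded_op p (Z i) \<and> precompact p (Z i)"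
  shows "bounded_op p (\<lambda>v. \<Sum>i\<in>I. Z i v) \<and> precompact p (\<lambda>v. \<Sum>i\<in>I. Z i v)"
  using assms
proof (induction I rule: finite_induct)
  case empty
  then show ?case unfolding sum.empty using bounded_op_null precompact_zero by blast
next
  case (insert x I)
  then show ?case unfolding sum.insert[OF insert.hyps]
    by (intro conjI bounded_op_plus precompact_add) auto
qed

section \<open>Total boundedness and compact closure\<close>

lemma precompact_imp_compact_op:
  assumes E: "bounded_op p E" and pc: "precompact p E"
  shows "compact_op p E"
  unfolding compact_op_def
proof (intro conjI E allI impI)
  interpret Metric_space "lp p" "lp_dist p" by (rule Metric_space_lp[OF p])
  fix S assume S: "S \<subseteq> lp p" "mbounded S"
  then obtain x B where B: "0 < B" "S \<subseteq> mcball x B" unfolding mbounded_pos by blast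
  have nS: "lp_norm p v \<le> lp_norm p x + B" if "v \<in> S" for v
  proof -
    have v: "v \<in> lp p" "x \<in> lp p" "lp_norm p (v - x) \<le> B"
      using subsetD[OF B(2) that] lp_norm_minus(2)[of p "x - v"] by (auto simp: lp_dist_def)
    have "lp_norm p ((v - x) + x) \<le> lp_norm p (v - x) + lp_norm p x"
      by (rule lp_norm_triangle(2)[OF p lp_diff(1)[OF p v(1,2)] v(2)])
    with v(3) show ?thesis by simp
  qed
  define R where "R = max 1 (lp_norm p x + B)"
  have R: "0 < R" "\<And>v. v \<in> S \<Longrightarrow> lp_norm p v \<le> R"
    using nS by (auto simp: R_def le_max_iff_disj)
  have sub: "E ` S \<subseteq> lp p" using S(1) bounded_op_lp[OF E] by auto
  have "\<exists>K. finite K \<and> K \<subseteq> E ` S \<and> E ` S \<subseteq> (\<Union>x\<in>K. mball x e)" if e: "0 < e" for e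
  proof -
    \<comment> \<open>Every vector of \<open>S\<close> is \<open>R\<close> times a vector of the
      unit ball, so composing \<open>E\<close> with this scaling yields a net of mesh e / 3 for the
      image of \<open>S\<close>.\<close>
    have "finite_net p (R * (e / (3 * R))) (\<lambda>v. E (\<lambda>i. of_real R * v i))"
      using R(1) e pc op_bound_scale[of "of_real R"]
      by (intro finite_net_comp_right[OF _ R(1) E]) (auto simp: precompact_def)
    then obtain F where F: "finite F" "F \<subseteq> lp p"
      "\<And>v. v \<in> lp p \<Longrightarrow> lp_norm p v \<le> 1 \<Longrightarrow> \<exists>w\<in>F. lp_norm p (E (\<lambda>i. of_real R * v i) - w) \<le> e / 3"
      using R(1) by (auto simp: finite_net_def)
    have near: "\<exists>w\<in>F. lp_norm p (E v - w) \<le> e / 3" if v: "v \<in> S" for v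
    proof -
      have vl: "v \<in> lp p" using v S(1) by auto
      have "lp_norm p (\<lambda>i. of_real (1 / R) * v i) \<le> 1"
        unfolding lp_scale(2)[OF p vl] using R v by (simp add: norm_divide)
      from F(3)[OF lp_scale(1)[OF p vl] this] show ?thesis using R(1) by simp
    qed
    define pick where "pick w = (SOME y. y \<in> E ` S \<and> lp_norm p (y - w) \<le> e / 3)" for w
    define F' where "F' = {w \<in> F. \<exists>y\<in>E ` S. lp_norm p (y - w) \<le> e / 3}"
    have pick: "pick w \<in> E ` S" "lp_norm p (pick w - w) \<le> e / 3" if "w \<in> F'" for w
      using someI_ex[of "\<lambda>y. y \<in> E ` S \<and> lp_norm p (y - w) \<le> e / 3"] that
      unfolding pick_def F'_def by blast+
    show ?thesis
    proof (intro exI[of _ "pick ` F'"] conjI subsetI)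
      show "finite (pick ` F')" using F(1) by (simp add: F'_def)
      show "y \<in> E ` S" if "y \<in> pick ` F'" for y using that pick(1) by auto
      fix y assume y: "y \<in> E ` S"
      then obtain w where w: "w \<in> F" "lp_norm p (y - w) \<le> e / 3" using near by auto
      then have wF: "w \<in> F'" using y by (auto simp: F'_def)
      have l: "y \<in> lp p" "w \<in> lp p" "pick w \<in> lp p" using y sub w(1) F(2) pick(1)[OF wF] by auto
      have "lp_norm p ((pick w - w) - (y - w)) \<le> lp_norm p (pick w - w) + lp_norm p (y - w)"
        by (rule lp_diff(2)[OF p lp_diff(1)[OF p l(3,2)] lp_diff(1)[OF p l(1,2)]])
      then have "lp_norm p (pick w - y) \<le> 2 * e / 3" using pick(2)[OF wF] w(2) by simp
      then have "y \<in> mball (pick w) e" using l e by (simp add: lp_dist_def)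
      with wF show "y \<in> (\<Union>x\<in>pick ` F'. mball x e)" by blast
    qed
  qed
  then have "mtotally_bounded (E ` S)" by (auto simp: mtotally_bounded_def)
  then show "compactin mtopology (mtopology closure_of E ` S)"
    using mtotally_bounded_eq_compact_closure_of[OF mcomplete_lp[OF p]] by blast
qed

lemma compact_op_imp_precompact:
  assumes E: "compact_op p E"
  shows "precompact p E"
  unfolding precompact_def
proof (intro allI impI)
  interpret Metric_space "lp p" "lp_dist p" by (rule Metric_space_lp[OF p])
  fix d :: real assume d: "0 < d"
  define S where "S = {v \<in> lp p. lp_norm p v \<le> 1}"
  have "lp_dist p 0 v = lp_norm p v" if "v \<in> lp p" for v
    using that lp_zero[OF p] lp_norm_minus(2)[of p v] by (simp add: lp_dist_def)
  then have "S \<subseteq> mcball 0 1" using lp_zero[OF p] by (auto simp: S_def)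
  then have mb: "mbounded S" unfolding mbounded_def by blast
  have S: "S \<subseteq> lp p" by (simp add: S_def)
  have ES: "E ` S \<subseteq> lp p" using E S bounded_op_lp[of p E] by (auto simp: compact_op_def)
  have "compactin mtopology (mtopology closure_of E ` S)"
    using E S mb unfolding compact_op_def by blast
  then have "mtotally_bounded (E ` S)"
    by (rule compact_closure_of_imp_mtotally_bounded[OF _ ES])
  then have "\<exists>K. finite K \<and> K \<subseteq> E ` S \<and> E ` S \<subseteq> (\<Union>x\<in>K. mball x d)"
    using d by (simp add: mtotally_bounded_def)
  then obtain K where K: "finite K" "K \<subseteq> E ` S" "E ` S \<subseteq> (\<Union>x\<in>K. mball x d)"
    by (elim exE conjE)
  show "finite_net p d E"
    unfolding finite_net_def
  proof (intro exI[of _ K] conjI K(1) ballI impI)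
    show "K \<subseteq> lp p" using K(2) ES by blast
    fix v assume "v \<in> lp p" "lp_norm p v \<le> 1"
    then have "E v \<in> E ` S" by (auto simp: S_def)
    with K(3) obtain w where w: "w \<in> K" "E v \<in> mball w d" by blast
    then have "lp_norm p (w - E v) < d" by (auto simp: lp_dist_def)
    then have "lp_norm p (E v - w) \<le> d" using lp_norm_minus(2)[of p "w - E v"] by simp
    with w(1) show "\<exists>w\<in>K. lp_norm p (E v - w) \<le> d" by blast
  qed
qed

end

section \<open>Absolutely convergent operator sums and Toeplitz operators\<close>

lemma sum_seq_apply: "(\<Sum>k\<in>F. u k) j = (\<Sum>k\<in>F. u k j)" for u :: "'i \<Rightarrow> nat \<Rightarrow> complex"
  by (induction F rule: infinite_finite_induct) auto

text \<open>The Toeplitz operator of z^k. For negative \<open>k\<close> zeros fill the first rows,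
  and the guard keeps \<open>nat\<close> away from negative arguments.\<close>

definition shift :: "int \<Rightarrow> seq_op" where
  "shift k v = (\<lambda>i. if 0 \<le> int i + k then v (nat (int i + k)) else 0)"

lemma shift_zero: "shift 0 v = v"
  by (simp add: shift_def)

text \<open>Information is lost only if the left factor has \<open>j < 0\<close> and writes zeros
  into the first -j rows; hence the defect has finite rank.\<close>

lemma shift_shift:
  "shift (j + m) v - shift j (shift m v) = (\<lambda>i. if i < nat (- j) then shift (j + m) v i else 0)"
  by (auto simp: shift_def fun_eq_iff algebra_simps)

text \<open>Summation by diagonals: row \<open>i\<close> meets only the diagonals k \<ge> -i, and
  the remaining terms vanish by the guard in \<open>shift\<close>.\<close>

lemma toeplitz_eq_seqsum: "toeplitz a v = seqsum a (\<lambda>k. shift k v)"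
proof
  fix i
  have "bij_betw (\<lambda>j. int j - int i) UNIV {k. 0 \<le> int i + k}"
    by (rule bij_betwI[where g="\<lambda>k. nat (int i + k)"]) auto
  from infsum_reindex_bij_betw[OF this, of "\<lambda>k. a k * shift k v i"]
  have "toeplitz a v i = (\<Sum>\<^sub>\<infinity>k\<in>{k. 0 \<le> int i + k}. a k * shift k v i)"
    by (simp add: toeplitz_def shift_def)
  also have "\<dots> = seqsum a (\<lambda>k. shift k v) i"
    unfolding seqsum_def by (rule infsum_cong_neutral) (auto simp: shift_def)
  finally show "toeplitz a v i = seqsum a (\<lambda>k. shift k v) i" .
qed

context
  fixes p :: ennreal
  assumes p: "1 \<le> p"
begin

lemma seqsum_summable:
  assumes c: "c abs_summable_on UNIV" and u: "\<And>k. u k \<in> lp p" "\<And>k. lp_norm p (u k) \<le> K"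
  shows "(\<lambda>k. c k * u k j) summable_on UNIV"
proof -
  have "norm (u k j) \<le> K" for k using norm_le_lp_norm[OF p u(1)] u(2) order_trans by blast
  from abs_summable_summable[OF abs_summable_mult_bounded[where u="\<lambda>k. u k j", OF c this]] show ?thesis .
qed

text \<open>The finite partial sums stay in one ball, and that ball is closed under entrywise
  limits.\<close>

lemma seqsum_lp:
  assumes c: "c abs_summable_on UNIV" and u: "\<And>k. u k \<in> lp p" "\<And>k. lp_norm p (u k) \<le> K"
  shows "seqsum c u \<in> lp p" and "lp_norm p (seqsum c u) \<le> l1_norm c * K"
proof -
  have K: "0 \<le> K" using lp_norm_eq_0(1)[OF p u(1)] u(2) order_trans by blast
  define f where "f F = (\<Sum>k\<in>F. (\<lambda>j. c k * u k j))" for F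
  have f: "f F \<in> lp p \<and> lp_norm p (f F) \<le> l1_norm c * K" if F: "finite F" for F
  proof -
    note s = lp_scale[OF p u(1)]
    have "lp_norm p (f F) \<le> (\<Sum>k\<in>F. lp_norm p (\<lambda>j. c k * u k j))"
      unfolding f_def by (rule lp_sum(2)[OF p F]) (rule s(1))
    also have "\<dots> \<le> (\<Sum>k\<in>F. norm (c k) * K)"
      by (intro sum_mono) (simp add: s(2) u(2) mult_left_mono)
    also have "\<dots> \<le> l1_norm c * K"
      using sum_norm_le_l1_norm[OF c F] K by (simp add: sum_distrib_right[symmetric] mult_right_mono)
    finally have "lp_norm p (f F) \<le> l1_norm c * K" .
    moreover have "f F \<in> lp p" unfolding f_def by (rule lp_sum(1)[OF p F]) (rule s(1))
    ultimately show ?thesis by simp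
  qed
  have ev: "eventually (\<lambda>F. f F \<in> lp p \<and> lp_norm p (f F) \<le> l1_norm c * K) (finite_subsets_at_top UNIV)"
    by (rule eventually_finite_subsets_at_top_weakI) (use f in auto)
  have lim: "((\<lambda>F. f F j) \<longlongrightarrow> seqsum c u j) (finite_subsets_at_top UNIV)" for j
    using infsum_tendsto[OF seqsum_summable[where u=u and j=j, OF c u]]
    by (simp add: f_def seqsum_def sum_seq_apply)
  have "0 \<le> l1_norm c * K" using K l1_norm_nonneg[of c] by simp
  from lp_pointwise_limit[OF p finite_subsets_at_top_neq_bot this ev lim]
  show "seqsum c u \<in> lp p" and "lp_norm p (seqsum c u) \<le> l1_norm c * K" by simp_all
qed

lemma seqsum_split:
  assumes c: "c abs_summable_on UNIV" and u: "\<And>k. u k \<in> lp p" "\<And>k. lp_norm p (u k) \<le> K"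
    and F: "finite F"
  shows "seqsum c u = (\<Sum>k\<in>F. (\<lambda>j. c k * u k j)) + seqsum (\<lambda>k. if k \<in> F then 0 else c k) u"
proof
  fix j
  note s = seqsum_summable[where u=u and j=j, OF c u]
  have "(\<Sum>\<^sub>\<infinity>k. c k * u k j) = (\<Sum>\<^sub>\<infinity>k\<in>F \<union> -F. c k * u k j)" by simp
  also have "\<dots> = (\<Sum>k\<in>F. c k * u k j) + (\<Sum>\<^sub>\<infinity>k\<in>-F. c k * u k j)"
    using F summable_on_subset_banach[where B="- F", OF s subset_UNIV] by (subst infsum_Un_disjoint) auto
  also have "(\<Sum>\<^sub>\<infinity>k\<in>-F. c k * u k j) = (\<Sum>\<^sub>\<infinity>k. (if k \<in> F then 0 else c k) * u k j)"
    by (rule infsum_cong_neutral) auto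
  finally show "seqsum c u j
      = ((\<Sum>k\<in>F. (\<lambda>j. c k * u k j)) + seqsum (\<lambda>k. if k \<in> F then 0 else c k) u) j"
    by (simp add: seqsum_def sum_seq_apply)
qed

text \<open>\<open>F\<close> is chosen before \<open>u\<close> and so serves all families in the
  ball at once. Both the interchange with operators and the compactness of sums rest on this
  uniformity.\<close>

lemma seqsum_approx:
  fixes c :: "'i \<Rightarrow> complex"
  assumes c: "c abs_summable_on UNIV" and K: "0 \<le> K" and e: "0 < e"
  shows "\<exists>F. finite F \<and> (\<forall>u. (\<forall>k. u k \<in> lp p \<and> lp_norm p (u k) \<le> K) \<longrightarrow>
    seqsum c u - (\<Sum>k\<in>F. (\<lambda>j. c k * u k j)) \<in> lp p \<and>
    lp_norm p (seqsum c u - (\<Sum>k\<in>F. (\<lambda>j. c k * u k j))) \<le> e)"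
proof -
  have "0 < e / (K + 1)" using K e by simp
  from l1_norm_tail[OF c this] obtain F where F: "finite F"
    "\<And>G. F \<subseteq> G \<Longrightarrow> l1_norm (\<lambda>k. if k \<in> G then 0 else c k) \<le> e / (K + 1)" by blast
  show ?thesis
  proof (intro exI[of _ F] conjI[OF F(1)] allI impI)
    fix u :: "'i \<Rightarrow> nat \<Rightarrow> complex"
    assume "\<forall>k. u k \<in> lp p \<and> lp_norm p (u k) \<le> K"
    then have u: "\<And>k. u k \<in> lp p" "\<And>k. lp_norm p (u k) \<le> K" by auto
    let ?c = "\<lambda>k. if k \<in> F then 0 else c k"
    have c': "?c abs_summable_on UNIV" by (rule l1_norm_mono(1)[OF c]) auto
    have "l1_norm ?c * K \<le> e / (K + 1) * K" using F(2)[of F] K by (intro mult_right_mono) auto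
    also have "\<dots> \<le> e" using K e by (simp add: field_simps)
    finally have "lp_norm p (seqsum ?c u) \<le> e" using seqsum_lp(2)[where u=u, OF c' u] by simp
    moreover have "seqsum c u - (\<Sum>k\<in>F. (\<lambda>j. c k * u k j)) = seqsum ?c u"
      using seqsum_split[where u=u, OF c u F(1)] by simp
    ultimately show "seqsum c u - (\<Sum>k\<in>F. (\<lambda>j. c k * u k j)) \<in> lp p \<and>
        lp_norm p (seqsum c u - (\<Sum>k\<in>F. (\<lambda>j. c k * u k j))) \<le> e"
      using seqsum_lp(1)[where u=u, OF c' u] by simp
  qed
qed

text \<open>The sum is an entrywise one, which \<open>R\<close> has no reason to respect; but it is
  also a norm limit of finite sums, and those pass through \<open>R\<close> by linearity.\<close>

lemma bounded_op_seqsum: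
  fixes c :: "'i \<Rightarrow> complex"
  assumes R: "bounded_op p R" and c: "c abs_summable_on UNIV"
    and u: "\<And>k. u k \<in> lp p" "\<And>k. lp_norm p (u k) \<le> K"
  shows "R (seqsum c u) = seqsum c (\<lambda>k. R (u k))"
proof -
  obtain L where L: "op_bound p L R" using R by (auto simp: bounded_op_iff[OF p])
  note Ru = bounded_op_lp[OF R u(1)]
  have K: "0 \<le> K" using lp_norm_eq_0(1)[OF p u(1)] u(2) order_trans by blast
  have nRu: "lp_norm p (R (u k)) \<le> L * K" for k
    using order_trans[OF op_boundD(4)[OF L u(1)] mult_left_mono[OF u(2) op_boundD(2)[OF L]]] .
  define D where "D = R (seqsum c u) - seqsum c (\<lambda>k. R (u k))"
  note su = seqsum_lp(1)[where u=u, OF c u] and sRu = seqsum_lp(1)[where u="\<lambda>k. R (u k)", OF c Ru nRu]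
  have D: "D \<in> lp p" unfolding D_def by (rule lp_diff(1)[OF p bounded_op_lp[OF R su] sRu])
  have "lp_norm p D \<le> 0 + e" if e: "0 < e" for e
  proof -
    \<comment> \<open>Dominates the bounds of both families, so that one \<open>F\<close>
      approximates the sum over \<open>u\<close> and the sum over its image under
      \<open>R\<close>.\<close>
    define M where "M = K + L * K + 1"
    have M: "0 \<le> M" "K \<le> M" "L * K \<le> M" using K op_boundD(2)[OF L] by (auto simp: M_def)
    have "0 < e / (L + 1)" using e op_boundD(2)[OF L] by simp
    from seqsum_approx[OF c M(1) this] obtain F where F: "finite F"
      and approx: "\<forall>u. (\<forall>k. u k \<in> lp p \<and> lp_norm p (u k) \<le> M) \<longrightarrow>
        seqsum c u - (\<Sum>k\<in>F. (\<lambda>j. c k * u k j)) \<in> lp p \<and>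
        lp_norm p (seqsum c u - (\<Sum>k\<in>F. (\<lambda>j. c k * u k j))) \<le> e / (L + 1)"
      by (elim exE conjE)
    let ?s = "\<lambda>w :: 'i \<Rightarrow> nat \<Rightarrow> complex. \<Sum>k\<in>F. (\<lambda>j. c k * w k j)"
    have a: "seqsum c u - ?s u \<in> lp p" "lp_norm p (seqsum c u - ?s u) \<le> e / (L + 1)"
      using approx[rule_format, of u] u(1) order_trans[OF u(2) M(2)] by auto
    have b: "seqsum c (\<lambda>k. R (u k)) - ?s (\<lambda>k. R (u k)) \<in> lp p"
      "lp_norm p (seqsum c (\<lambda>k. R (u k)) - ?s (\<lambda>k. R (u k))) \<le> e / (L + 1)"
      using approx[rule_format, of "\<lambda>k. R (u k)"] Ru order_trans[OF nRu M(3)] by auto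
    have su': "?s u \<in> lp p" by (rule lp_sum(1)[OF p F]) (rule lp_scale(1)[OF p u(1)])
    have "R (?s u) = ?s (\<lambda>k. R (u k))"
      using bounded_op_sum[OF p R F, of "\<lambda>k j. c k * u k j"] lp_scale(1)[OF p u(1)]
        bounded_op_scale[OF R u(1)] by simp
    then have "D = R (seqsum c u - ?s u) - (seqsum c (\<lambda>k. R (u k)) - ?s (\<lambda>k. R (u k)))"
      using bounded_op_diff[OF p R su su'] by (simp add: D_def)
    then have "lp_norm p D \<le> lp_norm p (R (seqsum c u - ?s u)) + e / (L + 1)"
      using lp_diff(2)[OF p bounded_op_lp[OF R a(1)] b(1)] b(2) by simp
    also have "lp_norm p (R (seqsum c u - ?s u)) \<le> L * (e / (L + 1))"
      using order_trans[OF op_boundD(4)[OF L a(1)] mult_left_mono[OF a(2) op_boundD(2)[OF L]]] .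
    also have "L * (e / (L + 1)) + e / (L + 1) = (L + 1) * (e / (L + 1))"
      by (simp only: distrib_right mult_1)
    also have "\<dots> = e" using op_boundD(2)[OF L] by simp
    finally show ?thesis by simp
  qed
  then have "lp_norm p D \<le> 0" by (rule field_le_epsilon)
  then have "D = 0" using lp_norm_eq_0[OF p D] by simp
  then show ?thesis by (simp add: D_def)
qed

lemma seqsum_add:
  assumes "c abs_summable_on UNIV" and "\<And>k. u k \<in> lp p" "\<And>k. lp_norm p (u k) \<le> K"
    and "\<And>k. w k \<in> lp p" "\<And>k. lp_norm p (w k) \<le> L"
  shows "seqsum c (\<lambda>k. u k + w k) = seqsum c u + seqsum c w"
  using infsum_add[OF seqsum_summable[where u=u, OF assms(1-3)] seqsum_summable[where u=w, OF assms(1,4,5)]]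
  by (simp add: seqsum_def fun_eq_iff distrib_left)

lemma seqsum_tensor:
  assumes c: "c abs_summable_on UNIV" and d: "d abs_summable_on UNIV"
    and u: "\<And>k m. u k m \<in> lp p" "\<And>k m. lp_norm p (u k m) \<le> K"
  shows "seqsum c (\<lambda>k. seqsum d (u k)) = seqsum (\<lambda>(k, m). c k * d m) (\<lambda>(k, m). u k m)"
proof
  fix j
  have "norm (u k m j) \<le> K" for k m using norm_le_lp_norm[OF p u(1)] u(2) order_trans by blast
  from infsum_tensor[where u="\<lambda>k m. u k m j", OF c d this]
  show "seqsum c (\<lambda>k. seqsum d (u k)) j = seqsum (\<lambda>(k, m). c k * d m) (\<lambda>(k, m). u k m) j"
    by (simp add: seqsum_def case_prod_unfold)
qed

lemma seqsum_push:
  assumes f: "f abs_summable_on UNIV" and u: "\<And>k. u k \<in> lp p" "\<And>k. lp_norm p (u k) \<le> K"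
  shows "seqsum f (\<lambda>i. u (\<phi> i)) = seqsum (push \<phi> f) u"
proof
  fix j
  have "norm (u k j) \<le> K" for k using norm_le_lp_norm[OF p u(1)] u(2) order_trans by blast
  from infsum_push[where u="\<lambda>k. u k j", OF f this] show "seqsum f (\<lambda>i. u (\<phi> i)) j = seqsum (push \<phi> f) u j"
    by (simp add: seqsum_def)
qed

lemma op_bound_seqsum:
  assumes c: "c abs_summable_on UNIV" and Z: "\<And>k. op_bound p K (Z k)"
  shows "op_bound p (l1_norm c * K) (\<lambda>v. seqsum c (\<lambda>k. Z k v))"
proof (rule op_boundI)
  note Zl = op_boundD(3)[OF Z] and Zn = op_boundD(4)[OF Z]
  show "0 \<le> l1_norm c * K" using l1_norm_nonneg[of c] op_boundD(2)[OF Z] by simp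
  fix v assume v: "v \<in> lp p"
  show "seqsum c (\<lambda>k. Z k v) \<in> lp p" by (rule seqsum_lp(1)[where u="\<lambda>k. Z k v", OF c Zl[OF v] Zn[OF v]])
  show "lp_norm p (seqsum c (\<lambda>k. Z k v)) \<le> l1_norm c * K * lp_norm p v"
    using seqsum_lp(2)[where u="\<lambda>k. Z k v", OF c Zl[OF v] Zn[OF v]] by (simp add: mult.assoc)
  show "seqsum c (\<lambda>k. Z k (v + w)) = seqsum c (\<lambda>k. Z k v) + seqsum c (\<lambda>k. Z k w)"
    if w: "w \<in> lp p" for w
    using seqsum_add[where u="\<lambda>k. Z k v" and w="\<lambda>k. Z k w", OF c Zl[OF v] Zn[OF v] Zl[OF w] Zn[OF w]]
      bounded_op_add[OF op_boundD(1)[OF Z] v w] by simp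
  show "seqsum c (\<lambda>k. Z k (\<lambda>i. r * v i)) = (\<lambda>i. r * seqsum c (\<lambda>k. Z k v) i)" for r
    using bounded_op_scale[OF op_boundD(1)[OF Z] v, of _ r]
    by (simp add: seqsum_def infsum_cmult_right'[symmetric] mult.left_commute)
qed

text \<open>A finite partial sum is precompact and the remainder is small uniformly on the unit
  ball; each receives half of \<open>d\<close>.\<close>

lemma precompact_seqsum:
  assumes c: "c abs_summable_on UNIV" and Z: "\<And>k. op_bound p K (Z k)"
    and pc: "\<And>k. precompact p (Z k)"
  shows "precompact p (\<lambda>v. seqsum c (\<lambda>k. Z k v))"
  unfolding precompact_def
proof (intro allI impI)
  fix d :: real assume "0 < d"
  then have d: "0 < d / 2" by simp
  from seqsum_approx[OF c op_boundD(2)[OF Z] d] obtain F where F: "finite F"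
    and approx: "\<forall>u. (\<forall>k. u k \<in> lp p \<and> lp_norm p (u k) \<le> K) \<longrightarrow>
      seqsum c u - (\<Sum>k\<in>F. (\<lambda>j. c k * u k j)) \<in> lp p \<and>
      lp_norm p (seqsum c u - (\<Sum>k\<in>F. (\<lambda>j. c k * u k j))) \<le> d / 2"
    by (elim exE conjE)
  let ?S = "\<lambda>v. \<Sum>k\<in>F. (\<lambda>j. c k * Z k v j)"
  let ?R = "\<lambda>v. seqsum c (\<lambda>k. Z k v) - ?S v"
  have S: "bounded_op p ?S \<and> precompact p ?S"
    using F bounded_op_smult[OF p op_boundD(1)[OF Z]] precompact_smult[OF p op_boundD(1)[OF Z] pc]
    by (intro precompact_sum[OF p]) auto
  have R: "bounded_op p ?R"
    by (intro bounded_op_minus[OF p] op_boundD(1)[OF op_bound_seqsum[where Z=Z, OF c Z]] conjunct1[OF S])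
  have "finite_net p (d / 2) ?R"
  proof (rule finite_net_small[OF p])
    fix v assume v: "v \<in> lp p" "lp_norm p v \<le> 1"
    have "lp_norm p (Z k v) \<le> K" for k
      using order_trans[OF op_boundD(4)[OF Z v(1)] mult_left_mono[OF v(2) op_boundD(2)[OF Z]]] by simp
    then show "lp_norm p (?R v) \<le> d / 2" using approx[rule_format, of "\<lambda>k. Z k v"] op_boundD(3)[OF Z v(1)] by simp
  qed
  then have "finite_net p (d / 2 + d / 2) (\<lambda>v. ?S v + ?R v)"
    using S d by (intro finite_net_add[OF p _ _ _ R]) (auto simp: precompact_def)
  then show "finite_net p d (\<lambda>v. seqsum c (\<lambda>k. Z k v))" by simp
qed

section \<open>Shifts, Toeplitz operators and truncations\<close>

lemma op_bound_shift: "op_bound p 1 (shift k)"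
proof (rule op_boundI)
  fix v assume v: "v \<in> lp p"
  have "inj_on (\<lambda>i. nat (int i + k)) {i. 0 \<le> int i + k}" by (auto simp: inj_on_def)
  from lp_partial_reindex[OF p v this]
  show "shift k v \<in> lp p" and "lp_norm p (shift k v) \<le> 1 * lp_norm p v" by (auto simp: shift_def)
qed (auto simp: shift_def fun_eq_iff)

lemma op_bound_toeplitz: "a \<in> wiener \<Longrightarrow> op_bound p (l1_norm a) (toeplitz a)"
  using op_bound_seqsum[where Z=shift and c=a, OF _ op_bound_shift] by (simp add: wiener_iff toeplitz_eq_seqsum[abs_def])

text \<open>The unit ball is mapped into a disc in a line, and compactness of the disc supplies the
  net.\<close>

lemma precompact_coordinate: "precompact p (\<lambda>v i. if i = N then v N else 0)"
  unfolding precompact_def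
proof (intro allI impI)
  fix d :: real assume "0 < d"
  then have "\<exists>T. finite T \<and> T \<subseteq> cball (0 :: complex) 1 \<and> cball 0 1 \<subseteq> (\<Union>z\<in>T. ball z d)"
    by (rule seq_compact_imp_totally_bounded[OF compact_imp_seq_compact[OF compact_cball], rule_format])
  then obtain T where T: "finite T" "cball (0 :: complex) 1 \<subseteq> (\<Union>z\<in>T. ball z d)"
    by (elim exE conjE)
  let ?e = "\<lambda>i. if i = N then 1 else 0 :: complex"
  show "finite_net p d (\<lambda>v i. if i = N then v N else 0)"
    unfolding finite_net_def
  proof (intro exI[of _ "(\<lambda>z i. z * ?e i) ` T"] conjI ballI impI)
    show "(\<lambda>z i. z * ?e i) ` T \<subseteq> lp p" using lp_scale(1)[OF p] lp_unit[OF p] by blast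
    fix v assume v: "v \<in> lp p" "lp_norm p v \<le> 1"
    then have "v N \<in> cball 0 1" using norm_le_lp_norm[OF p v(1), of N] by simp
    with T(2) obtain z where z: "z \<in> T" "v N \<in> ball z d" by blast
    have "(\<lambda>i. if i = N then v N else 0) - (\<lambda>i. z * ?e i) = (\<lambda>i. (v N - z) * ?e i)"
      by (auto simp: fun_eq_iff)
    moreover have "lp_norm p (\<lambda>i. (v N - z) * ?e i) \<le> norm (v N - z) * 1"
      using lp_norm_scale_le[OF p conjunct1[OF lp_unit[OF p]], of "v N - z" N]
        mult_left_mono[OF conjunct2[OF lp_unit[OF p, of N]], of "norm (v N - z)"] by simp
    ultimately have "lp_norm p ((\<lambda>i. if i = N then v N else 0) - (\<lambda>i. z * ?e i)) \<le> d"
      using z(2) by (simp add: dist_norm norm_minus_commute)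
    with z(1) show "\<exists>w\<in>(\<lambda>z i. z * ?e i) ` T. lp_norm p ((\<lambda>i. if i = N then v N else 0) - w) \<le> d"
      by blast
  qed (use T in simp)
qed

lemma op_bound_restrict: "op_bound p 1 (\<lambda>v i. if i \<in> D then v i else 0)"
  by (rule op_boundI) (use lp_mono[OF p] in \<open>auto simp: fun_eq_iff\<close>)

lemma precompact_truncate: "precompact p (\<lambda>v i. if i < N then v i else 0)"
proof (induction N)
  case 0
  show ?case using precompact_zero[OF p] by (simp add: zero_fun_def)
next
  case (Suc N)
  have 1: "bounded_op p (\<lambda>v i. if i < N then v i else 0)"
    using op_boundD(1)[OF op_bound_restrict[of "{..<N}"]] by simp
  have 2: "bounded_op p (\<lambda>v i. if i = N then v N else 0)"
    by (rule bounded_op_cong[OF p op_boundD(1)[OF op_bound_restrict[of "{N}"]]]) auto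
  show ?case
    by (rule precompact_cong[OF p precompact_add[OF p 1 2 Suc precompact_coordinate]])
      (auto simp: fun_eq_iff)
qed

lemma precompact_shift_shift: "precompact p (\<lambda>v. shift (j + m) v - shift j (shift m v))"
  unfolding shift_shift
  using precompact_comp_right[OF p op_boundD(1)[OF op_bound_shift] _ precompact_truncate]
    op_boundD(1)[OF op_bound_restrict[of "{..<nat (- j)}"]] by simp

end

section \<open>Symbol values lie in the spectrum\<close>

context
  fixes p :: ennreal
  assumes p: "1 \<le> p"
begin

text \<open>
  With \<open>V\<close> the contraction \<open>z\<^sup>-\<^sup>1 \<cdot> shift 1\<close> and \<open>w = (\<Sum>m<L. V\<^sup>m u)\<close>, telescoping gives
  \<open>V w - w = V\<^sup>L u - u\<close>, of norm at most \<open>2 \<parallel>u\<parallel>\<close>. Either \<open>u = e\<^sub>M\<close> already gives a long enough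
  vector \<open>w\<close>, or applying the construction to this \<open>w\<close> does, since the result has an entry of
  modulus \<open>L\<close>. This treats all exponents \<open>p\<close> alike.
\<close>

lemma shift_approx_eigenvector:
  assumes z: "norm z = 1" and e: "0 < e"
  shows "\<exists>v M. v \<in> lp p \<and> lp_norm p v = 1 \<and> (\<forall>i. i < N \<or> M \<le> i \<longrightarrow> v i = 0) \<and> N \<le> M \<and>
    lp_norm p (shift 1 v - (\<lambda>i. z * v i)) \<le> e"
proof -
  have z0: "z \<noteq> 0" using z by auto
  define V where "V m v = (\<lambda>i. inverse z ^ m * shift (int m) v i)" for m and v :: "nat \<Rightarrow> complex"
  have V: "V m v \<in> lp p" "lp_norm p (V m v) \<le> lp_norm p v" if "v \<in> lp p" for m v
    using lp_scale[OF p op_boundD(3)[OF op_bound_shift[OF p] that], of "inverse z ^ m"]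
      op_boundD(4)[OF op_bound_shift[OF p] that, of "int m"] z
    by (auto simp: V_def norm_power norm_inverse)
  have Vi: "V m v i = inverse z ^ m * v (i + m)" for m v i
    by (simp add: V_def shift_def nat_add_distrib)
  define W where "W L v = (\<Sum>m<L. V m v)" for L v
  have Wi: "W L v i = (\<Sum>m<L. inverse z ^ m * v (i + m))" for L v i
    by (simp add: W_def sum_seq_apply Vi)
  have W: "W L v \<in> lp p" if "v \<in> lp p" for L v
    unfolding W_def by (rule lp_sum(1)[OF p]) (use V that in auto)
  have step: "shift 1 (W L v) - (\<lambda>i. z * W L v i) = (\<lambda>i. z * (V L v - v) i)" for L v
  proof
    fix i
    have "shift 1 (W L v) i = z * (\<Sum>m<L. V (Suc m) v i)"
      using z0 by (simp add: shift_def Wi Vi sum_distrib_left nat_add_distrib mult.assoc[symmetric])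
    moreover have "W L v i = (\<Sum>m<L. V m v i)" by (simp add: Wi Vi)
    moreover have "(\<Sum>m<L. V (Suc m) v i) - (\<Sum>m<L. V m v i) = V L v i - v i"
      using sum_lessThan_telescope[of "\<lambda>m. V m v i" L] by (simp add: sum_subtractf Vi)
    ultimately show "(shift 1 (W L v) - (\<lambda>i. z * W L v i)) i = z * (V L v - v) i"
      by (simp add: right_diff_distrib[symmetric])
  qed
  have step_norm: "lp_norm p (shift 1 (W L v) - (\<lambda>i. z * W L v i)) \<le> 2 * lp_norm p v"
    if v: "v \<in> lp p" for L v
    unfolding step lp_scale(2)[OF p lp_diff(1)[OF p V(1)[OF v] v]]
    using lp_diff(2)[OF p V(1)[OF v] v, of L] V(2)[OF v, of L] z by simp
  \<comment> \<open>If \<open>u2\<close> is too short, its norm is below 2 / e, so the defect of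
    \<open>u3\<close> is below 4 / e. The norm of \<open>u3\<close> is at least \<open>L\<close>,
    and L > 4 / e^2 makes the defect small relative to it.\<close>
  obtain L :: nat where L: "4 / e\<^sup>2 < L" using reals_Archimedean2 by blast
  have L0: "0 < L" using L e by (cases L) auto
  \<comment> \<open>Each application of \<open>W L\<close> extends the support downwards by fewer
    than \<open>L\<close> entries, so two of them stay above \<open>N\<close>.\<close>
  define M where "M = N + 2 * L"
  define u1 where "u1 = (\<lambda>i. if i = M then 1 else 0 :: complex)"
  define u2 where "u2 = W L u1"
  define u3 where "u3 = W L u2"
  have u1: "u1 \<in> lp p" "lp_norm p u1 \<le> 1" using lp_unit[OF p] by (auto simp: u1_def)
  have u2: "u2 \<in> lp p" and u3: "u3 \<in> lp p" using W u1(1) by (auto simp: u2_def u3_def)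
  have u2i: "u2 i = (if i \<le> M \<and> M < i + L then inverse z ^ (M - i) else 0)" for i
  proof -
    have "u2 i = (\<Sum>m<L. if m = M - i then (if i \<le> M then inverse z ^ m else 0) else 0)"
      unfolding u2_def Wi u1_def by (intro sum.cong) auto
    then show ?thesis by auto
  qed
  \<comment> \<open>At this entry all \<open>L\<close> summands have the same phase, so their moduli
    add up.\<close>
  have u3i: "u3 (M + 1 - L) = of_nat L * inverse z ^ (L - 1)"
  proof -
    have "u3 (M + 1 - L) = (\<Sum>m<L. inverse z ^ (L - 1))"
      unfolding u3_def Wi
    proof (rule sum.cong)
      fix m assume m: "m \<in> {..<L}"
      then have "u2 (M + 1 - L + m) = inverse z ^ (L - 1 - m)" by (simp add: u2i M_def)
      moreover have "m + (L - 1 - m) = L - 1" using m by simp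
      ultimately show "inverse z ^ m * u2 (M + 1 - L + m) = inverse z ^ (L - 1)"
        by (metis power_add)
    qed simp
    then show ?thesis by simp
  qed
  have s2: "u2 i = 0" if "i < N \<or> Suc M \<le> i" for i using that L0 by (auto simp: u2i M_def)
  have s3: "u3 i = 0" if "i < N \<or> Suc M \<le> i" for i
    unfolding u3_def Wi by (rule sum.neutral) (use that in \<open>auto simp: u2i M_def\<close>)
  have n3: "real L \<le> lp_norm p u3"
    using norm_le_lp_norm[OF p u3, of "M + 1 - L"] z
    unfolding u3i by (simp add: norm_mult norm_power norm_inverse)
  have u2_step: "lp_norm p (shift 1 u2 - (\<lambda>i. z * u2 i)) \<le> 2"
    using step_norm[OF u1(1), of L] u1(2) by (simp add: u2_def)
  have u3_step: "lp_norm p (shift 1 u3 - (\<lambda>i. z * u3 i)) \<le> 2 * lp_norm p u2"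
    using step_norm[OF u2, of L] by (simp add: u3_def)
  have "\<exists>v. v \<in> lp p \<and> 0 < lp_norm p v \<and> (\<forall>i. i < N \<or> Suc M \<le> i \<longrightarrow> v i = 0) \<and>
      lp_norm p (shift 1 v - (\<lambda>i. z * v i)) \<le> e * lp_norm p v"
  proof (cases "2 \<le> e * lp_norm p u2")
    case True
    have "lp_norm p u2 \<noteq> 0" using True by auto
    then have "0 < lp_norm p u2" using lp_norm_eq_0(1)[OF p u2] by simp
    with True u2 s2 u2_step show ?thesis by (intro exI[of _ u2]) auto
  next
    case False
    have "2 * lp_norm p u2 \<le> 4 / e" using False e by (simp add: field_simps)
    also have "\<dots> = e * (4 / e\<^sup>2)" using e by (simp add: power2_eq_square)
    also have "\<dots> \<le> e * lp_norm p u3" using L n3 e by (intro mult_left_mono) auto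
    finally have "lp_norm p (shift 1 u3 - (\<lambda>i. z * u3 i)) \<le> e * lp_norm p u3" using u3_step by simp
    moreover have "0 < lp_norm p u3" using n3 L0 by simp
    ultimately show ?thesis using u3 s3 by (intro exI[of _ u3]) auto
  qed
  then obtain v where v: "v \<in> lp p" "0 < lp_norm p v" "\<And>i. i < N \<or> Suc M \<le> i \<Longrightarrow> v i = 0"
      "lp_norm p (shift 1 v - (\<lambda>i. z * v i)) \<le> e * lp_norm p v" by blast
  define r where "r = complex_of_real (1 / lp_norm p v)"
  define w where "w = (\<lambda>i. r * v i)"
  have r: "norm r = 1 / lp_norm p v" using v(2) by (simp add: r_def norm_divide)
  have sv: "shift 1 v - (\<lambda>i. z * v i) \<in> lp p"
    by (rule lp_diff(1)[OF p op_boundD(3)[OF op_bound_shift[OF p] v(1)] lp_scale(1)[OF p v(1)]])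
  have "shift 1 w - (\<lambda>i. z * w i) = (\<lambda>i. r * (shift 1 v - (\<lambda>i. z * v i)) i)"
    by (auto simp: fun_eq_iff shift_def w_def algebra_simps)
  then have "lp_norm p (shift 1 w - (\<lambda>i. z * w i))
      = lp_norm p (shift 1 v - (\<lambda>i. z * v i)) / lp_norm p v"
    using lp_scale(2)[OF p sv, of r] r by simp
  then have "lp_norm p (shift 1 w - (\<lambda>i. z * w i)) \<le> e"
    using v(2,4) by (simp add: pos_divide_le_eq)
  moreover have "w \<in> lp p" "lp_norm p w = 1"
    using lp_scale[OF p v(1), of r] v(2) r by (simp_all add: w_def)
  moreover have "\<forall>i. i < N \<or> Suc M \<le> i \<longrightarrow> w i = 0" using v(3) by (simp add: w_def)
  moreover have "N \<le> Suc M" by (simp add: M_def)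
  ultimately show ?thesis by blast
qed

text \<open>For positive \<open>k\<close> the error accumulates step by step. For negative
  \<open>k\<close> the leading zeros of \<open>v\<close> ensure that \<open>shift k\<close> undoes
  \<open>shift (- k)\<close> on \<open>v\<close>, which reduces the claim to the positive
  case.\<close>

lemma shift_power_approx:
  assumes z: "norm z = 1" and v: "v \<in> lp p" and supp: "\<And>i. i < nat \<bar>k\<bar> \<Longrightarrow> v i = 0"
    and e: "lp_norm p (shift 1 v - (\<lambda>i. z * v i)) \<le> e"
  shows "lp_norm p (shift k v - (\<lambda>i. z powi k * v i)) \<le> \<bar>of_int k\<bar> * e"
proof -
  note sl = op_boundD(3)[OF op_bound_shift[OF p]] and sn = op_boundD(4)[OF op_bound_shift[OF p]]
  have z0: "z \<noteq> 0" using z by auto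
  have D: "shift j v - (\<lambda>i. c * v i) \<in> lp p" for j c
    by (rule lp_diff(1)[OF p sl[OF v] lp_scale(1)[OF p v]])
  have pos: "lp_norm p (shift (int n) v - (\<lambda>i. z ^ n * v i)) \<le> real n * e" for n
  proof (induction n)
    case 0
    have "shift (int 0) v - (\<lambda>i. z ^ 0 * v i) = 0" by (simp add: shift_def fun_eq_iff)
    then show ?case using lp_zero(2)[OF p] by (simp only: of_nat_0 mult_zero_left order_refl)
  next
    case (Suc n)
    let ?x = "shift (int n) (shift 1 v - (\<lambda>i. z * v i))"
      and ?y = "\<lambda>i. z * (shift (int n) v - (\<lambda>i. z ^ n * v i)) i"
    have eq: "shift (int (Suc n)) v - (\<lambda>i. z ^ Suc n * v i) = ?x + ?y"
    proof
      fix i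
      have "nat (1 + (int i + int n)) = Suc (i + n)" "nat (int i + int n) = i + n" by simp_all
      then show "(shift (int (Suc n)) v - (\<lambda>i. z ^ Suc n * v i)) i = (?x + ?y) i"
        by (simp add: shift_def algebra_simps)
    qed
    have "lp_norm p ?x \<le> e" using order_trans[OF sn[OF D] _] e by simp
    moreover have "lp_norm p ?y \<le> real n * e" unfolding lp_scale(2)[OF p D] using Suc z by (simp add: fun_diff_def)
    moreover have "lp_norm p (?x + ?y) \<le> lp_norm p ?x + lp_norm p ?y"
      by (rule lp_norm_triangle(2)[OF p sl[OF D] lp_scale(1)[OF p D]])
    ultimately have "lp_norm p (?x + ?y) \<le> e + real n * e" by linarith
    also have "\<dots> = real (Suc n) * e" by (simp add: distrib_right)
    finally show ?case unfolding eq .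
  qed
  show ?thesis
  proof (cases "0 \<le> k")
    case True
    then show ?thesis using pos[of "nat k"] by (simp add: power_int_def)
  next
    case False
    define n where "n = nat (- k)"
    have k: "k = - int n" using False by (simp add: n_def)
    let ?y = "shift (- int n) (shift (int n) v - (\<lambda>i. z ^ n * v i))"
    have "shift k v - (\<lambda>i. z powi k * v i) = (\<lambda>i. - inverse (z ^ n) * ?y i)"
    proof
      fix i
      show "(shift k v - (\<lambda>i. z powi k * v i)) i = - inverse (z ^ n) * ?y i"
      proof (cases "n \<le> i")
        case True
        then have "nat (int i - int n) = i - n" "i - n + n = i" by simp_all
        with True z0 show ?thesis
          by (simp add: k shift_def power_int_minus nat_add_distrib of_nat_diff field_simps)
      next
        case False
        with supp[of i] show ?thesis by (simp add: k shift_def)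
      qed
    qed
    then have "lp_norm p (shift k v - (\<lambda>i. z powi k * v i)) = lp_norm p ?y"
      using lp_scale(2)[OF p sl[OF D], of "- inverse (z ^ n)" "- int n" "int n" "z ^ n"] z
      by (simp add: norm_inverse norm_power)
    also have "\<dots> \<le> real n * e" using order_trans[OF sn[OF D]] pos by simp
    finally show ?thesis by (simp add: k)
  qed
qed

lemma toeplitz_approx_eigenvector:
  assumes a: "a \<in> wiener" and z: "norm z = 1" and e: "0 < e"
  shows "\<exists>v M. v \<in> lp p \<and> lp_norm p v = 1 \<and> (\<forall>i. i < N \<or> M \<le> i \<longrightarrow> v i = 0) \<and> N \<le> M \<and>
    lp_norm p (toeplitz a v - (\<lambda>i. laurent_eval a z * v i)) \<le> e"
proof -
  have a': "a abs_summable_on UNIV" using a by (simp add: wiener_iff)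
  \<comment> \<open>The bound 2 fits the family \<open>u\<close> below, whose members are
    differences of two vectors of norm at most 1.\<close>
  from seqsum_approx[OF p a', of 2 "e / 2"] e obtain F where F: "finite F"
    and approx: "\<forall>u. (\<forall>k. u k \<in> lp p \<and> lp_norm p (u k) \<le> 2) \<longrightarrow>
      seqsum a u - (\<Sum>k\<in>F. (\<lambda>j. a k * u k j)) \<in> lp p \<and>
      lp_norm p (seqsum a u - (\<Sum>k\<in>F. (\<lambda>j. a k * u k j))) \<le> e / 2"
    by auto
  define C where "C = (\<Sum>k\<in>F. norm (a k) * \<bar>real_of_int k\<bar>)"
  have C: "0 \<le> C" unfolding C_def by (intro sum_nonneg) auto
  define h where "h = e / 2 / (C + 1)"
  have h: "0 < h" "C * h \<le> e / 2" using C e by (auto simp: h_def field_simps)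
  \<comment> \<open>Provides enough leading zeros for every \<open>k\<close> in \<open>F\<close>, as
    \<open>shift_power_approx\<close> requires.\<close>
  define N' where "N' = N + (\<Sum>k\<in>F. nat \<bar>k\<bar>)"
  obtain v M where v: "v \<in> lp p" "lp_norm p v = 1" "\<And>i. i < N' \<or> M \<le> i \<Longrightarrow> v i = 0" "N' \<le> M"
      "lp_norm p (shift 1 v - (\<lambda>i. z * v i)) \<le> h"
    using shift_approx_eigenvector[OF z h(1), of N'] by blast
  define u where "u k = shift k v - (\<lambda>i. z powi k * v i)" for k
  have sh: "shift k v \<in> lp p" "lp_norm p (shift k v) \<le> 1" for k
    using op_boundD(3,4)[OF op_bound_shift[OF p] v(1), of k] v(2) by auto
  have sc: "(\<lambda>i. z powi k * v i) \<in> lp p" "lp_norm p (\<lambda>i. z powi k * v i) = 1" for k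
    using lp_scale[OF p v(1), of "z powi k"] v(2) z by (auto simp: norm_power_int)
  have u: "u k \<in> lp p" "lp_norm p (u k) \<le> 2" for k
    using lp_diff[OF p sh(1) sc(1), of k k] sh(2)[of k] sc(2)[of k] by (auto simp: u_def)
  have eq: "seqsum a u = toeplitz a v - (\<lambda>i. laurent_eval a z * v i)"
  proof
    fix j
    have 1: "(\<lambda>k. a k * u k j) summable_on UNIV"
      by (rule seqsum_summable[where u=u, OF p a' u])
    have 2: "(\<lambda>k. a k * (z powi k * v j)) summable_on UNIV"
      using seqsum_summable[where u="\<lambda>k i. z powi k * v i", OF p a' sc(1) eq_refl[OF sc(2)]] by simp
    have "(\<Sum>\<^sub>\<infinity>k. a k * shift k v j) = seqsum a u j + (\<Sum>\<^sub>\<infinity>k. a k * (z powi k * v j))"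
      using infsum_add[OF 1 2] by (simp add: seqsum_def u_def right_diff_distrib)
    also have "(\<Sum>\<^sub>\<infinity>k. a k * (z powi k * v j)) = laurent_eval a z * v j"
      unfolding laurent_eval_def infsum_cmult_left'[symmetric] by (simp add: mult.assoc)
    finally show "seqsum a u j = (toeplitz a v - (\<lambda>i. laurent_eval a z * v i)) j"
      by (simp add: toeplitz_eq_seqsum seqsum_def)
  qed
  let ?s = "\<Sum>k\<in>F. (\<lambda>j. a k * u k j)"
  have small: "lp_norm p (\<lambda>j. a k * u k j) \<le> norm (a k) * \<bar>real_of_int k\<bar> * h" if k: "k \<in> F" for k
  proof -
    have "nat \<bar>k\<bar> \<le> N'" unfolding N'_def using F k by (intro trans_le_add2 member_le_sum) auto
    then have "lp_norm p (u k) \<le> \<bar>real_of_int k\<bar> * h"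
      unfolding u_def using v(3) by (intro shift_power_approx[OF z v(1) _ v(5)]) auto
    then show ?thesis unfolding lp_scale(2)[OF p u(1)] by (simp add: mult.assoc mult_left_mono)
  qed
  have "lp_norm p ?s \<le> (\<Sum>k\<in>F. lp_norm p (\<lambda>j. a k * u k j))"
    by (rule lp_sum(2)[OF p F]) (rule lp_scale(1)[OF p u(1)])
  also have "\<dots> \<le> (\<Sum>k\<in>F. norm (a k) * \<bar>real_of_int k\<bar> * h)" by (rule sum_mono[OF small])
  also have "\<dots> = C * h" by (simp add: C_def sum_distrib_right)
  finally have s: "lp_norm p ?s \<le> e / 2" using h(2) by simp
  have sl: "?s \<in> lp p" by (rule lp_sum(1)[OF p F]) (rule lp_scale(1)[OF p u(1)])
  have r: "seqsum a u - ?s \<in> lp p" "lp_norm p (seqsum a u - ?s) \<le> e / 2"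
    using approx[rule_format, of u] u by auto
  have "lp_norm p (seqsum a u) \<le> e"
    using lp_norm_triangle(2)[OF p r(1) sl] r(2) s by simp
  then show ?thesis
    using v unfolding eq N'_def by (intro exI[of _ v] exI[of _ M]) auto
qed

text \<open>
  Compactness makes \<open>E\<close> nearly constant on infinitely many of the approximate eigenvectors, so it
  is nearly zero on the difference of two of them. Weak convergence to \<open>0\<close> would not be enough for
  \<open>p = 1\<close>.
\<close>

lemma laurent_eval_in_op_spectrum:
  assumes a: "a \<in> wiener" and E: "compact_op p E" and A: "op_eq p A (toeplitz a + E)"
    and z: "norm z = 1"
  shows "laurent_eval a z \<in> op_spectrum p A"
proof (rule ccontr)
  define l where "l = laurent_eval a z"
  assume "laurent_eval a z \<notin> op_spectrum p A"
  then obtain R where R: "bounded_op p R" "op_eq p (R \<circ> (A - scalar_op l)) id"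
    by (auto simp: op_spectrum_def invertible_op_def l_def)
  obtain K where K: "op_bound p K R" using R(1) by (auto simp: bounded_op_iff[OF p])
  have Ebd: "bounded_op p E" using E by (simp add: compact_op_def)
  have T: "op_bound p (l1_norm a) (toeplitz a)" by (rule op_bound_toeplitz[OF p a])
  \<comment> \<open>The difference of two unit vectors collects two errors from the Toeplitz part
    and two from \<open>E\<close>; together they must stay below 1 after multiplication by
    \<open>K\<close>.\<close>
  define e where "e = 1 / (4 * K + 4)"
  have K0: "0 \<le> K" by (rule op_boundD(2)[OF K])
  have e: "0 < e" "K * (4 * e) < 1" using K0 by (auto simp: e_def field_simps)
  define B where "B = (\<lambda>v. toeplitz a v - (\<lambda>i. l * v i))"
  have Bbd: "bounded_op p B"
    unfolding B_def
    using bounded_op_minus[OF p op_boundD(1)[OF T] op_boundD(1)[OF op_bound_scale[OF p]]] .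
  have Av: "(A - scalar_op l) v = B v + E v" if "v \<in> lp p" for v
    using A that by (simp add: op_eq_def B_def scalar_op_def fun_eq_iff)
  have "\<forall>N. \<exists>x. fst x \<in> lp p \<and> lp_norm p (fst x) = 1 \<and>
      (\<forall>i. i < N \<or> snd x \<le> i \<longrightarrow> fst x i = 0) \<and> N \<le> snd x \<and> lp_norm p (B (fst x)) \<le> e"
    using toeplitz_approx_eigenvector[OF a z e(1)] unfolding B_def l_def by (metis fst_conv snd_conv)
  from choice[OF this] obtain x where x: "\<And>N. fst (x N) \<in> lp p" "\<And>N. lp_norm p (fst (x N)) = 1"
      "\<And>N i. i < N \<or> snd (x N) \<le> i \<Longrightarrow> fst (x N) i = 0" "\<And>N. N \<le> snd (x N)"
      "\<And>N. lp_norm p (B (fst (x N))) \<le> e" by blast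
  \<comment> \<open>Each block starts where the preceding one ends, which makes the supports
    disjoint.\<close>
  define n where "n k = ((\<lambda>N. snd (x N)) ^^ k) 0" for k
  define f where "f k = fst (x (n k))" for k
  have n_Suc: "n (Suc k) = snd (x (n k))" for k by (simp add: n_def)
  have n_mono: "n k \<le> n m" if "k \<le> m" for k m
    by (rule lift_Suc_mono_le[of n, OF _ that]) (simp add: n_Suc x(4))
  have f: "f k \<in> lp p" "lp_norm p (f k) = 1" "lp_norm p (B (f k)) \<le> e" for k
    using x by (auto simp: f_def)
  have "finite_net p e E" using compact_op_imp_precompact[OF p E] e(1) by (simp add: precompact_def)
  then obtain G where G: "finite G" "G \<subseteq> lp p"
      "\<And>v. v \<in> lp p \<Longrightarrow> lp_norm p v \<le> 1 \<Longrightarrow> \<exists>w\<in>G. lp_norm p (E v - w) \<le> e"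
    by (auto simp: finite_net_def)
  have "\<forall>k. \<exists>w. w \<in> G \<and> lp_norm p (E (f k) - w) \<le> e" using G(3) f by fastforce
  from choice[OF this] obtain g where g: "\<And>k. g k \<in> G" "\<And>k. lp_norm p (E (f k) - g k) \<le> e" by blast
  have "\<not> inj g"
    using finite_imageD[of g UNIV] finite_subset[of "range g" G] G(1) g(1) by auto
  then obtain k m where km: "k < m" "g k = g m"
    unfolding inj_def by (metis linorder_neqE_nat)
  define u where "u = f k - f m"
  have u: "u \<in> lp p" unfolding u_def by (rule lp_diff(1)[OF p f(1) f(1)])
  have "norm (f k i) \<le> norm (u i)" for i
  proof (cases "i < n (Suc k)")
    case True
    then have "i < n m" using n_mono[of "Suc k" m] km(1) by simp
    then have "f m i = 0" using x(3) by (simp add: f_def)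
    then show ?thesis by (simp add: u_def)
  next
    case False
    then have "f k i = 0" using x(3) by (simp add: f_def n_Suc)
    then show ?thesis by simp
  qed
  from lp_mono(2)[OF p u this] have "1 \<le> lp_norm p u" using f(2) by simp
  also have "R ((A - scalar_op l) u) = u" using R(2) u by (simp add: op_eq_def)
  then have "u = R (B u + E u)" unfolding Av[OF u] by simp
  also have "lp_norm p (R (B u + E u)) \<le> K * lp_norm p (B u + E u)"
    by (rule op_boundD(4)[OF K lp_norm_triangle(1)[OF p bounded_op_lp[OF Bbd u] bounded_op_lp[OF Ebd u]]])
  also have "\<dots> \<le> K * (4 * e)"
  proof (rule mult_left_mono[OF _ K0])
    have "lp_norm p (B u) \<le> 2 * e"
      unfolding u_def bounded_op_diff[OF p Bbd f(1) f(1)]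
      using lp_diff(2)[OF p bounded_op_lp[OF Bbd f(1)] bounded_op_lp[OF Bbd f(1)], of k m]
        f(3)[of k] f(3)[of m] by simp
    moreover have "lp_norm p (E u) \<le> 2 * e"
    proof -
      have d: "E (f j) - g j \<in> lp p" for j
        using lp_diff(1)[OF p bounded_op_lp[OF Ebd f(1)]] g(1) G(2) by blast
      have "E u = (E (f k) - g k) - (E (f m) - g m)"
        unfolding u_def bounded_op_diff[OF p Ebd f(1) f(1)] by (simp add: km(2))
      then show ?thesis using lp_diff(2)[OF p d d, of k m] g(2)[of k] g(2)[of m] by simp
    qed
    ultimately show "lp_norm p (B u + E u) \<le> 4 * e"
      using lp_norm_triangle(2)[OF p bounded_op_lp[OF Bbd u] bounded_op_lp[OF Ebd u]] by simp
  qed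
  finally show False using e(2) by simp
qed

end

section \<open>The Sylvester equation modulo compact operators\<close>

lemma toeplitz_uminus: "toeplitz (\<lambda>k. - a k) v = - toeplitz a v"
  by (simp add: toeplitz_def fun_eq_iff infsum_uminus)

lemma laurent_eval_uminus: "laurent_eval (\<lambda>k. - a k) z = - laurent_eval a z"
  by (simp add: laurent_eval_def infsum_uminus)

context
  fixes p :: ennreal
  assumes p: "1 \<le> p"
begin

lemma seqsum_add_coeff:
  assumes c: "c abs_summable_on UNIV" and d: "d abs_summable_on UNIV"
    and u: "\<And>k. u k \<in> lp p" "\<And>k. lp_norm p (u k) \<le> K"
  shows "seqsum (\<lambda>k. c k + d k) u = seqsum c u + seqsum d u"
proof
  fix j
  show "seqsum (\<lambda>k. c k + d k) u j = (seqsum c u + seqsum d u) j"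
    using infsum_add[OF seqsum_summable[where u=u and j=j, OF p c u] seqsum_summable[where u=u and j=j, OF p d u]]
    by (simp add: seqsum_def distrib_right)
qed

lemma seqsum_diff:
  assumes c: "c abs_summable_on UNIV" and u: "\<And>k. u k \<in> lp p" "\<And>k. lp_norm p (u k) \<le> K"
    and w: "\<And>k. w k \<in> lp p" "\<And>k. lp_norm p (w k) \<le> L"
  shows "seqsum c (\<lambda>k. u k - w k) = seqsum c u - seqsum c w"
proof -
  have uw: "u k - w k \<in> lp p" "lp_norm p (u k - w k) \<le> K + L" for k
    using lp_diff[OF p u(1) w(1), of k k] u(2)[of k] w(2)[of k] by auto
  show ?thesis
    using seqsum_add[where u="\<lambda>k. u k - w k" and w=w, OF p c uw w] by simp
qed

lemma op_bound_diff:
  assumes A: "op_bound p K A" and B: "op_bound p L B"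
  shows "op_bound p (K + L) (\<lambda>v. A v - B v)"
  using op_bound_add[OF p A op_bound_comp[OF p op_bound_scale[OF p, of "-1"] B]]
  by (simp add: fun_minus_scale)

lemma precompact_shift_shift_shift:
  "precompact p (\<lambda>v. shift (i + (m + j)) v - shift i (shift m (shift j v)))"
proof -
  note sh = op_boundD(1)[OF op_bound_shift[OF p]]
  note comp = bounded_op_comp[OF p]
  have D: "bounded_op p (\<lambda>v. shift (i + j) v - shift i (shift j v))" for i j
    by (rule bounded_op_minus[OF p sh comp[OF sh sh]])
  have "precompact p (\<lambda>v. (shift (i + (m + j)) v - shift i (shift (m + j) v))
      + shift i (shift (m + j) v - shift m (shift j v)))"
    by (rule precompact_add[OF p D comp[OF sh D] precompact_shift_shift[OF p]
          precompact_comp_left[OF p sh D precompact_shift_shift[OF p]]])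
  then show ?thesis
  proof (rule precompact_cong[OF p])
    fix v assume v: "v \<in> lp p"
    show "shift (i + (m + j)) v - shift i (shift m (shift j v))
      = (shift (i + (m + j)) v - shift i (shift (m + j) v))
        + shift i (shift (m + j) v - shift m (shift j v))"
      using bounded_op_diff[OF p sh bounded_op_lp[OF sh v] bounded_op_lp[OF comp[OF sh sh] v],
          of i "m + j" m j] by simp
  qed
qed

text \<open>\<open>X\<close> separates the left shifts from the right ones, so the two defects are
  treated one at a time by inserting a mixed term.\<close>

lemma precompact_shift_sandwich:
  assumes X: "bounded_op p X"
  shows "precompact p (\<lambda>v. shift (i + i') (X (shift (j + j') v)) - shift i (shift i' (X (shift j (shift j' v)))))"
proof -
  note sh = op_boundD(1)[OF op_bound_shift[OF p]]
  note comp = bounded_op_comp[OF p]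
  have D: "bounded_op p (\<lambda>v. shift (i + j) v - shift i (shift j v))" for i j
    by (rule bounded_op_minus[OF p sh comp[OF sh sh]])
  have Y: "bounded_op p (\<lambda>v. shift i (shift i' (X v)))" by (rule comp[OF sh comp[OF sh X]])
  let ?P = "\<lambda>v. shift (i + i') (X (shift (j + j') v)) - shift i (shift i' (X (shift (j + j') v)))"
  let ?Q = "\<lambda>v. shift i (shift i' (X (shift (j + j') v - shift j (shift j' v))))"
  have P: "bounded_op p ?P"
    by (rule bounded_op_minus[OF p comp[OF sh comp[OF X sh]] comp[OF sh comp[OF sh comp[OF X sh]]]])
  have Q: "bounded_op p ?Q" by (rule comp[OF Y D])
  have "precompact p ?P"
    by (rule precompact_comp_right[OF p comp[OF X sh] D precompact_shift_shift[OF p]])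
  moreover have "precompact p ?Q"
    by (rule precompact_comp_left[OF p Y D precompact_shift_shift[OF p]])
  ultimately have "precompact p (\<lambda>v. ?P v + ?Q v)" by (rule precompact_add[OF p P Q])
  then show ?thesis
  proof (rule precompact_cong[OF p])
    fix v assume v: "v \<in> lp p"
    have "?Q v = shift i (shift i' (X (shift (j + j') v))) - shift i (shift i' (X (shift j (shift j' v))))"
      using bounded_op_diff[OF p Y bounded_op_lp[OF sh v] bounded_op_lp[OF comp[OF sh sh] v]] .
    then show "shift (i + i') (X (shift (j + j') v)) - shift i (shift i' (X (shift j (shift j' v)))) = ?P v + ?Q v"
      by simp
  qed
qed

text \<open>
  Modulo compact operators, \<open>k \<mapsto> shift k\<close> is a representation of \<open>\<int>\<close> by contractions, so every
  absolutely summable family \<open>g\<close> over \<open>\<int> \<times> \<int>\<close> acts on operators by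
  \<open>Z \<mapsto> \<Sum>k. g k \<cdot> shift (fst k) \<circ> Z \<circ> shift (snd k)\<close>, and convolution corresponds to composition.
  The Sylvester operator \<open>Z \<mapsto> T(a) Z + Z T(b)\<close> is the action of \<open>a(z) + b(w)\<close>, hence it is
  inverted by the action of \<open>g(z, w) = 1 / (a(z) + b(w))\<close>.
\<close>

lemma precompact_sylvester_solution:
  assumes a: "a \<in> wiener" and b: "b \<in> wiener" and c: "c \<in> wiener" and X: "bounded_op p X"
    and L: "precompact p (\<lambda>v. toeplitz a (X v) + X (toeplitz b v) + toeplitz c v)"
    and g: "g abs_summable_on UNIV"
    and inv: "push (\<lambda>(k, m). k + m)
      (\<lambda>(k, m). g k * (push (\<lambda>k. (k, 0)) a m + push (\<lambda>l. (0, l)) b m)) = (\<lambda>k. if k = 0 then 1 else 0)"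
  shows "precompact p (\<lambda>v. X v -
    toeplitz (\<lambda>n. - push (\<lambda>(k, m). fst k + snd k + m) (\<lambda>(k, m). g k * c m) n) v)"
proof -
  \<comment> \<open>The coefficients of a(z) + b(w): \<open>a\<close> on one axis of the lattice,
    \<open>b\<close> on the other.\<close>
  define e where "e = (\<lambda>m. push (\<lambda>k. (k, 0 :: int)) a m + push (\<lambda>l. (0 :: int, l)) b m)"
  define y where "y = push (\<lambda>(k, m). fst k + snd k + m) (\<lambda>(k, m). g k * c m)"
  note a' = a[unfolded wiener_iff] and b' = b[unfolded wiener_iff] and c' = c[unfolded wiener_iff]
  have e: "e abs_summable_on UNIV"
    unfolding e_def by (intro abs_summable_add(1) abs_summable_push(1) a' b')
  note ge = abs_summable_tensor(1)[OF g e] and gc = abs_summable_tensor(1)[OF g c']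
  obtain K where K: "op_bound p K X" using X by (auto simp: bounded_op_iff[OF p])
  note sh = op_bound_shift[OF p]
  have S1: "op_bound p K (\<lambda>v. shift i (X (shift j v)))" for i j
    using op_bound_comp[OF p sh op_bound_comp[OF p K sh]] by simp
  have S2: "op_bound p K (\<lambda>v. shift i (shift i' (X (shift j (shift j' v)))))" for i i' j j'
    using op_bound_comp[OF p sh op_bound_comp[OF p S1 sh]] by simp
  have S3: "op_bound p 1 (\<lambda>v. shift i (shift i' (shift j v)))" for i i' j
    using op_bound_comp[OF p sh op_bound_comp[OF p sh sh]] by simp
  define F where "F = (\<lambda>v. toeplitz a (X v) + X (toeplitz b v) + toeplitz c v)"
  note ta = op_bound_toeplitz[OF p a] and tb = op_bound_toeplitz[OF p b] and tc = op_bound_toeplitz[OF p c]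
  obtain M where M: "op_bound p M F"
    using op_bound_add[OF p op_bound_add[OF p op_bound_comp[OF p ta K] op_bound_comp[OF p K tb]] tc]
    unfolding F_def by blast
  have sylv: "toeplitz a (X v) + X (toeplitz b v)
      = seqsum e (\<lambda>m. shift (fst m) (X (shift (snd m) v)))" if v: "v \<in> lp p" for v
  proof -
    let ?u = "\<lambda>m. shift (fst m) (X (shift (snd m) v))"
    have u: "?u m \<in> lp p" "lp_norm p (?u m) \<le> K * lp_norm p v" for m
      using op_boundD(3,4)[OF S1 v] by auto
    have "toeplitz a (X v) = seqsum (push (\<lambda>k. (k, 0)) a) ?u"
      using seqsum_push[where u="?u" and \<phi>="\<lambda>k. (k, 0)", OF p a' u]
      by (simp add: toeplitz_eq_seqsum shift_zero)
    moreover have "X (toeplitz b v) = seqsum (push (\<lambda>l. (0, l)) b) ?u"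
      using seqsum_push[where u="?u" and \<phi>="\<lambda>l. (0, l)", OF p b' u]
        bounded_op_seqsum[where u="\<lambda>k. shift k v", OF p X b' op_boundD(3)[OF sh v] op_boundD(4)[OF sh v]]
      by (simp add: toeplitz_eq_seqsum shift_zero)
    ultimately show ?thesis
      unfolding e_def
      using seqsum_add_coeff[where u="?u", OF abs_summable_push(1)[OF a'] abs_summable_push(1)[OF b'] u]
      by simp
  qed
  \<comment> \<open>The action of \<open>g\<close> on the residual \<open>F\<close>, with all shifts
    left as compositions. As \<open>F\<close> is precompact, so is the left side.\<close>
  have Phi: "seqsum g (\<lambda>k. shift (fst k) (F (shift (snd k) v)))
    = seqsum (\<lambda>(k, m). g k * e m)
        (\<lambda>(k, m). shift (fst k) (shift (fst m) (X (shift (snd m) (shift (snd k) v)))))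
      + seqsum (\<lambda>(k, m). g k * c m) (\<lambda>(k, m). shift (fst k) (shift m (shift (snd k) v)))"
    if v: "v \<in> lp p" for v
  proof -
    let ?P = "\<lambda>k m. shift (fst k) (shift (fst m) (X (shift (snd m) (shift (snd k) v))))"
    let ?Q = "\<lambda>k m. shift (fst k) (shift m (shift (snd k) v))"
    have P: "?P k m \<in> lp p" "lp_norm p (?P k m) \<le> K * lp_norm p v" for k m
      using op_boundD(3,4)[OF S2 v] by auto
    have Q: "?Q k m \<in> lp p" "lp_norm p (?Q k m) \<le> 1 * lp_norm p v" for k m
      using op_boundD(3,4)[OF S3 v] by auto
    have "shift (fst k) (F (shift (snd k) v)) = seqsum e (?P k) + seqsum c (?Q k)" for k
    proof -
      let ?v = "shift (snd k) v"
      have v': "?v \<in> lp p" by (rule op_boundD(3)[OF sh v])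
      let ?p = "\<lambda>m. shift (fst m) (X (shift (snd m) ?v))" and ?q = "\<lambda>m. shift m ?v"
      note p' = op_boundD(3,4)[OF S1 v'] and q' = op_boundD(3,4)[OF sh v']
      have "F ?v = seqsum e ?p + seqsum c ?q"
        unfolding F_def sylv[OF v'] by (simp add: toeplitz_eq_seqsum)
      then have "shift (fst k) (F ?v) = shift (fst k) (seqsum e ?p) + shift (fst k) (seqsum c ?q)"
        using bounded_op_add[OF op_boundD(1)[OF sh] seqsum_lp(1)[where u="?p", OF p e p']
            seqsum_lp(1)[where u="?q", OF p c' q']] by simp
      then show ?thesis
        using bounded_op_seqsum[where u="?p", OF p op_boundD(1)[OF sh] e p']
          bounded_op_seqsum[where u="?q", OF p op_boundD(1)[OF sh] c' q'] by simp
    qed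
    then have "seqsum g (\<lambda>k. shift (fst k) (F (shift (snd k) v)))
        = seqsum g (\<lambda>k. seqsum e (?P k) + seqsum c (?Q k))" by simp
    also have "\<dots> = seqsum g (\<lambda>k. seqsum e (?P k)) + seqsum g (\<lambda>k. seqsum c (?Q k))"
      using seqsum_add[where u="\<lambda>k. seqsum e (?P k)" and w="\<lambda>k. seqsum c (?Q k)", OF p g
          seqsum_lp[where u="?P k" for k, OF p e P] seqsum_lp[where u="?Q k" for k, OF p c' Q]] .
    also have "\<dots> = seqsum (\<lambda>(k, m). g k * e m) (\<lambda>(k, m). ?P k m)
        + seqsum (\<lambda>(k, m). g k * c m) (\<lambda>(k, m). ?Q k m)"
      using seqsum_tensor[where u="?P", OF p g e P] seqsum_tensor[where u="?Q", OF p g c' Q] by simp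
    finally show ?thesis .
  qed
  \<comment> \<open>With shifts merged, the double sum is the action of the convolution of
    \<open>g\<close> and \<open>e\<close>, the unit family. This identity is exact; compact terms
    arise only from splitting the shifts.\<close>
  have inv': "X v = seqsum (\<lambda>(k, m). g k * e m)
      (\<lambda>(k, m). shift (fst k + fst m) (X (shift (snd m + snd k) v)))" if v: "v \<in> lp p" for v
  proof -
    let ?u = "\<lambda>m. shift (fst m) (X (shift (snd m) v))"
    note u = op_boundD(3,4)[OF S1 v]
    have "seqsum (\<lambda>(k, m). g k * e m) (\<lambda>x. ?u (case x of (k, m) \<Rightarrow> k + m))
        = seqsum (\<lambda>k. if k = 0 then 1 else 0) ?u"
      using seqsum_push[where u="?u" and \<phi>="\<lambda>(k, m). k + m", OF p ge u] inv by (simp add: e_def)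
    also have "\<dots> = X v"
    proof
      fix j
      have "seqsum (\<lambda>k. if k = 0 then 1 else 0) ?u j = (\<Sum>\<^sub>\<infinity>k\<in>{0}. ?u k j)"
        unfolding seqsum_def by (rule infsum_cong_neutral) auto
      then show "seqsum (\<lambda>k. if k = 0 then 1 else 0) ?u j = X v j" by (simp add: shift_zero)
    qed
    finally show ?thesis by (simp add: case_prod_unfold add.commute)
  qed
  have y: "toeplitz y v = seqsum (\<lambda>(k, m). g k * c m) (\<lambda>(k, m). shift (fst k + (m + snd k)) v)"
    if v: "v \<in> lp p" for v
    using seqsum_push[where u="\<lambda>k. shift k v" and \<phi>="\<lambda>(k, m). fst k + snd k + m",
        OF p gc op_boundD(3,4)[OF sh v]]
    by (simp add: y_def toeplitz_eq_seqsum case_prod_unfold algebra_simps)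
  \<comment> \<open>The defects between merged and composed shifts, bounded uniformly in the index
    as \<open>precompact_seqsum\<close> requires.\<close>
  let ?D1 = "\<lambda>x v. shift (fst (fst x) + fst (snd x)) (X (shift (snd (snd x) + snd (fst x)) v))
    - shift (fst (fst x)) (shift (fst (snd x)) (X (shift (snd (snd x)) (shift (snd (fst x)) v))))"
  let ?D2 = "\<lambda>x v. shift (fst (fst x) + (snd x + snd (fst x))) v
    - shift (fst (fst x)) (shift (snd x) (shift (snd (fst x)) v))"
  have D1: "op_bound p (K + K) (?D1 x)" for x by (rule op_bound_diff[OF S1 S2])
  have D2: "op_bound p (1 + 1) (?D2 x)" for x by (rule op_bound_diff[OF sh S3])
  have SF: "op_bound p M (\<lambda>v. shift (fst k) (F (shift (snd k) v)))" for k :: "int \<times> int"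
    using op_bound_comp[OF p sh op_bound_comp[OF p M sh]] by simp
  have pcF: "precompact p (\<lambda>v. shift (fst k) (F (shift (snd k) v)))" for k :: "int \<times> int"
  proof -
    have "precompact p (\<lambda>v. F (shift (snd k) v))"
      by (rule precompact_comp_right[OF p op_boundD(1)[OF sh] op_boundD(1)[OF M]])
        (use L in \<open>simp add: F_def\<close>)
    then show ?thesis
      by (rule precompact_comp_left[OF p op_boundD(1)[OF sh] op_boundD(1)[OF op_bound_comp[OF p M sh]]])
  qed
  \<comment> \<open>The residual under the action of \<open>g\<close>, plus the defects that replace
    composed shifts by merged ones; the total is X + T(y).\<close>
  let ?R = "\<lambda>v. seqsum g (\<lambda>k. shift (fst k) (F (shift (snd k) v)))
    + (seqsum (\<lambda>(k, m). g k * e m) (\<lambda>x. ?D1 x v) + seqsum (\<lambda>(k, m). g k * c m) (\<lambda>x. ?D2 x v))"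
  have b0: "bounded_op p (\<lambda>v. seqsum g (\<lambda>k. shift (fst k) (F (shift (snd k) v))))"
    by (rule op_boundD(1)[OF op_bound_seqsum[OF p g SF]])
  have b1: "bounded_op p (\<lambda>v. seqsum (\<lambda>(k, m). g k * e m) (\<lambda>x. ?D1 x v))"
    by (rule op_boundD(1)[OF op_bound_seqsum[OF p ge D1]])
  have b2: "bounded_op p (\<lambda>v. seqsum (\<lambda>(k, m). g k * c m) (\<lambda>x. ?D2 x v))"
    by (rule op_boundD(1)[OF op_bound_seqsum[OF p gc D2]])
  have "precompact p ?R"
    by (intro precompact_add[OF p b0 bounded_op_plus[OF p b1 b2]] precompact_add[OF p b1 b2]
        precompact_seqsum[OF p g SF pcF] precompact_seqsum[OF p ge D1 precompact_shift_sandwich[OF X]]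
        precompact_seqsum[OF p gc D2 precompact_shift_shift_shift])
  then show ?thesis
  proof (rule precompact_cong[OF p])
    fix v assume v: "v \<in> lp p"
    have "seqsum (\<lambda>(k, m). g k * e m) (\<lambda>x. ?D1 x v) = X v - seqsum (\<lambda>(k, m). g k * e m)
        (\<lambda>(k, m). shift (fst k) (shift (fst m) (X (shift (snd m) (shift (snd k) v)))))"
      unfolding inv'[OF v] case_prod_unfold
      by (rule seqsum_diff[OF ge[unfolded case_prod_unfold] op_boundD(3,4)[OF S1 v] op_boundD(3,4)[OF S2 v]])
    moreover have "seqsum (\<lambda>(k, m). g k * c m) (\<lambda>x. ?D2 x v) = toeplitz y v -
        seqsum (\<lambda>(k, m). g k * c m) (\<lambda>(k, m). shift (fst k) (shift m (shift (snd k) v)))"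
      unfolding y[OF v] case_prod_unfold
      by (rule seqsum_diff[OF gc[unfolded case_prod_unfold] op_boundD(3,4)[OF sh v] op_boundD(3,4)[OF S3 v]])
    ultimately have "X v + toeplitz y v = ?R v" using Phi[OF v] by simp
    then show "X v - toeplitz (\<lambda>n. - push (\<lambda>(k, m). fst k + snd k + m) (\<lambda>(k, m). g k * c m) n) v = ?R v"
      unfolding toeplitz_uminus y_def[symmetric] by simp
  qed
qed

end

section \<open>Symbols on the torus and on its diagonal\<close>

lemma wiener_rep_laurent:
  assumes "a \<in> wiener" and "b \<in> wiener"
  shows "wiener_rep (\<lambda>m. push (\<lambda>k. (k, 0)) a m + push (\<lambda>l. (0, l)) b m)
    (\<lambda>t. laurent_eval a (fst t) + laurent_eval b (snd t))"
proof (rule wiener_rep_add)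
  note a = assms[unfolded wiener_iff]
  have "(\<Sum>\<^sub>\<infinity>k. push (\<lambda>k. (k, 0)) a k * character k t) = laurent_eval a (fst t)"
    and "(\<Sum>\<^sub>\<infinity>k. push (\<lambda>l. (0, l)) b k * character k t) = laurent_eval b (snd t)"
    if t: "t \<in> torus" for t
  proof -
    have ch: "norm (character k t) \<le> 1" for k using norm_character[OF t] by simp
    show "(\<Sum>\<^sub>\<infinity>k. push (\<lambda>k. (k, 0)) a k * character k t) = laurent_eval a (fst t)"
      unfolding infsum_push[where u="\<lambda>k. character k t", OF a(1) ch]
      by (simp add: laurent_eval_def character_def)
    show "(\<Sum>\<^sub>\<infinity>k. push (\<lambda>l. (0, l)) b k * character k t) = laurent_eval b (snd t)"
      unfolding infsum_push[where u="\<lambda>k. character k t", OF a(2) ch]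
      by (simp add: laurent_eval_def character_def)
  qed
  then show "wiener_rep (push (\<lambda>k. (k, 0)) a) (\<lambda>t. laurent_eval a (fst t))"
    and "wiener_rep (push (\<lambda>l. (0, l)) b) (\<lambda>t. laurent_eval b (snd t))"
    using abs_summable_push(1) a by (auto simp: wiener_rep_def)
qed

text \<open>Collecting terms of equal total degree sets w = z in g(z, w), which is how a
  two-variable inverse yields a symbol in one variable.\<close>

lemma laurent_eval_push_diagonal:
  assumes g: "wiener_rep g G" and c: "c \<in> wiener" and z: "norm z = 1"
  shows "laurent_eval (push (\<lambda>(k, m). fst k + snd k + m) (\<lambda>(k, m). g k * c m)) z
    = G (z, z) * laurent_eval c z"
proof -
  note c' = c[unfolded wiener_iff] and g' = wiener_repD(1)[OF g]
  have z0: "z \<noteq> 0" using z by auto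
  have t: "(z, z) \<in> torus" using z by (simp add: torus_def)
  have pz: "norm (z powi k) \<le> 1" for k using z by (simp add: norm_power_int)
  have "laurent_eval (push (\<lambda>(k, m). fst k + snd k + m) (\<lambda>(k, m). g k * c m)) z
      = (\<Sum>\<^sub>\<infinity>(k, m). g k * c m * (character k (z, z) * z powi m))"
    unfolding laurent_eval_def infsum_push[where u="\<lambda>k. z powi k", OF abs_summable_tensor(1)[OF g' c'] pz]
    using z0 by (simp add: case_prod_unfold character_def power_int_add)
  also have "\<dots> = (\<Sum>\<^sub>\<infinity>k. g k * (\<Sum>\<^sub>\<infinity>m. c m * (character k (z, z) * z powi m)))"
    by (rule infsum_tensor[where B=1, OF g' c'])
      (use z in \<open>simp add: norm_mult norm_character[OF t] norm_power_int\<close>)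
  also have "\<dots> = (\<Sum>\<^sub>\<infinity>k. g k * character k (z, z)) * laurent_eval c z"
    unfolding laurent_eval_def infsum_cmult_left'[symmetric]
    by (simp add: infsum_cmult_right'[symmetric] mult_ac)
  finally show ?thesis using wiener_repD(2)[OF g t] by simp
qed

theorem lemma2p12:
  fixes p :: ennreal
    and a b c :: "int \<Rightarrow> complex"
    and A B C E\<^sub>a E\<^sub>b E\<^sub>c X :: seq_op
  assumes "1 \<le> p"
    and "A \<in> quasi_toeplitz p" and "B \<in> quasi_toeplitz p" and "C \<in> quasi_toeplitz p"
    and "a \<in> wiener" and "b \<in> wiener" and "c \<in> wiener"
    and "compact_op p E\<^sub>a" and "compact_op p E\<^sub>b" and "compact_op p E\<^sub>c"
    and "op_eq p A (toeplitz a + E\<^sub>a)"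
    and "op_eq p B (toeplitz b + E\<^sub>b)"
    and "op_eq p C (toeplitz c + E\<^sub>c)"
    and "op_spectrum p A \<inter> op_spectrum p (- B) = {}"
    and "bounded_op p X"
    and "op_eq p ((A \<circ> X) + (X \<circ> B) + C) 0"
  shows "(\<forall>z. norm z = 1 \<longrightarrow> laurent_eval a z + laurent_eval b z \<noteq> 0) \<and>
    (\<exists>x\<in>wiener.
       (\<forall>z. norm z = 1 \<longrightarrow>
          laurent_eval x z = - laurent_eval c z * inverse (laurent_eval a z + laurent_eval b z)) \<and>
       (\<exists>E\<^sub>x. compact_op p E\<^sub>x \<and>
          op_eq p X (toeplitz x + E\<^sub>x) \<and>
          (let C' = C + (A \<circ> toeplitz x) + (toeplitz x \<circ> B)
           in op_eq p ((A \<circ> E\<^sub>x) + (E\<^sub>x \<circ> B) + C') 0)))"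
proof -
  note p = assms(1) and a = assms(5) and b = assms(6) and c = assms(7) and X = assms(15)
  have Ab: "bounded_op p A" using assms(2) by (simp add: quasi_toeplitz_def)
  have Bb: "bounded_op p B" using assms(3) by (simp add: quasi_toeplitz_def)
  have E: "bounded_op p E \<and> precompact p E" if "compact_op p E" for E
    using that compact_op_imp_precompact[OF p] by (simp add: compact_op_def)
  note Ea = E[OF assms(8)] and Eb = E[OF assms(9)] and Ec = E[OF assms(10)]
  have nz: "laurent_eval a z + laurent_eval b w \<noteq> 0" if "norm z = 1" "norm w = 1" for z w
  proof
    assume eq: "laurent_eval a z + laurent_eval b w = 0"
    have "laurent_eval a z \<in> op_spectrum p A"
      by (rule laurent_eval_in_op_spectrum[OF p a assms(8,11) that(1)])
    \<comment> \<open>\<open>- B\<close> is itself a compact perturbation of a Toeplitz operator,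
      with symbol -b.\<close>
    moreover have "laurent_eval (\<lambda>k. - b k) w \<in> op_spectrum p (- B)"
    proof (rule laurent_eval_in_op_spectrum[OF p _ _ _ that(2)])
      show "(\<lambda>k. - b k) \<in> wiener" using b by (simp add: wiener_def)
      show "compact_op p (\<lambda>v i. (-1) * E\<^sub>b v i)"
        using Eb by (intro precompact_imp_compact_op[OF p] bounded_op_smult[OF p] precompact_smult[OF p]) auto
      show "op_eq p (- B) (toeplitz (\<lambda>k. - b k) + (\<lambda>v i. (-1) * E\<^sub>b v i))"
        using assms(12) by (auto simp: op_eq_def toeplitz_uminus fun_eq_iff)
    qed
    moreover have "laurent_eval (\<lambda>k. - b k) w = laurent_eval a z"
      using eq by (simp add: laurent_eval_uminus neg_eq_iff_add_eq_0 add.commute)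
    ultimately show False using assms(14) by auto
  qed
  let ?F = "\<lambda>t. laurent_eval a (fst t) + laurent_eval b (snd t)"
  note F = wiener_rep_laurent[OF a b]
  have Fnz: "?F t \<noteq> 0" if "t \<in> torus" for t using nz that by (simp add: torus_def)
  obtain g where g: "wiener_rep g (\<lambda>t. 1 / ?F t)" using wiener_lemma_torus[OF F Fnz] by blast
  \<comment> \<open>The pointwise identity (1 / F) F = 1 on the torus, transferred to coefficients
    by uniqueness.\<close>
  have inv: "push (\<lambda>(k, m). k + m)
      (\<lambda>(k, m). g k * (push (\<lambda>k. (k, 0)) a m + push (\<lambda>l. (0, l)) b m)) = (\<lambda>k. if k = 0 then 1 else 0)"
    by (rule wiener_rep_unique[OF wiener_rep_cong[OF wiener_rep_mult(1)[OF g F]] wiener_rep_const])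
      (use Fnz in simp)
  define y where "y = push (\<lambda>(k, m). fst k + snd k + m) (\<lambda>(k, m). g k * c m)"
  define x where "x = (\<lambda>n. - y n)"
  have x: "x \<in> wiener"
    unfolding x_def wiener_iff abs_summable_uminus y_def
    by (intro abs_summable_push(1) abs_summable_tensor(1) wiener_repD(1)[OF g] c[unfolded wiener_iff])
  have x_eval: "laurent_eval x z = - laurent_eval c z * inverse (laurent_eval a z + laurent_eval b z)"
    if "norm z = 1" for z
    using laurent_eval_push_diagonal[OF g c that]
    by (simp add: x_def y_def laurent_eval_uminus divide_inverse)
  have Tx: "bounded_op p (toeplitz x)" by (rule op_boundD(1)[OF op_bound_toeplitz[OF p x]])
  \<comment> \<open>By the given equation, this residual is minus the sum of
    \<open>E\<^sub>a \<circ> X\<close>, \<open>X \<circ> E\<^sub>b\<close> and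
    \<open>E\<^sub>c\<close>.\<close>
  have "precompact p (\<lambda>v. toeplitz a (X v) + X (toeplitz b v) + toeplitz c v)"
  proof -
    have EX: "bounded_op p (\<lambda>v. E\<^sub>a (X v) + X (E\<^sub>b v))" "precompact p (\<lambda>v. E\<^sub>a (X v) + X (E\<^sub>b v))"
      using Ea Eb X bounded_op_comp[OF p] precompact_comp_right[OF p X, of E\<^sub>a]
        precompact_comp_left[OF p X, of E\<^sub>b]
      by (auto intro!: bounded_op_plus[OF p] precompact_add[OF p])
    have "precompact p (\<lambda>v i. (-1) * ((E\<^sub>a (X v) + X (E\<^sub>b v)) + E\<^sub>c v) i)"
      by (rule precompact_smult[OF p bounded_op_plus[OF p EX(1) conjunct1[OF Ec]]
            precompact_add[OF p EX(1) conjunct1[OF Ec] EX(2) conjunct2[OF Ec]]])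
    then show ?thesis
    proof (rule precompact_cong[OF p])
      fix v assume v: "v \<in> lp p"
      have Xv: "X v \<in> lp p" by (rule bounded_op_lp[OF X v])
      have "B v = toeplitz b v + E\<^sub>b v" using assms(12) v by (simp add: op_eq_def)
      then have "X (B v) = X (toeplitz b v) + X (E\<^sub>b v)"
        using bounded_op_add[OF X op_boundD(3)[OF op_bound_toeplitz[OF p b] v] bounded_op_lp[OF _ v]] Eb
        by simp
      moreover have "A (X v) = toeplitz a (X v) + E\<^sub>a (X v)" using assms(11) Xv by (simp add: op_eq_def)
      moreover have "C v = toeplitz c v + E\<^sub>c v" using assms(13) v by (simp add: op_eq_def)
      moreover have "A (X v) + X (B v) + C v = 0" using assms(16) v by (simp add: op_eq_def)
      ultimately have "(toeplitz a (X v) + X (toeplitz b v) + toeplitz c v)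
          + ((E\<^sub>a (X v) + X (E\<^sub>b v)) + E\<^sub>c v) = 0" by (simp add: algebra_simps)
      then show "toeplitz a (X v) + X (toeplitz b v) + toeplitz c v
          = (\<lambda>i. (-1) * ((E\<^sub>a (X v) + X (E\<^sub>b v)) + E\<^sub>c v) i)"
        by (simp add: fun_eq_iff add_eq_0_iff2)
    qed
  qed
  from precompact_sylvester_solution[OF p a b c X this wiener_repD(1)[OF g] inv]
  have "precompact p (\<lambda>v. X v - toeplitz x v)" by (simp add: x_def y_def)
  then have Ex: "compact_op p (\<lambda>v. X v - toeplitz x v)"
    by (rule precompact_imp_compact_op[OF p bounded_op_minus[OF p X Tx]])
  \<comment> \<open>With X - T(x) as the correction, the terms A T(x) and T(x) B cancel and the
    given equation remains.\<close>
  have "A (X v - toeplitz x v) + (X (B v) - toeplitz x (B v)) + (C v + A (toeplitz x v) + toeplitz x (B v)) = 0"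
    if v: "v \<in> lp p" for v
  proof -
    have "A (X v) + X (B v) + C v = 0" using assms(16) v by (simp add: op_eq_def)
    then show ?thesis
      unfolding bounded_op_diff[OF p Ab bounded_op_lp[OF X v] bounded_op_lp[OF Tx v]]
      by (simp add: algebra_simps)
  qed
  then have corr: "op_eq p ((A \<circ> (\<lambda>v. X v - toeplitz x v)) + ((\<lambda>v. X v - toeplitz x v) \<circ> B)
      + (C + (A \<circ> toeplitz x) + (toeplitz x \<circ> B))) 0"
    by (simp add: op_eq_def)
  have "op_eq p X (toeplitz x + (\<lambda>v. X v - toeplitz x v))" by (simp add: op_eq_def)
  with nz x x_eval Ex corr show ?thesis unfolding Let_def by blast
qed

end
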